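(* Let $g(x)=\sum_{k=1}^N\frac{a_k}{x-iw_k}$ with $a_k,w_k\in\mathbb{C}$, $a_k\ne0$, $\Re w_k\neq 0$, and $\Re w_k\neq\Re w_l$ for $k\neq l$. Then for $\alpha,\beta>0$, the system $\mathcal{G}(g;\alpha,\beta)$ is complete in $L^2(\mathbb{R})$ if and only if $\alpha\beta\le 1$.
   Context: $\mathcal{G}(g;\alpha,\beta)=\{e^{2\pi i\beta n t}g(t-\alpha m)\}_{m,n\in\mathbb{Z}}$. A system is complete in $L^2(\mathbb{R})$ if its closed linear span is $L^2(\mathbb{R})$. *)

theory Defs
  imports "HOL-Analysis.Analysis"
begin

definition gabor_atom :: "(real \<Rightarrow> complex) \<Rightarrow> real \<Rightarrow> real \<Rightarrow> int \<Rightarrow> int \<Rightarrow> real \<Rightarrow> complex" where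
  "gabor_atom g \<alpha> \<beta> m n t = exp (2 * complex_of_real pi * \<i> * complex_of_real (\<beta> * real_of_int n * t))
                               * g (t - \<alpha> * real_of_int m)"

definition square_integrable :: "(real \<Rightarrow> complex) \<Rightarrow> bool" where
  "square_integrable f \<longleftrightarrow> f \<in> borel_measurable lborel \<and> integrable lborel (\<lambda>x. (norm (f x))\<^sup>2)"

definition gabor_complete :: "(real \<Rightarrow> complex) \<Rightarrow> real \<Rightarrow> real \<Rightarrow> bool" where
  "gabor_complete g \<alpha> \<beta> \<longleftrightarrow>
     (\<forall>f. square_integrable f \<longrightarrow>
        (\<forall>\<epsilon>>0. \<exists>S c. finite (S :: (int \<times> int) set) \<and>
           (\<integral>\<^sup>+ x. ennreal ((norm (f x - (\<Sum>(m,n)\<in>S. c (m,n) * gabor_atom g \<alpha> \<beta> m n x)))\<^sup>2) \<partial>lborel)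
             < ennreal \<epsilon>))"

end

theory Submission
  imports Defs "HOL-Probability.Probability" "HOL-Complex_Analysis.Complex_Analysis"
    "HOL-Computational_Algebra.Fundamental_Theorem_Algebra"
begin

text \<open>
  After a dilation \<open>\<alpha> = 1\<close>. On the Fourier side the window becomes a function \<open>kap\<close> that is a sum of
  exponentials on each half-line, and the atoms become \<open>exp (- 2\<pi>imx) kap (x - \<beta>n)\<close> up to phases. As the exponentials
  in \<open>x\<close> have period one, completeness is decided on the fibres \<open>\<xi> + \<int>\<close>: it means that for almost
  every \<open>\<xi>\<close> the sequences \<open>j \<mapsto> kap (\<xi> + j - \<beta>n)\<close>, \<open>n \<in> \<int>\<close>, span a dense subspace of \<open>\<ell>\<^sup>2(\<int>)\<close>.
  A combination that annihilates the finitely many exponentials has finite support, so this is a question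
  of linear algebra. For \<open>\<beta> < 1\<close> there are more shifts than unknowns in a long window, and for generic \<open>\<xi>\<close>
  unit vectors are hit exactly; distinct real parts enter through the dominance of a single
  exponential as \<open>\<xi> \<rightarrow> \<infinity>\<close>. For \<open>\<beta> = 1\<close> the fibre system is a convolution with a nonzero polynomial, whose
  multiples are dense in \<open>\<ell>\<^sup>2\<close>. For \<open>\<beta> > 1\<close> there are fewer shifts than unknowns, and a nonzero finitely supported
  sequence, analytic in \<open>\<xi>\<close>, is orthogonal to all of them. Plancherel's identity is only needed for
  explicit piecewise exponential functions, since the modulated Cauchy kernels already span a dense subspace.
\<close>

subsection \<open>Closed subspaces of square integrable functions\<close>

text \<open>Coefficients that work on one fibre depend on \<xi>, and gluing them directly would call
  for a measurable selection. Instead one coefficient vector is kept on a whole cell of length 1/n: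
  the error is continuous in \<xi>, so the cells on which no single vector works have total length
  tending to 0. The periodic cell indicators come from studying a closed subspace through its
  bounded multipliers: polynomial approximation and bounded limits lead from modulations to
  indicators. The same calculus, with all frequencies, shows that the modulations of one nowhere
  vanishing square integrable function span a dense subspace.

  Terms with \<open>Re (w k)\<close> of different sign live on different half-lines. As every
  one-sided exponential has the same jump at 0, \<open>kap\<close> is nevertheless one analytic
  expression plus a single jump term, and annihilating combinations see only the jump term.

  At \<beta> = 1 a polynomial with a nonzero root has no monomial among its multiples, so unit
  vectors are only approximated there. This is why \<open>good\<close> carries a tolerance, although
  exact solutions exist for almost every \<xi> when \<beta> < 1.\<close>

definition energy :: "(real \<Rightarrow> complex) \<Rightarrow> ennreal" where
  "energy f = (\<integral>\<^sup>+ x. ennreal ((norm (f x))\<^sup>2) \<partial>lborel)"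

lemma square_integrable_iff:
  "square_integrable f \<longleftrightarrow> f \<in> borel_measurable borel \<and> energy f < \<infinity>"
proof -
  have "integrable lborel (\<lambda>x. (norm (f x))\<^sup>2) \<longleftrightarrow> energy f < \<infinity>"
    if [measurable]: "f \<in> borel_measurable borel"
    unfolding integrable_iff_bounded energy_def by simp
  then show ?thesis
    unfolding square_integrable_def by auto
qed

lemma square_integrable_measurable [measurable_dest]:
  "square_integrable f \<Longrightarrow> f \<in> borel_measurable borel"
  by (simp add: square_integrable_iff)

text \<open>The inequality (s + t)^2 \<le> 2 s^2 + 2 t^2 takes the place of Minkowski's: only
  smallness of energies matters later, and no square roots of \<open>ennreal\<close> values
  appear.\<close>

lemma energy_add_le:
  assumes [measurable]: "f \<in> borel_measurable borel" "g \<in> borel_measurable borel"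
  shows "energy (\<lambda>x. f x + g x) \<le> 2 * energy f + 2 * energy g"
proof -
  have *: "ennreal ((norm (f x + g x))\<^sup>2)
      \<le> 2 * ennreal ((norm (f x))\<^sup>2) + 2 * ennreal ((norm (g x))\<^sup>2)" for x
  proof -
    have "(norm (f x + g x))\<^sup>2 \<le> (norm (f x) + norm (g x))\<^sup>2"
      by (intro power_mono norm_triangle_ineq) auto
    also have "\<dots> \<le> 2 * (norm (f x))\<^sup>2 + 2 * (norm (g x))\<^sup>2"
      using sum_squares_bound[of "norm (f x)" "norm (g x)"] by (simp add: power2_sum)
    finally have "ennreal ((norm (f x + g x))\<^sup>2)
        \<le> ennreal (2 * (norm (f x))\<^sup>2 + 2 * (norm (g x))\<^sup>2)"
      by (rule ennreal_leI)
    then show ?thesis by (simp add: ennreal_mult)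
  qed
  have "energy (\<lambda>x. f x + g x)
      \<le> (\<integral>\<^sup>+ x. 2 * ennreal ((norm (f x))\<^sup>2) + 2 * ennreal ((norm (g x))\<^sup>2) \<partial>lborel)"
    unfolding energy_def by (intro nn_integral_mono *)
  also have "\<dots> = 2 * energy f + 2 * energy g"
    unfolding energy_def by (simp add: nn_integral_add nn_integral_cmult)
  finally show ?thesis .
qed

lemma energy_mult_le:
  assumes [measurable]: "f \<in> borel_measurable borel" and B: "\<And>x. norm (m x) \<le> B"
  shows "energy (\<lambda>x. m x * f x) \<le> ennreal (B\<^sup>2) * energy f"
proof -
  have "energy (\<lambda>x. m x * f x) \<le> (\<integral>\<^sup>+ x. ennreal (B\<^sup>2) * ennreal ((norm (f x))\<^sup>2) \<partial>lborel)"
    unfolding energy_def using B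
    by (intro nn_integral_mono)
       (auto simp: norm_mult power_mult_distrib ennreal_mult[symmetric]
             intro!: ennreal_leI mult_right_mono power_mono)
  then show ?thesis
    unfolding energy_def by (simp add: nn_integral_cmult)
qed

lemma square_integrable_add:
  assumes "square_integrable f" "square_integrable g"
  shows "square_integrable (\<lambda>x. f x + g x)"
  using assms energy_add_le[of f g]
  by (auto simp: square_integrable_iff ennreal_mult_less_top intro: le_less_trans)

lemma square_integrable_mult:
  assumes "square_integrable f" "m \<in> borel_measurable borel" "\<And>x. norm (m x) \<le> B"
  shows "square_integrable (\<lambda>x. m x * f x)"
  using assms energy_mult_le[of f m B]
  by (auto simp: square_integrable_iff ennreal_mult_less_top intro: le_less_trans)

lemma square_integrable_cmult:
  "square_integrable f \<Longrightarrow> square_integrable (\<lambda>x. c * f x)"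
  by (rule square_integrable_mult[where B = "norm c"]) auto

lemma square_integrable_0: "square_integrable (\<lambda>x. 0)"
  by (simp add: square_integrable_iff energy_def)

text \<open>Dominated convergence in mean square. The limit inherits the bound |g| almost
  everywhere, so |f - F n| \<le> 2 |g|, whence the majorant 4 |g|^2.\<close>

lemma energy_tendsto_0:
  assumes [measurable]: "\<And>n. F n \<in> borel_measurable borel" "f \<in> borel_measurable borel"
    and lim: "AE x in lborel. (\<lambda>n. F n x) \<longlonglongrightarrow> f x"
    and g: "energy g < \<infinity>" "g \<in> borel_measurable borel"
    and le: "\<And>n x. norm (F n x) \<le> norm (g x)"
  shows "(\<lambda>n. energy (\<lambda>x. f x - F n x)) \<longlonglongrightarrow> 0"
proof -
  note [measurable] = g(2)
  have "(\<lambda>n. (\<integral>\<^sup>+ x. ennreal ((norm (f x - F n x))\<^sup>2) \<partial>lborel)) \<longlonglongrightarrow> (\<integral>\<^sup>+ (x::real). 0 \<partial>lborel)"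
  proof (rule nn_integral_dominated_convergence[where M = lborel and
        u = "\<lambda>n x. ennreal ((norm (f x - F n x))\<^sup>2)" and u' = "\<lambda>x. 0" and
        w = "\<lambda>x. 4 * ennreal ((norm (g x))\<^sup>2)"])
    show "(\<integral>\<^sup>+ x. 4 * ennreal ((norm (g x))\<^sup>2) \<partial>lborel) < \<infinity>"
      using g(1) unfolding energy_def
      by (subst nn_integral_cmult) (auto simp: ennreal_mult_less_top)
    show "AE x in lborel. (\<lambda>n. ennreal ((norm (f x - F n x))\<^sup>2)) \<longlonglongrightarrow> 0"
      using lim
    proof eventually_elim
      case (elim x)
      then have "(\<lambda>n. (norm (f x - F n x))\<^sup>2) \<longlonglongrightarrow> (norm (f x - f x))\<^sup>2"
        by (intro tendsto_intros)
      then show ?case using tendsto_ennrealI by fastforce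
    qed
    show "AE x in lborel. ennreal ((norm (f x - F j x))\<^sup>2) \<le> 4 * ennreal ((norm (g x))\<^sup>2)" for j
      using lim
    proof eventually_elim
      case (elim x)
      have "norm (f x) \<le> norm (g x)"
        using tendsto_norm[OF elim] le by (intro LIMSEQ_le_const2) auto
      then have "norm (f x - F j x) \<le> 2 * norm (g x)"
        using norm_triangle_ineq4[of "f x" "F j x"] le[of j x] by linarith
      then have "(norm (f x - F j x))\<^sup>2 \<le> (2 * norm (g x))\<^sup>2"
        by (intro power_mono) auto
      then have "ennreal ((norm (f x - F j x))\<^sup>2) \<le> ennreal (4 * (norm (g x))\<^sup>2)"
        by (intro ennreal_leI) (simp add: power_mult_distrib)
      then show ?case by (simp add: ennreal_mult)
    qed
  qed auto
  then show ?thesis by (simp add: energy_def)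
qed

text \<open>Members are functions, not classes. The closure axiom nevertheless makes
  \<open>V\<close> invariant under measurable changes on null sets, see
  \<open>cong_AE\<close>.\<close>

locale closed_subspace =
  fixes V :: "(real \<Rightarrow> complex) set"
  assumes sq: "f \<in> V \<Longrightarrow> square_integrable f"
    and zero: "(\<lambda>x. 0) \<in> V"
    and add: "f \<in> V \<Longrightarrow> g \<in> V \<Longrightarrow> (\<lambda>x. f x + g x) \<in> V"
    and cmult: "f \<in> V \<Longrightarrow> (\<lambda>x. c * f x) \<in> V"
    and closed: "square_integrable f \<Longrightarrow>
      (\<And>e. 0 < e \<Longrightarrow> \<exists>v\<in>V. energy (\<lambda>x. f x - v x) < ennreal e) \<Longrightarrow> f \<in> V"
begin

lemma sum:
  assumes "\<And>i. i \<in> I \<Longrightarrow> F i \<in> V"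
  shows "(\<lambda>x. \<Sum>i\<in>I. F i x) \<in> V"
  using assms by (induction I rule: infinite_finite_induct) (auto intro: zero add)

lemma closed_seq:
  assumes f: "square_integrable f" and F: "\<And>n. F n \<in> V"
    and lim: "(\<lambda>n::nat. energy (\<lambda>x. f x - F n x)) \<longlonglongrightarrow> 0"
  shows "f \<in> V"
proof (rule closed[OF f])
  fix e :: real assume "0 < e"
  then have "eventually (\<lambda>n. energy (\<lambda>x. f x - F n x) < ennreal e) sequentially"
    using lim by (intro order_tendstoD) auto
  then show "\<exists>v\<in>V. energy (\<lambda>x. f x - v x) < ennreal e"
    using F by (auto simp: eventually_sequentially)
qed

lemma dominated:
  assumes F: "\<And>n::nat. F n \<in> V" and f: "f \<in> borel_measurable borel"
    and lim: "AE x in lborel. (\<lambda>n. F n x) \<longlonglongrightarrow> f x"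
    and g: "square_integrable g"
    and le: "\<And>n x. norm (F n x) \<le> norm (g x)"
  shows "f \<in> V"
proof -
  note [measurable] = f square_integrable_measurable[OF sq[OF F]] square_integrable_measurable[OF g]
  have "AE x in lborel. ennreal ((norm (f x))\<^sup>2) \<le> ennreal ((norm (g x))\<^sup>2)"
    using lim
  proof eventually_elim
    case (elim x)
    have "norm (f x) \<le> norm (g x)"
      using tendsto_norm[OF elim] le by (intro LIMSEQ_le_const2) auto
    then show ?case by (intro ennreal_leI power_mono) auto
  qed
  then have "energy f \<le> energy g"
    unfolding energy_def by (rule nn_integral_mono_AE)
  then have "square_integrable f"
    using g f by (auto simp: square_integrable_iff)
  moreover have "(\<lambda>n. energy (\<lambda>x. f x - F n x)) \<longlonglongrightarrow> 0"
    using g by (intro energy_tendsto_0[OF square_integrable_measurable[OF sq[OF F]] f lim _ _ le])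
      (simp_all add: square_integrable_iff)
  ultimately show ?thesis by (rule closed_seq[OF _ F])
qed

lemma cong_AE:
  assumes "f \<in> V" "g \<in> borel_measurable borel" "AE x in lborel. f x = g x"
  shows "g \<in> V"
  using assms by (intro dominated[of "\<lambda>_. f" g f]) (auto intro: sq)

text \<open>Multiplication by a bounded function is continuous for the energy, so the preimage of a
  closed subspace is closed. Hence the multiplier property can be tested on the generators of a
  closed span.\<close>

lemma multiplier_preimage:
  assumes m: "m \<in> borel_measurable borel" "\<And>x. norm (m x) \<le> B"
  shows "closed_subspace {f. square_integrable f \<and> (\<lambda>x. m x * f x) \<in> V}"
proof
  fix f assume f: "square_integrable f"
    and *: "\<And>e. 0 < e \<Longrightarrow> \<exists>v\<in>{f. square_integrable f \<and> (\<lambda>x. m x * f x) \<in> V}.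
      energy (\<lambda>x. f x - v x) < ennreal e"
  have "(\<lambda>x. m x * f x) \<in> V"
  proof (rule closed)
    show "square_integrable (\<lambda>x. m x * f x)"
      by (rule square_integrable_mult[OF f m])
    fix e :: real assume "0 < e"
    \<comment> \<open>The summand 1 keeps the denominator positive when B = 0.\<close>
    define d where "d = e / (B\<^sup>2 + 1)"
    have "0 < B\<^sup>2 + 1" by (metis add.commute add_pos_nonneg zero_le_power2 zero_less_one)
    then have d: "0 < d" and Bd: "B\<^sup>2 * d < e"
      using \<open>0 < e\<close> by (auto simp: d_def field_simps)
    obtain v where v: "square_integrable v" "(\<lambda>x. m x * v x) \<in> V"
      "energy (\<lambda>x. f x - v x) < ennreal d" using *[OF d] by auto
    have "energy (\<lambda>x. m x * f x - m x * v x) = energy (\<lambda>x. m x * (f x - v x))"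
      by (simp add: algebra_simps)
    also have "\<dots> \<le> ennreal (B\<^sup>2) * energy (\<lambda>x. f x - v x)"
      using f v by (intro energy_mult_le m) (auto dest!: square_integrable_measurable)
    also have "\<dots> \<le> ennreal (B\<^sup>2) * ennreal d"
      using v(3) by (intro mult_left_mono) auto
    also have "\<dots> = ennreal (B\<^sup>2 * d)" using d by (simp add: ennreal_mult)
    also have "\<dots> < ennreal e" using Bd \<open>0 < e\<close> by (simp add: ennreal_less_iff d less_imp_le)
    finally show "\<exists>v\<in>V. energy (\<lambda>x. m x * f x - v x) < ennreal e" using v(2) by auto
  qed
  with f show "f \<in> {f. square_integrable f \<and> (\<lambda>x. m x * f x) \<in> V}" by simp
next
  fix f c assume "f \<in> {f. square_integrable f \<and> (\<lambda>x. m x * f x) \<in> V}"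
  then show "(\<lambda>x. c * f x) \<in> {f. square_integrable f \<and> (\<lambda>x. m x * f x) \<in> V}"
    using cmult[of "\<lambda>x. m x * f x" c] by (auto intro: square_integrable_cmult simp: mult.left_commute)
qed (auto simp: distrib_left square_integrable_0 zero intro: square_integrable_add add)

section \<open>Bounded multipliers of a closed subspace\<close>

definition multipliers :: "(real \<Rightarrow> complex) set" where
  "multipliers = {m. m \<in> borel_measurable borel \<and> (\<exists>B. \<forall>x. norm (m x) \<le> B) \<and>
     (\<forall>f\<in>V. (\<lambda>x. m x * f x) \<in> V)}"

lemma multipliers_const: "(\<lambda>x. c) \<in> multipliers"
  by (auto simp: multipliers_def intro: cmult)

lemma multipliers_add:
  assumes "m \<in> multipliers" "m' \<in> multipliers"
  shows "(\<lambda>x. m x + m' x) \<in> multipliers"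
proof -
  obtain B B' where "\<And>x. norm (m x) \<le> B" "\<And>x. norm (m' x) \<le> B'"
    using assms unfolding multipliers_def by auto
  then have "norm (m x + m' x) \<le> B + B'" for x
    by (meson add_mono norm_triangle_le order_trans)
  then show ?thesis
    using assms unfolding multipliers_def by (auto simp: distrib_right intro: add)
qed

lemma multipliers_mult:
  assumes "m \<in> multipliers" "m' \<in> multipliers"
  shows "(\<lambda>x. m x * m' x) \<in> multipliers"
proof -
  obtain B B' where "\<And>x. norm (m x) \<le> B" "\<And>x. norm (m' x) \<le> B'"
    using assms unfolding multipliers_def by auto
  then have "norm (m x * m' x) \<le> B * B'" for x
    using order_trans[OF norm_ge_zero] by (fastforce simp: norm_mult intro!: mult_mono)
  then show ?thesis
    using assms unfolding multipliers_def by (auto simp: mult.assoc)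
qed

lemma multipliers_diff:
  assumes "m \<in> multipliers" "m' \<in> multipliers"
  shows "(\<lambda>x. m x - m' x) \<in> multipliers"
  using multipliers_add[OF assms(1) multipliers_mult[OF multipliers_const[of "-1"] assms(2)]] by simp

lemma multipliers_dominated:
  assumes m: "\<And>n::nat. m n \<in> multipliers" and B: "\<And>n x. norm (m n x) \<le> B"
    and lim: "\<And>x. (\<lambda>n. m n x) \<longlonglongrightarrow> l x"
  shows "l \<in> multipliers"
proof -
  have mm: "m n \<in> borel_measurable borel" for n
    using m by (auto simp: multipliers_def)
  have l [measurable]: "l \<in> borel_measurable borel"
    by (rule borel_measurable_LIMSEQ_metric[OF mm]) (rule lim)
  have "norm (l x) \<le> B" for x
    by (rule LIMSEQ_le_const2[OF tendsto_norm[OF lim]]) (use B in auto)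
  moreover have "(\<lambda>x. l x * f x) \<in> V" if f: "f \<in> V" for f
  proof (rule dominated[where F = "\<lambda>n x. m n x * f x" and g = "\<lambda>x. of_real \<bar>B\<bar> * f x"])
    show "(\<lambda>x. l x * f x) \<in> borel_measurable borel"
      using square_integrable_measurable[OF sq[OF f]] by measurable
    show "square_integrable (\<lambda>x. of_real \<bar>B\<bar> * f x)"
      by (intro square_integrable_cmult sq f)
    show "norm (m n x * f x) \<le> norm (of_real \<bar>B\<bar> * f x)" for n x
      using B[of n x] by (simp add: norm_mult mult_right_mono)
    show "(\<lambda>x. m n x * f x) \<in> V" for n using m f by (auto simp: multipliers_def)
    show "AE x in lborel. (\<lambda>n. m n x * f x) \<longlonglongrightarrow> l x * f x"
      by (intro AE_I2 tendsto_mult lim tendsto_const)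
  qed
  ultimately show ?thesis unfolding multipliers_def by (auto intro: l)
qed

lemma multipliers_sum:
  assumes "\<And>i. i \<in> I \<Longrightarrow> m i \<in> multipliers"
  shows "(\<lambda>x. \<Sum>i\<in>I. m i x) \<in> multipliers"
  using assms
  by (induction I rule: infinite_finite_induct) (auto intro: multipliers_const multipliers_add)

text \<open>Continuous functional calculus: multipliers form an algebra with constants, so
  polynomials in the bounded function u are multipliers, and Weierstrass approximation on [-B, B]
  gives h(u) as a bounded limit.\<close>

lemma multipliers_continuous:
  fixes u :: "real \<Rightarrow> real" and h :: "real \<Rightarrow> real"
  assumes u: "(\<lambda>x. of_real (u x)) \<in> multipliers" and h: "continuous_on UNIV h"
  shows "(\<lambda>x. of_real (h (u x))) \<in> multipliers"
proof -
  obtain B where B: "\<And>x. \<bar>u x\<bar> \<le> B" using u by (auto simp: multipliers_def)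
  have poly: "(\<lambda>x. of_real (g (u x))) \<in> multipliers" if "real_polynomial_function g" for g
    using that
  proof induction
    case (linear f)
    then have "f y = y * f 1" for y
      using linear_scale[OF bounded_linear.linear[OF linear], of y 1] by simp
    then have "(\<lambda>x. of_real (f (u x))) = (\<lambda>x. of_real (u x) * complex_of_real (f 1))"
      by (metis of_real_mult)
    then show ?case using multipliers_mult[OF u multipliers_const] by simp
  qed (auto intro: multipliers_const multipliers_add multipliers_mult)
  have "\<exists>g. real_polynomial_function g \<and> (\<forall>x\<in>{-B..B}. \<bar>h x - g x\<bar> < inverse (Suc n))" for n
    by (rule Stone_Weierstrass_real_polynomial_function[of "{-B..B}" h "inverse (Suc n)"])
       (use h continuous_on_subset in auto)
  then obtain g where g: "\<And>n. real_polynomial_function (g n)"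
    "\<And>n x. x \<in> {-B..B} \<Longrightarrow> \<bar>h x - g n x\<bar> < inverse (Suc n)" by metis
  have g': "\<bar>h (u x) - g n (u x)\<bar> < inverse (Suc n)" for n x
    using B[of x] by (intro g(2)) (auto simp: abs_le_iff)
  have "compact (h ` {-B..B})" using h by (intro compact_continuous_image continuous_on_subset[OF h]) auto
  then obtain C where C: "\<And>y. y \<in> {-B..B} \<Longrightarrow> norm (h y) \<le> C"
    using compact_imp_bounded bounded_iff by (metis imageI)
  show ?thesis
  proof (rule multipliers_dominated[where m = "\<lambda>n x. of_real (g n (u x))"])
    show "(\<lambda>x. complex_of_real (g n (u x))) \<in> multipliers" for n by (intro poly g)
    \<comment> \<open>A uniform bound for all n: the approximation error inverse (Suc n) never
      exceeds 1.\<close>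
    show "norm (complex_of_real (g n (u x))) \<le> C + 1" for n x
    proof -
      have "inverse (real (Suc n)) \<le> 1" by (simp add: field_simps)
      moreover have "\<bar>h (u x)\<bar> \<le> C" using C[of "u x"] B[of x] by (auto simp: abs_le_iff)
      ultimately show ?thesis using g'[of x n] unfolding norm_of_real by linarith
    qed
    show "(\<lambda>n. complex_of_real (g n (u x))) \<longlonglongrightarrow> of_real (h (u x))" for x
    proof (rule tendsto_of_real, rule LIM_zero_cancel)
      show "(\<lambda>n. g n (u x) - h (u x)) \<longlonglongrightarrow> 0"
        by (rule Lim_null_comparison[OF _ LIMSEQ_inverse_real_of_nat])
           (use g' in \<open>auto intro!: always_eventually less_imp_le simp: abs_minus_commute\<close>)
    qed
  qed
qed

text \<open>The continuous ramps min 1 (n max(0, y)) tend to the indicator of y > 0 while staying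
  between 0 and 1.\<close>

lemma multipliers_indicator_pos:
  fixes u :: "real \<Rightarrow> real"
  assumes u: "(\<lambda>x. of_real (u x)) \<in> multipliers"
  shows "indicator {x. 0 < u x} \<in> multipliers"
proof (rule multipliers_dominated)
  show "(\<lambda>x. complex_of_real (min 1 (real n * max 0 (u x)))) \<in> multipliers" for n
    by (rule multipliers_continuous[OF u, of "\<lambda>y. min 1 (real n * max 0 y)"])
      (intro continuous_intros)
  show "norm (complex_of_real (min 1 (real n * max 0 (u x)))) \<le> 1" for n x
    unfolding norm_of_real by auto
  show "(\<lambda>n. complex_of_real (min 1 (real n * max 0 (u x)))) \<longlonglongrightarrow> indicator {x. 0 < u x} x" for x
  proof (cases "0 < u x")
    case True
    obtain n0 where n0: "1 / u x < real n0" using reals_Archimedean2 by blast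
    have "min 1 (real n * max 0 (u x)) = 1" if "n \<ge> n0" for n
    proof -
      have "1 / u x < real n" using n0 that by linarith
      then show ?thesis using True by (simp add: field_simps min_def)
    qed
    then have "eventually (\<lambda>n. complex_of_real (min 1 (real n * max 0 (u x))) = 1) sequentially"
      by (intro eventually_sequentiallyI[of n0]) (metis of_real_1)
    then show ?thesis using True by (simp add: tendsto_eventually)
  qed (simp add: max_def)
qed

lemma multipliers_cos:
  assumes "(\<lambda>x. cis (a * x)) \<in> multipliers" "(\<lambda>x. cis (- (a * x))) \<in> multipliers"
  shows "(\<lambda>x. of_real (cos (a * (x - b)))) \<in> multipliers"
proof -
  have "complex_of_real (cos (a * (x - b))) = cis (a * x) * (cis (- (a * b)) / 2)
       + cis (- (a * x)) * (cis (a * b) / 2)" for x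
  proof -
    have "complex_of_real (cos y) = (cis y + cis (- y)) / 2" for y
      by (simp add: complex_eq_iff)
    from this[of "a * (x - b)"] show ?thesis
      by (simp add: cis_mult add_divide_distrib algebra_simps)
  qed
  then show ?thesis
    using multipliers_add[OF multipliers_mult[OF assms(1) multipliers_const]
        multipliers_mult[OF assms(2) multipliers_const],
        of "cis (- (a * b)) / 2" "cis (a * b) / 2"] by simp
qed

text \<open>A superlevel set of a cosine is a periodic union of intervals. With a = 2 pi this yields
  the periodic cells; with a tending to 0 it isolates a single interval.\<close>

lemma multipliers_indicator_cos:
  assumes "(\<lambda>x. cis (a * x)) \<in> multipliers" "(\<lambda>x. cis (- (a * x))) \<in> multipliers"
  shows "indicator {x. cos (a * (x - b)) > c} \<in> multipliers"
  using multipliers_indicator_pos[of "\<lambda>x. cos (a * (x - b)) - c"]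
    multipliers_diff[OF multipliers_cos[OF assms] multipliers_const[of "of_real c"]]
  by simp

end

section \<open>Closed linear spans of families\<close>

definition span_closure :: "('i \<Rightarrow> real \<Rightarrow> complex) \<Rightarrow> (real \<Rightarrow> complex) set" where
  "span_closure \<Phi> = {f. square_integrable f \<and>
     (\<forall>e>0. \<exists>S c. finite S \<and> energy (\<lambda>x. f x - (\<Sum>i\<in>S. c i * \<Phi> i x)) < ennreal e)}"

lemma square_integrable_sum:
  assumes "\<And>i. i \<in> S \<Longrightarrow> square_integrable (F i)"
  shows "square_integrable (\<lambda>x. \<Sum>i\<in>S. F i x)"
  using assms
  by (induction S rule: infinite_finite_induct) (auto intro: square_integrable_0 square_integrable_add)

lemma two_ennreal_lt:
  assumes "a < ennreal (e / 4)" "b < ennreal (e / 4)"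
  shows "2 * a + 2 * b < ennreal e"
proof -
  have "0 < e" using assms(1) by (metis divide_pos_pos divide_nonpos_pos ennreal_neg leI not_less_zero zero_less_numeral)
  have "2 * a + 2 * b < 2 * ennreal (e / 4) + 2 * ennreal (e / 4)"
    using assms by (intro add_strict_mono ennreal_mult_strict_left_mono) auto
  also have "\<dots> = ennreal e"
  proof -
    have "ennreal e = ennreal (2 * (e / 4) + 2 * (e / 4))" by simp
    also have "\<dots> = ennreal (2 * (e / 4)) + ennreal (2 * (e / 4))"
      using \<open>0 < e\<close> by (intro ennreal_plus) auto
    also have "ennreal (2 * (e / 4)) = 2 * ennreal (e / 4)"
      using \<open>0 < e\<close> by (subst ennreal_mult) auto
    finally show ?thesis by simp
  qed
  finally show ?thesis .
qed

lemma closed_subspace_span_closure: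
  assumes \<Phi>: "\<And>i. square_integrable (\<Phi> i)"
  shows "closed_subspace (span_closure \<Phi>)"
proof
  have comb: "square_integrable (\<lambda>x. \<Sum>i\<in>S. c i * \<Phi> i x)" for S and c :: "'a \<Rightarrow> complex"
    by (intro square_integrable_sum square_integrable_cmult \<Phi>)
  note [measurable] = square_integrable_measurable[OF comb]
  show "(\<lambda>x. 0) \<in> span_closure \<Phi>"
    unfolding span_closure_def
    by (auto simp: square_integrable_0 energy_def intro!: exI[of _ "{}"])
  show "(\<lambda>x. f x + g x) \<in> span_closure \<Phi>" if f: "f \<in> span_closure \<Phi>" and g: "g \<in> span_closure \<Phi>" for f g
    unfolding span_closure_def
  proof (safe)
    show "square_integrable (\<lambda>x. f x + g x)"
      using f g by (auto simp: span_closure_def intro: square_integrable_add)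
    have [measurable]: "f \<in> borel_measurable borel" "g \<in> borel_measurable borel"
      using f g by (auto simp: span_closure_def square_integrable_iff)
    fix e :: real assume "0 < e"
    \<comment> \<open>Two errors, each doubled by \<open>energy_add_le\<close>, have to fit into
      e.\<close>
    then have "0 < e / 4" by simp
    then obtain S c S' c' where S: "finite S" "finite S'"
      and 1: "energy (\<lambda>x. f x - (\<Sum>i\<in>S. c i * \<Phi> i x)) < ennreal (e / 4)"
      and 2: "energy (\<lambda>x. g x - (\<Sum>i\<in>S'. c' i * \<Phi> i x)) < ennreal (e / 4)"
      using f g unfolding span_closure_def by blast
    \<comment> \<open>Extending both coefficient functions by zero lets indices in both S and S'
      collect both contributions.\<close>
    define d where "d i = (if i \<in> S then c i else 0) + (if i \<in> S' then c' i else 0)" for i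
    have "(\<Sum>i\<in>S. c i * \<Phi> i x) = (\<Sum>i\<in>S \<union> S'. (if i \<in> S then c i else 0) * \<Phi> i x)"
         "(\<Sum>i\<in>S'. c' i * \<Phi> i x) = (\<Sum>i\<in>S \<union> S'. (if i \<in> S' then c' i else 0) * \<Phi> i x)" for x
      using S by (auto intro!: sum.mono_neutral_cong_left)
    then have eq: "f x + g x - (\<Sum>i\<in>S \<union> S'. d i * \<Phi> i x)
      = (f x - (\<Sum>i\<in>S. c i * \<Phi> i x)) + (g x - (\<Sum>i\<in>S'. c' i * \<Phi> i x))" for x
      by (simp add: d_def distrib_right sum.distrib)
    have "energy (\<lambda>x. f x + g x - (\<Sum>i\<in>S \<union> S'. d i * \<Phi> i x))
      \<le> 2 * energy (\<lambda>x. f x - (\<Sum>i\<in>S. c i * \<Phi> i x)) + 2 * energy (\<lambda>x. g x - (\<Sum>i\<in>S'. c' i * \<Phi> i x))"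
      unfolding eq by (rule energy_add_le) measurable
    also have "\<dots> < ennreal e" by (rule two_ennreal_lt[OF 1 2])
    finally show "\<exists>S c. finite S \<and> energy (\<lambda>x. f x + g x - (\<Sum>i\<in>S. c i * \<Phi> i x)) < ennreal e"
      using S by blast
  qed
  show "(\<lambda>x. k * f x) \<in> span_closure \<Phi>" if f: "f \<in> span_closure \<Phi>" for f k
    unfolding span_closure_def
  proof (safe)
    show "square_integrable (\<lambda>x. k * f x)"
      using f by (auto simp: span_closure_def intro: square_integrable_cmult)
    have [measurable]: "f \<in> borel_measurable borel"
      using f by (auto simp: span_closure_def square_integrable_iff)
    fix e :: real assume "0 < e"
    define d where "d = e / ((norm k)\<^sup>2 + 1)"
    have "0 < (norm k)\<^sup>2 + 1" by (metis add.commute add_pos_nonneg zero_le_power2 zero_less_one)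
    then have d: "0 < d" and kd: "(norm k)\<^sup>2 * d < e"
      using \<open>0 < e\<close> by (auto simp: d_def field_simps)
    then obtain S c where S: "finite S"
      and 1: "energy (\<lambda>x. f x - (\<Sum>i\<in>S. c i * \<Phi> i x)) < ennreal d"
      using f unfolding span_closure_def by blast
    have "energy (\<lambda>x. k * f x - (\<Sum>i\<in>S. (k * c i) * \<Phi> i x))
      = energy (\<lambda>x. k * (f x - (\<Sum>i\<in>S. c i * \<Phi> i x)))"
      by (simp add: right_diff_distrib sum_distrib_left mult.assoc)
    also have "\<dots> \<le> ennreal ((norm k)\<^sup>2) * energy (\<lambda>x. f x - (\<Sum>i\<in>S. c i * \<Phi> i x))"
      by (rule energy_mult_le) auto
    also have "\<dots> \<le> ennreal ((norm k)\<^sup>2) * ennreal d"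
      using 1 by (intro mult_left_mono) auto
    also have "\<dots> = ennreal ((norm k)\<^sup>2 * d)" using d by (simp add: ennreal_mult)
    also have "\<dots> < ennreal e" using kd \<open>0 < e\<close> d by (simp add: ennreal_less_iff)
    finally show "\<exists>S c. finite S \<and> energy (\<lambda>x. k * f x - (\<Sum>i\<in>S. c i * \<Phi> i x)) < ennreal e"
      using S by (auto intro!: exI[of _ S] exI[of _ "\<lambda>i. k * c i"])
  qed
  show "f \<in> span_closure \<Phi>" if f: "square_integrable f"
    and *: "\<And>e. 0 < e \<Longrightarrow> \<exists>v\<in>span_closure \<Phi>. energy (\<lambda>x. f x - v x) < ennreal e" for f
    unfolding span_closure_def
  proof (safe intro!: f)
    fix e :: real assume "0 < e"
    then have e: "0 < e / 4" by simp
    obtain v where v: "v \<in> span_closure \<Phi>" and 1: "energy (\<lambda>x. f x - v x) < ennreal (e / 4)"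
      using *[OF e] by auto
    obtain S c where S: "finite S" and 2: "energy (\<lambda>x. v x - (\<Sum>i\<in>S. c i * \<Phi> i x)) < ennreal (e / 4)"
      using v e unfolding span_closure_def by blast
    have [measurable]: "f \<in> borel_measurable borel" "v \<in> borel_measurable borel"
      using f v by (auto simp: span_closure_def square_integrable_iff)
    have eq: "f x - (\<Sum>i\<in>S. c i * \<Phi> i x) = (f x - v x) + (v x - (\<Sum>i\<in>S. c i * \<Phi> i x))" for x
      by simp
    have "energy (\<lambda>x. f x - (\<Sum>i\<in>S. c i * \<Phi> i x))
      \<le> 2 * energy (\<lambda>x. f x - v x) + 2 * energy (\<lambda>x. v x - (\<Sum>i\<in>S. c i * \<Phi> i x))"
      by (subst eq, rule energy_add_le) measurable
    also have "\<dots> < ennreal e" by (rule two_ennreal_lt[OF 1 2])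
    finally show "\<exists>S c. finite S \<and> energy (\<lambda>x. f x - (\<Sum>i\<in>S. c i * \<Phi> i x)) < ennreal e"
      using S by blast
  qed
qed (auto simp: span_closure_def)

lemma span_closure_base:
  assumes "square_integrable (\<Phi> i)"
  shows "\<Phi> i \<in> span_closure \<Phi>"
  unfolding span_closure_def
  by (auto simp: assms energy_def intro!: exI[of _ "{i}"] exI[of _ "\<lambda>_. 1"])

lemma span_closure_minimal:
  assumes V: "closed_subspace V" and "\<And>i. \<Phi> i \<in> V"
  shows "span_closure \<Phi> \<subseteq> V"
proof
  fix f assume f: "f \<in> span_closure \<Phi>"
  show "f \<in> V"
  proof (rule closed_subspace.closed[OF V])
    fix e :: real assume "0 < e"
    then obtain S c where "energy (\<lambda>x. f x - (\<Sum>i\<in>S. c i * \<Phi> i x)) < ennreal e"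
      using f unfolding span_closure_def by blast
    then show "\<exists>v\<in>V. energy (\<lambda>x. f x - v x) < ennreal e"
      using closed_subspace.sum[OF V, of S "\<lambda>i x. c i * \<Phi> i x"] closed_subspace.cmult[OF V] assms(2)
      by auto
  qed (use f in \<open>simp add: span_closure_def\<close>)
qed

lemma gabor_complete_iff:
  "gabor_complete g \<alpha> \<beta> \<longleftrightarrow>
     (\<forall>f. square_integrable f \<longrightarrow> f \<in> span_closure (\<lambda>(m, n). gabor_atom g \<alpha> \<beta> m n))"
  unfolding gabor_complete_def span_closure_def energy_def by (simp add: split_beta')

lemma cos_less_cos_iff:
  assumes "\<bar>y\<bar> \<le> pi" "0 \<le> z" "z \<le> pi"
  shows "cos z < cos y \<longleftrightarrow> \<bar>y\<bar> < z"
  using cos_mono_less_eq[of z "\<bar>y\<bar>"] cos_mono_less_eq[of "\<bar>y\<bar>" z] assms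
  by (cases "\<bar>y\<bar> = z") (auto simp: cos_abs_real)

context closed_subspace
begin

text \<open>The functions that m maps into V form a closed subspace by
  \<open>multiplier_preimage\<close>; once it contains the generators it contains V.\<close>

lemma span_closure_multiplier:
  assumes V: "V = span_closure \<Phi>" and m: "m \<in> borel_measurable borel" "\<And>x. norm (m x) \<le> B"
    and \<Phi>: "\<And>i. square_integrable (\<Phi> i)" "\<And>i. (\<lambda>x. m x * \<Phi> i x) \<in> V"
  shows "m \<in> multipliers"
  using span_closure_minimal[OF multiplier_preimage[OF m], of \<Phi>] \<Phi> m
  unfolding multipliers_def V[symmetric] by auto

text \<open>The superlevel set \<open>A n\<close> is {a<..<b} together with its translates by
  multiples of the period \<open>T n\<close>. As the period grows, the translates leave every fixed
  point.\<close>

lemma multipliers_indicator_interval: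
  assumes cis: "\<And>a. (\<lambda>x. cis (a * x)) \<in> multipliers"
  shows "indicator {a<..<b} \<in> multipliers"
proof (cases "a < b")
  case True
  \<comment> \<open>A period of at least b - a keeps the angle pi (b - a) / T n within [0, pi],
    where cosine is monotone.\<close>
  define T where "T n = b - a + real n" for n
  define M where "M = (a + b) / 2"
  define A where "A n = {x. cos (2 * pi / T n * (x - M)) > cos (pi * (b - a) / T n)}" for n
  have T: "0 < T n" "b - a \<le> T n" for n using True by (auto simp: T_def)
  show ?thesis
  proof (rule multipliers_dominated)
    show "indicator (A n) \<in> multipliers" for n
      unfolding A_def using cis[of "2 * pi / T n"] cis[of "- (2 * pi / T n)"]
      by (intro multipliers_indicator_cos) auto
    show "norm (indicator (A n) x :: complex) \<le> 1" for n x
      by (simp add: indicator_def)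
    show "(\<lambda>n. indicator (A n) x) \<longlonglongrightarrow> (indicator {a<..<b} x :: complex)" for x
    proof (rule tendsto_eventually, rule eventually_sequentiallyI)
      fix n assume n: "nat \<lceil>2 * \<bar>x - M\<bar>\<rceil> \<le> n"
      then have "2 * \<bar>x - M\<bar> \<le> T n" using True unfolding T_def by linarith
      then have "pi * (2 * \<bar>x - M\<bar>) \<le> pi * T n" by (intro mult_left_mono) auto
      moreover have abs_eq: "\<bar>2 * pi / T n * (x - M)\<bar> = pi * (2 * \<bar>x - M\<bar>) / T n"
        using T(1)[of n] by (simp add: abs_mult)
      ultimately have "\<bar>2 * pi / T n * (x - M)\<bar> \<le> pi"
        using T(1)[of n] by (simp add: divide_le_eq)
      moreover have "pi * (b - a) / T n \<le> pi"
        using mult_left_mono[OF T(2)[of n], of pi] T(1)[of n] by (simp add: divide_le_eq)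
      ultimately have "x \<in> A n \<longleftrightarrow> \<bar>2 * pi / T n * (x - M)\<bar> < pi * (b - a) / T n"
        unfolding A_def using True T(1)[of n] by (subst mem_Collect_eq, intro cos_less_cos_iff) auto
      also have "\<dots> \<longleftrightarrow> 2 * \<bar>x - M\<bar> < b - a"
        unfolding abs_eq using T(1)[of n] by (simp add: divide_less_cancel)
      also have "\<dots> \<longleftrightarrow> x \<in> {a<..<b}"
        unfolding M_def by (auto simp: abs_if field_simps)
      finally show "indicator (A n) x = (indicator {a<..<b} x :: complex)"
        by (simp add: indicator_def)
    qed
  qed
next
  case False
  then have "indicator {a<..<b} = (\<lambda>x. 0 :: complex)" by (auto simp: fun_eq_iff indicator_def)
  then show ?thesis using multipliers_const by simp
qed

text \<open>Sets whose indicators are multipliers form a sigma-algebra: sums, differences and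
  products give complements and finite unions, bounded pointwise limits give countable
  unions.\<close>

lemma multipliers_indicator_borel:
  assumes cis: "\<And>a. (\<lambda>x. cis (a * x)) \<in> multipliers" and A: "A \<in> sets borel"
  shows "indicator A \<in> multipliers"
proof -
  have "A \<in> sigma_sets UNIV (range (\<lambda>(a, b). {a<..<b::real}))"
    using A unfolding borel_eq_box box_real by simp
  then show ?thesis
  proof induction
    case (Basic a)
    then show ?case using multipliers_indicator_interval[OF cis] by auto
  next
    case Empty
    then show ?case using multipliers_const[of 0] by (simp add: indicator_def[abs_def])
  next
    case (Compl a)
    have "indicator (UNIV - a) = (\<lambda>x. 1 - indicator a x :: complex)"
      by (auto simp: indicator_def)
    then show ?case using multipliers_diff[OF multipliers_const[of 1] Compl.IH] by simp
  next
    case (Union a)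
    have fin: "indicator (\<Union>i<n. a i) \<in> multipliers" for n :: nat
    proof (induction n)
      case 0
      then show ?case using multipliers_const[of 0] by (simp add: indicator_def[abs_def])
    next
      case (Suc n)
      have "indicator (\<Union>i<Suc n. a i) = (\<lambda>x. indicator (\<Union>i<n. a i) x
          + (indicator (a n) x - indicator (\<Union>i<n. a i) x * indicator (a n) x) :: complex)"
        by (auto simp: fun_eq_iff indicator_def less_Suc_eq)
      then show ?case
        using multipliers_add[OF Suc multipliers_diff[OF Union.IH multipliers_mult[OF Suc Union.IH]]]
        by simp
    qed
    show ?case
    proof (rule multipliers_dominated[OF fin])
      show "norm (indicator (\<Union>i<n. a i) x :: complex) \<le> 1" for n x
        by (simp add: indicator_def)
      show "(\<lambda>n. indicator (\<Union>i<n. a i) x) \<longlonglongrightarrow> (indicator (\<Union> (range a)) x :: complex)" for x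
      proof (cases "x \<in> \<Union> (range a)")
        case True
        then obtain i where "x \<in> a i" by auto
        then have "eventually (\<lambda>n. indicator (\<Union>i<n. a i) x = (1 :: complex)) sequentially"
          by (intro eventually_sequentiallyI[of "Suc i"]) (auto simp: indicator_def)
        then show ?thesis using True by (simp add: tendsto_eventually)
      qed (auto simp: indicator_def)
    qed
  qed
qed

text \<open>Write f = (f / \<phi>) \<phi> and approximate the possibly unbounded quotient by simple
  functions, which are multipliers by \<open>multipliers_indicator_borel\<close>. It is later
  applied to a Cauchy kernel and its modulations.\<close>

lemma eq_all_square_integrable:
  assumes cis: "\<And>a. (\<lambda>x. cis (a * x)) \<in> multipliers"
    and \<phi>: "\<phi> \<in> V" "\<And>x. \<phi> x \<noteq> 0" and f: "square_integrable f"
  shows "f \<in> V"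
proof -
  have [measurable]: "f \<in> borel_measurable borel" "\<phi> \<in> borel_measurable borel"
    using square_integrable_measurable[OF f] square_integrable_measurable[OF sq[OF \<phi>(1)]] by auto
  have "(\<lambda>x. f x / \<phi> x) \<in> borel_measurable borel" by measurable
  \<comment> \<open>The bound by 2 |f / \<phi>| turns, after multiplication by \<phi>, into the
    square integrable majorant 2 |f|.\<close>
  from borel_measurable_implies_sequence_metric[OF this, of 0] obtain s
    where s: "\<And>n. simple_function borel (s n)" "\<And>x. (\<lambda>n. s n x) \<longlonglongrightarrow> f x / \<phi> x"
      "\<And>n x. norm (s n x) \<le> 2 * norm (f x / \<phi> x)" by auto
  show ?thesis
  proof (rule dominated[where F = "\<lambda>n x. s n x * \<phi> x" and g = "\<lambda>x. 2 * f x"])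
    fix n
    have fin: "finite (range (s n))" using simple_functionD(1)[OF s(1)[of n]] by simp
    have "s n x = (\<Sum>y\<in>range (s n). y * indicator (s n -` {y}) x)" for x
    proof -
      have "(\<Sum>y\<in>range (s n). y * indicator (s n -` {y}) x) = (\<Sum>y\<in>range (s n). if y = s n x then y else 0)"
        by (intro sum.cong) (auto simp: indicator_def)
      also have "\<dots> = s n x" using fin by (subst sum.delta) auto
      finally show ?thesis by simp
    qed
    then have eq: "s n = (\<lambda>x. \<Sum>y\<in>range (s n). y * indicator (s n -` {y}) x)" ..
    have ind: "(\<lambda>x. y * indicator (s n -` {y}) x) \<in> multipliers" for y
    proof -
      have "s n -` {y} \<in> sets borel" using simple_functionD(2)[OF s(1)[of n]] by simp
      note * = multipliers_indicator_borel[OF cis this]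
      show ?thesis using multipliers_mult[OF multipliers_const[of y] *] .
    qed
    have "(\<lambda>x. \<Sum>y\<in>range (s n). y * indicator (s n -` {y}) x) \<in> multipliers"
      by (rule multipliers_sum) (rule ind)
    then have "s n \<in> multipliers" by (subst eq)
    then show "(\<lambda>x. s n x * \<phi> x) \<in> V" using \<phi>(1) by (auto simp: multipliers_def)
  next
    show "AE x in lborel. (\<lambda>n. s n x * \<phi> x) \<longlonglongrightarrow> f x"
    proof (rule AE_I2)
      fix x
      have "(\<lambda>n. s n x * \<phi> x) \<longlonglongrightarrow> f x / \<phi> x * \<phi> x" by (intro tendsto_mult s(2) tendsto_const)
      then show "(\<lambda>n. s n x * \<phi> x) \<longlonglongrightarrow> f x" using \<phi>(2)[of x] by simp
    qed
    show "norm (s n x * \<phi> x) \<le> norm (2 * f x)" for n x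
      using mult_right_mono[OF s(3)[of n x], of "norm (\<phi> x)"] \<phi>(2)[of x]
      by (simp add: norm_mult norm_divide)
  qed (use square_integrable_cmult[OF f, of 2] in auto)
qed

end

subsection \<open>Plancherel's identity and one-sided exponentials\<close>

text \<open>A class of functions on which Plancherel's identity can be proved by Gaussian regularisation.\<close>

definition tame :: "(real \<Rightarrow> complex) \<Rightarrow> bool" where
  "tame k \<longleftrightarrow> k \<in> borel_measurable borel \<and> integrable lborel k \<and> (\<exists>B. \<forall>x. norm (k x) \<le> B) \<and>
     (\<exists>Z. finite Z \<and> (\<forall>x. x \<notin> Z \<longrightarrow> isCont k x))"

text \<open>With the plus sign in the exponent a shift of \<open>k\<close> becomes a modulation of
  positive frequency, as in \<open>gabor_atom\<close>.\<close>

definition fourier :: "(real \<Rightarrow> complex) \<Rightarrow> real \<Rightarrow> complex" where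
  "fourier k t = (\<integral>x. k x * cis (2 * pi * x * t) \<partial>lborel)"

lemma tame_zero: "tame (\<lambda>x. 0)"
  unfolding tame_def by (auto intro: exI[of _ "{}"])

lemma tame_add:
  assumes "tame f" "tame g" shows "tame (\<lambda>x. f x + g x)"
proof -
  obtain B B' where B: "\<And>x. norm (f x) \<le> B" "\<And>x. norm (g x) \<le> B'"
    using assms unfolding tame_def by auto
  have "norm (f x + g x) \<le> B + B'" for x
    using norm_triangle_ineq[of "f x" "g x"] B[of x] by linarith
  moreover obtain Z Z' where "finite Z" "finite Z'" "\<And>x. x \<notin> Z \<Longrightarrow> isCont f x" "\<And>x. x \<notin> Z' \<Longrightarrow> isCont g x"
    using assms unfolding tame_def by auto
  then have "finite (Z \<union> Z') \<and> (\<forall>x. x \<notin> Z \<union> Z' \<longrightarrow> isCont (\<lambda>x. f x + g x) x)" by auto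
  then have "\<exists>Z. finite Z \<and> (\<forall>x. x \<notin> Z \<longrightarrow> isCont (\<lambda>x. f x + g x) x)" ..
  ultimately show ?thesis using assms unfolding tame_def by auto
qed

lemma tame_mult:
  assumes f: "tame f" and m: "\<And>x. isCont m x" "\<And>x. norm (m x) \<le> C"
  shows "tame (\<lambda>x. m x * f x)"
proof -
  obtain B where B: "\<And>x. norm (f x) \<le> B" using f unfolding tame_def by auto
  have C: "0 \<le> C" using norm_ge_zero m(2) order_trans by blast
  have [measurable]: "m \<in> borel_measurable borel"
    using m(1) by (intro borel_measurable_continuous_onI) (simp add: continuous_at_imp_continuous_on)
  have [measurable]: "f \<in> borel_measurable borel" using f by (simp add: tame_def)
  have "norm (m x * f x) \<le> C * B" for x
    unfolding norm_mult by (intro mult_mono m B C) auto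
  moreover have "integrable lborel (\<lambda>x. m x * f x)"
    by (rule Bochner_Integration.integrable_bound[where f = "\<lambda>x. of_real C * f x"])
       (use f C m(2) in \<open>auto simp: tame_def norm_mult intro!: mult_right_mono\<close>)
  moreover obtain Z where "finite Z" "\<And>x. x \<notin> Z \<Longrightarrow> isCont f x"
    using f unfolding tame_def by auto
  then have "finite Z \<and> (\<forall>x. x \<notin> Z \<longrightarrow> isCont (\<lambda>x. m x * f x) x)" using m(1) by auto
  ultimately show ?thesis unfolding tame_def by (intro conjI exI) auto
qed

lemma tame_cmult: "tame f \<Longrightarrow> tame (\<lambda>x. c * f x)"
  by (rule tame_mult[where C = "norm c"]) auto

lemma tame_sum: "(\<And>i. i \<in> I \<Longrightarrow> tame (F i)) \<Longrightarrow> tame (\<lambda>x. \<Sum>i\<in>I. F i x)"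
  by (induction I rule: infinite_finite_induct) (auto intro: tame_zero tame_add)

lemma tame_shift:
  assumes "tame f" shows "tame (\<lambda>x. f (x - a))"
proof -
  have "integrable lborel f \<Longrightarrow> integrable lborel (\<lambda>x. f (- a + 1 * x))"
    by (rule lborel_integrable_real_affine) auto
  then have "integrable lborel (\<lambda>x. f (x - a))" using assms by (simp add: tame_def)
  moreover obtain Z where Z: "finite Z" "\<And>x. x \<notin> Z \<Longrightarrow> isCont f x"
    using assms unfolding tame_def by auto
  have "isCont (\<lambda>x. f (x - a)) x" if "x \<notin> (\<lambda>z. z + a) ` Z" for x
  proof -
    have "x - a \<notin> Z" using that by (metis diff_add_cancel imageI)
    then show ?thesis using Z(2) by (intro isCont_o2[of x "\<lambda>x. x - a" f]) auto
  qed
  then have "\<exists>Z. finite Z \<and> (\<forall>x. x \<notin> Z \<longrightarrow> isCont (\<lambda>x. f (x - a)) x)"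
    using Z(1) by (intro exI[of _ "(\<lambda>z. z + a) ` Z"]) auto
  ultimately show ?thesis using assms unfolding tame_def by auto
qed

lemma tame_square_integrable:
  assumes "tame f" shows "square_integrable f"
proof -
  obtain B where B: "\<And>x. norm (f x) \<le> B" using assms unfolding tame_def by auto
  have [measurable]: "f \<in> borel_measurable borel" using assms by (simp add: tame_def)
  have "integrable lborel (\<lambda>x. (norm (f x))\<^sup>2)"
    by (rule Bochner_Integration.integrable_bound[where f = "\<lambda>x. of_real B * f x"])
       (use assms B order_trans[OF norm_ge_zero B]
         in \<open>auto simp: tame_def norm_mult power2_eq_square intro!: mult_right_mono\<close>)
  then show ?thesis by (simp add: square_integrable_def)
qed

lemma integrable_fourier:
  assumes "tame k" shows "integrable lborel (\<lambda>x. k x * cis (2 * pi * x * t))"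
proof -
  have "tame (\<lambda>x. cis (2 * pi * x * t) * k x)"
    by (rule tame_mult[OF assms, where C = 1]) (auto simp: cis_conv_exp)
  then show ?thesis by (simp add: tame_def mult.commute)
qed

lemma fourier_sum:
  assumes "\<And>i. i \<in> I \<Longrightarrow> tame (F i)"
  shows "fourier (\<lambda>x. \<Sum>i\<in>I. c i * F i x) t = (\<Sum>i\<in>I. c i * fourier (F i) t)"
proof -
  have "fourier (\<lambda>x. \<Sum>i\<in>I. c i * F i x) t = (\<integral>x. (\<Sum>i\<in>I. c i * (F i x * cis (2 * pi * x * t))) \<partial>lborel)"
    by (simp add: fourier_def sum_distrib_right mult.assoc)
  also have "\<dots> = (\<Sum>i\<in>I. c i * fourier (F i) t)"
    unfolding fourier_def
    by (subst Bochner_Integration.integral_sum) (auto intro!: integrable_fourier assms)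
  finally show ?thesis .
qed

lemma fourier_diff:
  assumes "tame f" "tame g"
  shows "fourier (\<lambda>x. f x - g x) t = fourier f t - fourier g t"
  unfolding fourier_def left_diff_distrib
  by (rule Bochner_Integration.integral_diff) (auto intro!: integrable_fourier assms)

lemma fourier_shift: "fourier (\<lambda>x. k (x - a)) t = cis (2 * pi * a * t) * fourier k t"
proof -
  have "fourier (\<lambda>x. k (x - a)) t = (\<integral>x. k x * cis (2 * pi * (a + x) * t) \<partial>lborel)"
    unfolding fourier_def by (subst lborel_integral_real_affine[where c = 1 and t = a]) auto
  also have "\<dots> = (\<integral>x. cis (2 * pi * a * t) * (k x * cis (2 * pi * x * t)) \<partial>lborel)"
    by (intro Bochner_Integration.integral_cong)
       (auto simp: cis_mult algebra_simps)
  finally show ?thesis by (simp add: fourier_def)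
qed

lemma fourier_modulate: "fourier (\<lambda>x. cis (2 * pi * b * x) * k x) t = fourier k (t + b)"
  unfolding fourier_def
  by (intro Bochner_Integration.integral_cong) (auto simp: cis_mult algebra_simps)

section \<open>Gaussian regularisation and Plancherel's identity\<close>

lemma gauss_integral:
  assumes "0 < d"
  shows "(\<integral>t. exp (- (d * t)\<^sup>2 / 2) *\<^sub>R cis (u * t) \<partial>lborel)
    = of_real (sqrt (2 * pi) / d * exp (- (u / d)\<^sup>2 / 2))"
proof -
  have "of_real (exp (- (u / d)\<^sup>2 / 2)) = char std_normal_distribution (u / d)"
    by (simp add: char_std_normal_distribution)
  also have "\<dots> = (\<integral>x. std_normal_density x *\<^sub>R cis (u / d * x) \<partial>lborel)"
    unfolding char_def by (subst integral_density) (auto simp: cis_conv_exp)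
  also have "\<dots> = d *\<^sub>R (\<integral>t. std_normal_density (d * t) *\<^sub>R cis (u * t) \<partial>lborel)"
    using assms by (subst lborel_integral_real_affine[where c = d and t = 0]) auto
  also have "\<dots> = (d / sqrt (2 * pi)) *\<^sub>R (\<integral>t. exp (- (d * t)\<^sup>2 / 2) *\<^sub>R cis (u * t) \<partial>lborel)"
    by (simp add: std_normal_density_def flip: integral_scaleR_right)
  finally have *: "of_real (exp (- (u / d)\<^sup>2 / 2)) =
      (d / sqrt (2 * pi)) *\<^sub>R (\<integral>t. exp (- (d * t)\<^sup>2 / 2) *\<^sub>R cis (u * t) \<partial>lborel)" .
  have "of_real (sqrt (2 * pi) / d * exp (- (u / d)\<^sup>2 / 2))
      = (sqrt (2 * pi) / d) *\<^sub>R complex_of_real (exp (- (u / d)\<^sup>2 / 2))"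
    by (simp add: scaleR_conv_of_real)
  also have "\<dots> = (\<integral>t. exp (- (d * t)\<^sup>2 / 2) *\<^sub>R cis (u * t) \<partial>lborel)"
    unfolding * using assms by simp
  finally show ?thesis by simp
qed

lemma integrable_gauss:
  assumes "0 < d"
  shows "integrable lborel (\<lambda>t. exp (- (d * t)\<^sup>2 / 2) :: real)"
proof -
  have "integrable lborel (\<lambda>t. std_normal_density (0 + d * t))"
    using assms by (intro lborel_integrable_real_affine integrable_normal_density) auto
  then have "integrable lborel (\<lambda>t. sqrt (2 * pi) * std_normal_density (d * t))"
    by (intro integrable_mult_right) auto
  then show ?thesis by (simp add: std_normal_density_def)
qed

text \<open>A product majorant gives absolute integrability on the plane; this justifies both
  exchanges of integrals in \<open>plancherel\<close>.\<close>

lemma integrable_pair_bound: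
  fixes h :: "real \<times> real \<Rightarrow> complex"
  assumes h: "h \<in> borel_measurable (lborel \<Otimes>\<^sub>M lborel)"
    and f: "integrable lborel (f :: real \<Rightarrow> real)" "\<And>x. 0 \<le> f x" and g: "integrable lborel (g :: real \<Rightarrow> real)" "\<And>x. 0 \<le> g x"
    and le: "\<And>x y. norm (h (x, y)) \<le> f x * g y"
  shows "integrable (lborel \<Otimes>\<^sub>M lborel) h"
proof -
  have "integrable (lborel \<Otimes>\<^sub>M lborel) (\<lambda>p. f (fst p) * g (snd p))"
  proof (rule lborel_pair.Fubini_integrable)
    have [measurable]: "f \<in> borel_measurable lborel" "g \<in> borel_measurable lborel"
      using f g by auto
    show "(\<lambda>p. f (fst p) * g (snd p)) \<in> borel_measurable (lborel \<Otimes>\<^sub>M lborel)"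
      by measurable
    have "(\<lambda>x. \<integral>y. norm (f (fst (x, y)) * g (snd (x, y))) \<partial>lborel) = (\<lambda>x. f x * (\<integral>y. g y \<partial>lborel))"
      using f g by (simp add: abs_mult)
    then show "integrable lborel (\<lambda>x. \<integral>y. norm (f (fst (x, y)) * g (snd (x, y))) \<partial>lborel)"
      using f by simp
  qed (use g in auto)
  then show ?thesis
    by (rule Bochner_Integration.integrable_bound) (use h f g le in auto)
qed

text \<open>The integral of |F|^2 against a Gaussian weight is computed by Fubini: it pairs the
  conjugate of k with a Gaussian average of k. As the weight tends to 1, monotone convergence treats
  the side of F and dominated convergence the side of k.\<close>

lemma plancherel:
  assumes k: "tame k"
  shows "energy (fourier k) = energy k"
proof -
  obtain B where B: "\<And>x. norm (k x) \<le> B" using k unfolding tame_def by auto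
  obtain Z where Z: "finite Z" "\<And>x. x \<notin> Z \<Longrightarrow> isCont k x" using k unfolding tame_def by auto
  have [measurable]: "k \<in> borel_measurable borel" and k_int: "integrable lborel k"
    using k by (auto simp: tame_def)
  have cis_meas [measurable]: "cis \<in> borel_measurable borel"
    by (intro borel_measurable_continuous_onI) (auto simp: cis_conv_exp intro!: continuous_intros)
  have cnj_meas [measurable]: "cnj \<in> borel_measurable borel"
    by (intro borel_measurable_continuous_onI) (intro continuous_intros)
  define F where "F = fourier k"
  define L where "L = (\<integral>x. norm (k x) \<partial>lborel)"
  have F_meas [measurable]: "F \<in> borel_measurable borel"
    unfolding F_def fourier_def[abs_def] by measurable
  have F_le: "norm (F t) \<le> L" for t
    unfolding F_def L_def fourier_def
    by (rule order_trans[OF integral_norm_bound]) (simp add: norm_mult)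
  define \<gamma> where "\<gamma> d t = exp (- (d * t)\<^sup>2 / 2)" for d t :: real
  have [measurable]: "\<gamma> d \<in> borel_measurable borel" for d unfolding \<gamma>_def by measurable
  \<comment> \<open>The average of k under a normal law centred at e with standard deviation d / (2
    pi).\<close>
  define K where "K d e = (\<integral>s. std_normal_density s *\<^sub>R k (e + d / (2 * pi) * s) \<partial>lborel)" for d e
  have 1: "(\<integral>t. \<gamma> d t *\<^sub>R (F t * cis (- 2 * pi * e * t)) \<partial>lborel) = K d e" if d: "0 < d" for d e
  proof -
    have "(\<integral>t. \<gamma> d t *\<^sub>R (F t * cis (- 2 * pi * e * t)) \<partial>lborel)
        = (\<integral>t. (\<integral>x. k x * (\<gamma> d t *\<^sub>R cis (2 * pi * (x - e) * t)) \<partial>lborel) \<partial>lborel)"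
    proof (intro Bochner_Integration.integral_cong refl)
      fix t
      have "\<gamma> d t *\<^sub>R (F t * cis (- 2 * pi * e * t))
        = (\<integral>x. (\<gamma> d t *\<^sub>R cis (- 2 * pi * e * t)) * (k x * cis (2 * pi * x * t)) \<partial>lborel)"
        unfolding F_def fourier_def by simp
      also have "\<dots> = (\<integral>x. k x * (\<gamma> d t *\<^sub>R cis (2 * pi * (x - e) * t)) \<partial>lborel)"
      proof (intro Bochner_Integration.integral_cong refl)
        fix x
        have "cis (2 * pi * (x - e) * t) = cis (- 2 * pi * e * t) * cis (2 * pi * x * t)"
          by (simp add: cis_mult algebra_simps)
        then show "(\<gamma> d t *\<^sub>R cis (- 2 * pi * e * t)) * (k x * cis (2 * pi * x * t))
          = k x * (\<gamma> d t *\<^sub>R cis (2 * pi * (x - e) * t))" by simp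
      qed
      finally show "\<gamma> d t *\<^sub>R (F t * cis (- 2 * pi * e * t))
        = (\<integral>x. k x * (\<gamma> d t *\<^sub>R cis (2 * pi * (x - e) * t)) \<partial>lborel)" .
    qed
    also have "\<dots> = (\<integral>x. (\<integral>t. k x * (\<gamma> d t *\<^sub>R cis (2 * pi * (x - e) * t)) \<partial>lborel) \<partial>lborel)"
    proof (rule lborel_pair.Fubini_integral)
      show "integrable (lborel \<Otimes>\<^sub>M lborel) (\<lambda>(x, t). k x * (\<gamma> d t *\<^sub>R cis (2 * pi * (x - e) * t)))"
      proof (rule integrable_pair_bound)
        show "integrable lborel (\<lambda>x. norm (k x))" using k_int by simp
        show "integrable lborel (\<gamma> d)" using integrable_gauss[OF d] by (simp add: \<gamma>_def[abs_def])
        show "(\<lambda>(x, t). k x * (\<gamma> d t *\<^sub>R cis (2 * pi * (x - e) * t))) \<in> borel_measurable (lborel \<Otimes>\<^sub>M lborel)"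
          by measurable
      qed (auto simp: norm_mult \<gamma>_def)
    qed
    also have "\<dots> = (\<integral>x. (sqrt (2 * pi) / d * exp (- (2 * pi * (x - e) / d)\<^sup>2 / 2)) *\<^sub>R k x \<partial>lborel)"
    proof (intro Bochner_Integration.integral_cong refl)
      fix x
      have "(\<integral>t. k x * (\<gamma> d t *\<^sub>R cis (2 * pi * (x - e) * t)) \<partial>lborel)
          = k x * (\<integral>t. \<gamma> d t *\<^sub>R cis (2 * pi * (x - e) * t) \<partial>lborel)"
        by (rule integral_mult_right_zero)
      then show "(\<integral>t. k x * (\<gamma> d t *\<^sub>R cis (2 * pi * (x - e) * t)) \<partial>lborel)
          = (sqrt (2 * pi) / d * exp (- (2 * pi * (x - e) / d)\<^sup>2 / 2)) *\<^sub>R k x"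
        using gauss_integral[OF d, of "2 * pi * (x - e)"]
        by (simp add: \<gamma>_def scaleR_conv_of_real mult.commute)
    qed
    also have "\<dots> = (d / (2 * pi)) *\<^sub>R (\<integral>s. (sqrt (2 * pi) / d * exp (- s\<^sup>2 / 2)) *\<^sub>R k (e + d / (2 * pi) * s) \<partial>lborel)"
      using d by (subst lborel_integral_real_affine[where c = "d / (2 * pi)" and t = e]) auto
    also have "\<dots> = (\<integral>s. std_normal_density s *\<^sub>R k (e + d / (2 * pi) * s) \<partial>lborel)"
    proof -
      have "d / (2 * pi) * (sqrt (2 * pi) / d * exp (- s\<^sup>2 / 2)) = std_normal_density s" for s
        using d real_div_sqrt[of "2 * pi"] by (simp add: std_normal_density_def field_simps)
      then show ?thesis by (simp flip: integral_scaleR_right)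
    qed
    finally show ?thesis unfolding K_def .
  qed
  have 2: "(\<integral>t. \<gamma> d t *\<^sub>R (F t * cnj (F t)) \<partial>lborel) = (\<integral>e. cnj (k e) * K d e \<partial>lborel)" if d: "0 < d" for d
  proof -
    have "(\<integral>t. \<gamma> d t *\<^sub>R (F t * cnj (F t)) \<partial>lborel)
        = (\<integral>t. (\<integral>e. cnj (k e) * (\<gamma> d t *\<^sub>R (F t * cis (- 2 * pi * e * t))) \<partial>lborel) \<partial>lborel)"
    proof (intro Bochner_Integration.integral_cong refl)
      fix t
      have "cnj (F t) = (\<integral>e. cnj (k e) * cis (- 2 * pi * e * t) \<partial>lborel)"
        unfolding F_def fourier_def by (subst Bochner_Integration.integral_cnj[symmetric]) (simp add: cis_cnj)
      then have "\<gamma> d t *\<^sub>R (F t * cnj (F t)) = (\<integral>e. (\<gamma> d t *\<^sub>R F t) * (cnj (k e) * cis (- 2 * pi * e * t)) \<partial>lborel)"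
        by simp
      also have "\<dots> = (\<integral>e. cnj (k e) * (\<gamma> d t *\<^sub>R (F t * cis (- 2 * pi * e * t))) \<partial>lborel)"
        by (intro Bochner_Integration.integral_cong refl) simp
      finally show "\<gamma> d t *\<^sub>R (F t * cnj (F t)) = (\<integral>e. cnj (k e) * (\<gamma> d t *\<^sub>R (F t * cis (- 2 * pi * e * t))) \<partial>lborel)" .
    qed
    also have "\<dots> = (\<integral>e. (\<integral>t. cnj (k e) * (\<gamma> d t *\<^sub>R (F t * cis (- 2 * pi * e * t))) \<partial>lborel) \<partial>lborel)"
    proof (rule lborel_pair.Fubini_integral)
      show "integrable (lborel \<Otimes>\<^sub>M lborel) (\<lambda>(e, t). cnj (k e) * (\<gamma> d t *\<^sub>R (F t * cis (- 2 * pi * e * t))))"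
      proof (rule integrable_pair_bound)
        show "integrable lborel (\<lambda>x. norm (k x))" using k_int by simp
        show "integrable lborel (\<lambda>t. \<gamma> d t * L)" using integrable_gauss[OF d] by (simp add: \<gamma>_def)
        show "(\<lambda>(e, t). cnj (k e) * (\<gamma> d t *\<^sub>R (F t * cis (- 2 * pi * e * t)))) \<in> borel_measurable (lborel \<Otimes>\<^sub>M lborel)"
          by measurable
      qed (use F_le in \<open>auto simp: norm_mult \<gamma>_def L_def intro!: mult_left_mono\<close>)
    qed
    also have "\<dots> = (\<integral>e. cnj (k e) * K d e \<partial>lborel)"
      by (simp only: integral_mult_right_zero 1[OF d])
    finally show ?thesis .
  qed
  define \<delta> where "\<delta> n = inverse (real (Suc n))" for n
  have \<delta>: "0 < \<delta> n" "\<delta> \<longlonglongrightarrow> 0" for n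
    using LIMSEQ_inverse_real_of_nat by (auto simp: \<delta>_def[abs_def])
  have K_meas [measurable]: "K d \<in> borel_measurable borel" for d
    unfolding K_def[abs_def] by measurable
  have sd: "integrable lborel (std_normal_density :: real \<Rightarrow> real)" by (rule integrable_normal_density) auto
  \<comment> \<open>Continuity at e is enough for the averages to converge; the exceptional set Z is
    finite, hence null.\<close>
  have K_lim: "(\<lambda>n. K (\<delta> n) e) \<longlonglongrightarrow> k e" if "e \<notin> Z" for e
  proof -
    have "(\<lambda>n. K (\<delta> n) e) \<longlonglongrightarrow> (\<integral>s. std_normal_density s *\<^sub>R k e \<partial>lborel)"
      unfolding K_def
    proof (rule integral_dominated_convergence[where w = "\<lambda>s. std_normal_density s * B"])
      show "integrable lborel (\<lambda>s. std_normal_density s * B)" using sd by simp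
      show "AE s in lborel. (\<lambda>n. std_normal_density s *\<^sub>R k (e + \<delta> n / (2 * pi) * s)) \<longlonglongrightarrow> std_normal_density s *\<^sub>R k e"
      proof (intro AE_I2 tendsto_scaleR tendsto_const)
        fix s
        have "(\<lambda>n. e + \<delta> n / (2 * pi) * s) \<longlonglongrightarrow> e + 0 / (2 * pi) * s"
          by (intro tendsto_intros \<delta>(2)) auto
        then show "(\<lambda>n. k (e + \<delta> n / (2 * pi) * s)) \<longlonglongrightarrow> k e"
          using Z(2)[OF that] by (intro isCont_tendsto_compose[of e k]) auto
      qed
    qed (use B in \<open>auto intro!: mult_left_mono\<close>)
    also have "(\<integral>s. std_normal_density s *\<^sub>R k e \<partial>lborel) = k e"
      using integral_normal_density[of 1 0] sd by simp
    finally show ?thesis .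
  qed
  have K_le: "norm (K d e) \<le> B" for d e
  proof -
    have "norm (K d e) \<le> (\<integral>s. norm (std_normal_density s *\<^sub>R k (e + d / (2 * pi) * s)) \<partial>lborel)"
      unfolding K_def by (rule integral_norm_bound)
    also have "\<dots> \<le> (\<integral>s. std_normal_density s * B \<partial>lborel)"
    proof (rule integral_mono')
      show "integrable lborel (\<lambda>s. std_normal_density s * B)" using sd by simp
    qed (use B order_trans[OF norm_ge_zero B] in \<open>auto intro!: mult_left_mono mult_nonneg_nonneg\<close>)
    also have "\<dots> = B" using integral_normal_density[of 1 0] by simp
    finally show ?thesis .
  qed
  have 3: "(\<lambda>n. \<integral>e. cnj (k e) * K (\<delta> n) e \<partial>lborel) \<longlonglongrightarrow> (\<integral>e. cnj (k e) * k e \<partial>lborel)"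
  proof (rule integral_dominated_convergence[where w = "\<lambda>e. norm (k e) * B"])
    show "integrable lborel (\<lambda>e. norm (k e) * B)" using k_int by simp
    show "AE e in lborel. (\<lambda>n. cnj (k e) * K (\<delta> n) e) \<longlonglongrightarrow> cnj (k e) * k e"
    proof (rule AE_I')
      show "Z \<in> null_sets lborel" using Z(1) by (rule finite_imp_null_set_lborel)
    qed (use K_lim in \<open>auto intro!: tendsto_intros\<close>)
  qed (use K_le in \<open>auto simp: norm_mult intro!: mult_left_mono\<close>)
  have kk: "integrable lborel (\<lambda>x. (norm (k x))\<^sup>2)"
    using tame_square_integrable[OF k] by (simp add: square_integrable_def)
  have R: "(\<integral>e. cnj (k e) * k e \<partial>lborel) = of_real (\<integral>e. (norm (k e))\<^sup>2 \<partial>lborel)"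
  proof -
    have "cnj (k e) * k e = of_real ((norm (k e))\<^sup>2)" for e
      by (simp add: complex_norm_square mult.commute flip: of_real_power)
    then show ?thesis by (simp only: integral_complex_of_real)
  qed
  have gF: "integrable lborel (\<lambda>t. \<gamma> d t * (norm (F t))\<^sup>2)" if "0 < d" for d
  proof (rule Bochner_Integration.integrable_bound[where f = "\<lambda>t. \<gamma> d t * L\<^sup>2"])
    show "integrable lborel (\<lambda>t. \<gamma> d t * L\<^sup>2)" using integrable_gauss[OF that] by (simp add: \<gamma>_def)
  qed (use F_le in \<open>auto simp: \<gamma>_def intro!: mult_left_mono power_mono\<close>)
  have "(\<lambda>n. of_real (\<integral>t. \<gamma> (\<delta> n) t * (norm (F t))\<^sup>2 \<partial>lborel) :: complex)
      \<longlonglongrightarrow> of_real (\<integral>e. (norm (k e))\<^sup>2 \<partial>lborel)"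
  proof -
    have "of_real (\<integral>t. \<gamma> (\<delta> n) t * (norm (F t))\<^sup>2 \<partial>lborel) = (\<integral>e. cnj (k e) * K (\<delta> n) e \<partial>lborel)" for n
    proof -
      have "\<gamma> d t *\<^sub>R (F t * cnj (F t)) = of_real (\<gamma> d t * (norm (F t))\<^sup>2)" for d t
        by (simp add: scaleR_conv_of_real flip: complex_norm_square)
      then show ?thesis
        unfolding 2[OF \<delta>(1), symmetric] by (simp only: integral_complex_of_real)
    qed
    then show ?thesis using 3 by (simp add: R)
  qed
  then have "(\<lambda>n. \<integral>t. \<gamma> (\<delta> n) t * (norm (F t))\<^sup>2 \<partial>lborel) \<longlonglongrightarrow> (\<integral>e. (norm (k e))\<^sup>2 \<partial>lborel)"
    unfolding tendsto_of_real_iff .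
  then have "(\<lambda>n. ennreal (\<integral>t. \<gamma> (\<delta> n) t * (norm (F t))\<^sup>2 \<partial>lborel)) \<longlonglongrightarrow> ennreal (\<integral>e. (norm (k e))\<^sup>2 \<partial>lborel)"
    by (rule tendsto_ennrealI)
  moreover have "ennreal (\<integral>e. (norm (k e))\<^sup>2 \<partial>lborel) = energy k"
    unfolding energy_def using kk by (simp add: nn_integral_eq_integral)
  moreover have "ennreal (\<integral>t. \<gamma> (\<delta> n) t * (norm (F t))\<^sup>2 \<partial>lborel) = (\<integral>\<^sup>+ t. ennreal (\<gamma> (\<delta> n) t * (norm (F t))\<^sup>2) \<partial>lborel)" for n
    using gF[OF \<delta>(1)] by (subst nn_integral_eq_integral) (auto simp: \<gamma>_def)
  ultimately have A: "(\<lambda>n. \<integral>\<^sup>+ t. ennreal (\<gamma> (\<delta> n) t * (norm (F t))\<^sup>2) \<partial>lborel) \<longlonglongrightarrow> energy k"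
    by simp
  \<comment> \<open>Monotone convergence is used because square integrability of F is not known yet;
    the weights increase to 1 since \<open_delta> decreases to 0.\<close>
  have "(\<lambda>n. \<integral>\<^sup>+ t. ennreal (\<gamma> (\<delta> n) t * (norm (F t))\<^sup>2) \<partial>lborel) \<longlonglongrightarrow> (\<integral>\<^sup>+ t. ennreal ((norm (F t))\<^sup>2) \<partial>lborel)"
  proof (rule nn_integral_LIMSEQ)
    show "incseq (\<lambda>n t. ennreal (\<gamma> (\<delta> n) t * (norm (F t))\<^sup>2))"
    proof (intro incseq_SucI le_funI ennreal_leI mult_right_mono)
      fix n t
      have "\<delta> (Suc n) \<le> \<delta> n" by (simp add: \<delta>_def field_simps)
      then have "(\<delta> (Suc n))\<^sup>2 * t\<^sup>2 \<le> (\<delta> n)\<^sup>2 * t\<^sup>2"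
        using \<delta>(1) by (intro mult_right_mono power_mono) (auto intro: less_imp_le)
      then show "\<gamma> (\<delta> n) t \<le> \<gamma> (\<delta> (Suc n)) t" by (simp add: \<gamma>_def power_mult_distrib)
    qed auto
    show "(\<lambda>n. ennreal (\<gamma> (\<delta> n) t * (norm (F t))\<^sup>2)) \<longlonglongrightarrow> ennreal ((norm (F t))\<^sup>2)" for t
    proof (rule tendsto_ennrealI)
      have "(\<lambda>n. \<gamma> (\<delta> n) t * (norm (F t))\<^sup>2) \<longlonglongrightarrow> exp (- (0 * t)\<^sup>2 / 2) * (norm (F t))\<^sup>2"
        unfolding \<gamma>_def by (intro tendsto_intros \<delta>(2)) auto
      then show "(\<lambda>n. \<gamma> (\<delta> n) t * (norm (F t))\<^sup>2) \<longlonglongrightarrow> (norm (F t))\<^sup>2" by simp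
    qed
  qed auto
  with A show ?thesis
    using LIMSEQ_unique unfolding energy_def[of F] F_def[symmetric] by blast
qed


section \<open>One-sided exponentials as preimages of Cauchy kernels\<close>

lemma half_line_exp:
  fixes z :: complex
  assumes z: "Re z < 0"
  shows "integrable lborel (\<lambda>x. indicator {0<..} x * exp (z * of_real x))" (is ?int)
    and "(\<integral>x. indicator {0<..} x * exp (z * of_real x) \<partial>lborel) = - 1 / z" (is ?eq)
proof -
  have z0: "z \<noteq> 0" using z by auto
  have si: "set_integrable lborel {0<..} (\<lambda>x. exp (z * of_real x))"
    unfolding set_integrable_def
  proof (rule Bochner_Integration.integrable_bound)
    show "integrable lborel (\<lambda>x. indicator {0<..} x *\<^sub>R exp (- (x * (- Re z))))"
      using integrable_I0i_exp_mscale[of "- Re z"] z by (simp add: set_integrable_def)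
  qed (auto simp: norm_mult indicator_def mult.commute)
  have "(LBINT x=0..\<infinity>. exp (z * of_real x)) = 0 - exp (z * of_real 0) / z"
  proof (rule interval_integral_FTC_integrable[where F = "\<lambda>x. exp (z * of_real x) / z"])
    show "((\<lambda>x. exp (z * of_real x) / z) has_vector_derivative exp (z * of_real x)) (at x)" for x
      using z0 by (auto intro!: derivative_eq_intros has_vector_derivative_real_field)
    show "set_integrable lborel (einterval 0 \<infinity>) (\<lambda>x. exp (z * of_real x))"
      using si by (simp add: einterval_def zero_ereal_def greaterThan_def)
    show "(((\<lambda>x. exp (z * of_real x) / z) \<circ> real_of_ereal) \<longlongrightarrow> exp (z * of_real 0) / z) (at_right 0)"
      unfolding zero_ereal_def ereal_tendsto_simps using z0 by (auto intro!: tendsto_eq_intros)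
    have "((\<lambda>x. exp (Re z * x)) \<longlongrightarrow> 0) at_top"
      by (rule filterlim_compose[OF exp_at_bot])
         (auto intro!: filterlim_tendsto_neg_mult_at_bot[OF tendsto_const z] filterlim_ident)
    then have "((\<lambda>x. exp (z * of_real x)) \<longlongrightarrow> 0) at_top"
      by (subst tendsto_norm_zero_iff[symmetric]) simp
    then show "(((\<lambda>x. exp (z * of_real x) / z) \<circ> real_of_ereal) \<longlongrightarrow> 0) (at_left \<infinity>)"
      unfolding ereal_tendsto_simps by (rule tendsto_divide_zero)
  qed (auto intro!: continuous_intros)
  then have "(LINT x:{0<..}|lborel. exp (z * of_real x)) = - 1 / z"
    by (simp add: interval_lebesgue_integral_0_infty)
  moreover have eq: "indicator {0<..} x *\<^sub>R exp (z * of_real x) = indicator {0<..} x * exp (z * of_real x)" for x :: real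
    by (simp add: indicator_def)
  ultimately show ?eq unfolding set_lebesgue_integral_def eq by simp
  show ?int using si unfolding set_integrable_def eq .
qed

text \<open>The Fourier preimage of \<open>t \<mapsto> 1 / (t - \<i> * w)\<close>: a one-sided exponential whose side depends on the sign
  of \<open>Re w\<close>, but whose jump at \<open>0\<close> is always \<open>- 2 * pi * \<i>\<close>.\<close>

definition cauchy_pre :: "complex \<Rightarrow> real \<Rightarrow> complex" where
  "cauchy_pre w x = (if Re w < 0 then indicator {0<..} x * (- 2 * of_real pi * \<i> * exp (2 * of_real pi * w * of_real x))
     else indicator {..<0} x * (2 * of_real pi * \<i> * exp (2 * of_real pi * w * of_real x)))"

lemma cauchy_pre_reflect: "0 < Re w \<Longrightarrow> cauchy_pre w x = - cauchy_pre (- w) (- x)"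
  by (auto simp: cauchy_pre_def indicator_def)

lemma isCont_cauchy_pre:
  assumes "x \<noteq> 0" shows "isCont (cauchy_pre w) x"
proof -
  \<comment> \<open>The parameter s freezes the side of 0, so that near x the function agrees with
    the continuous \<open>g x\<close>.\<close>
  define g where "g s y = (if (0 < s) = (Re w < 0) then
    (if Re w < 0 then - 1 else 1) * (2 * of_real pi * \<i> * exp (2 * of_real pi * w * of_real y)) else 0)"
    for s y :: real
  have "isCont (g x) x" unfolding g_def by (cases "(0 < x) = (Re w < 0)") (auto intro!: continuous_intros)
  moreover have "\<forall>\<^sub>F y in nhds x. (0 < y) = (0 < x) \<and> y \<noteq> 0"
    using assms eventually_nhds_in_open[OF open_greaterThan[of 0], of x]
      eventually_nhds_in_open[OF open_lessThan[of 0], of x]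
    by (cases "0 < x") (auto elim!: eventually_mono)
  then have "\<forall>\<^sub>F y in nhds x. cauchy_pre w y = g x y"
    by eventually_elim (auto simp: cauchy_pre_def g_def indicator_def)
  ultimately show ?thesis by (subst isCont_cong)
qed

lemma tame_cauchy_pre_neg:
  assumes "Re w < 0" shows "tame (cauchy_pre w)"
proof -
  have eq: "cauchy_pre w = (\<lambda>x. - 2 * of_real pi * \<i> * (indicator {0<..} x * exp (2 * of_real pi * w * of_real x)))"
    using assms by (auto simp: cauchy_pre_def fun_eq_iff)
  have "norm (cauchy_pre w x) \<le> 2 * pi" for x
    using assms by (auto simp: eq norm_mult indicator_def mult_nonneg_nonpos intro!: mult_left_le)
  moreover have "integrable lborel (cauchy_pre w)"
    unfolding eq using half_line_exp(1)[of "2 * of_real pi * w"] assms by (auto simp: mult_pos_neg)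
  moreover have "isCont (cauchy_pre w) x" if "x \<notin> {0}" for x
    using that by (intro isCont_cauchy_pre) auto
  ultimately show ?thesis
    unfolding tame_def by (intro conjI exI[of _ "2 * pi"] exI[of _ "{0}"]) auto
qed

lemma tame_reflect:
  assumes "tame k" shows "tame (\<lambda>x. k (- x))"
proof -
  have "integrable lborel k \<Longrightarrow> integrable lborel (\<lambda>x. k (0 + (- 1) * x))"
    by (rule lborel_integrable_real_affine) auto
  then have "integrable lborel (\<lambda>x. k (- x))" using assms by (simp add: tame_def)
  moreover obtain Z where Z: "finite Z" "\<And>x. x \<notin> Z \<Longrightarrow> isCont k x"
    using assms unfolding tame_def by auto
  have "isCont (\<lambda>x. k (- x)) x" if "x \<notin> uminus ` Z" for x
  proof -
    have "- x \<notin> Z" using that by (metis imageI minus_minus)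
    then show ?thesis using Z(2) by (intro isCont_o2[of x uminus k]) auto
  qed
  then have "\<exists>Z. finite Z \<and> (\<forall>x. x \<notin> Z \<longrightarrow> isCont (\<lambda>x. k (- x)) x)"
    using Z(1) by (intro exI[of _ "uminus ` Z"]) auto
  ultimately show ?thesis using assms unfolding tame_def by auto
qed

lemma tame_cauchy_pre: assumes "Re w \<noteq> 0" shows "tame (cauchy_pre w)"
proof (cases "Re w < 0")
  case False
  then have eq: "cauchy_pre w = (\<lambda>x. - 1 * cauchy_pre (- w) (- x))"
    using assms cauchy_pre_reflect[of w] by auto
  show ?thesis
    unfolding eq using False assms
    by (intro tame_cmult tame_reflect[of "cauchy_pre (- w)"] tame_cauchy_pre_neg) auto
qed (rule tame_cauchy_pre_neg)

lemma fourier_cauchy_pre_neg: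
  assumes "Re w < 0" shows "fourier (cauchy_pre w) t = 1 / (of_real t - \<i> * w)"
proof -
  define z where "z = 2 * of_real pi * (w + \<i> * of_real t)"
  have z: "Re z < 0" using assms by (simp add: z_def mult_pos_neg)
  have "fourier (cauchy_pre w) t = (\<integral>x. - 2 * of_real pi * \<i> * (indicator {0<..} x * exp (z * of_real x)) \<partial>lborel)"
    unfolding fourier_def using assms
    by (intro Bochner_Integration.integral_cong)
       (auto simp: cauchy_pre_def z_def cis_conv_exp exp_add[symmetric] algebra_simps)
  also have "\<dots> = - 2 * of_real pi * \<i> * (- 1 / z)"
    by (simp only: integral_mult_right_zero half_line_exp(2)[OF z])
  also have "\<dots> = 1 / (of_real t - \<i> * w)"
  proof -
    have "z = 2 * of_real pi * \<i> * (of_real t - \<i> * w)" by (simp add: z_def algebra_simps)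
    then show ?thesis by simp
  qed
  finally show ?thesis .
qed

lemma fourier_cauchy_pre:
  assumes "Re w \<noteq> 0" shows "fourier (cauchy_pre w) t = 1 / (of_real t - \<i> * w)"
proof (cases "Re w < 0")
  case False
  have "fourier (cauchy_pre w) t = (\<integral>x. cauchy_pre w (- x) * cis (2 * pi * - x * t) \<partial>lborel)"
    unfolding fourier_def by (subst lborel_integral_real_affine[where c = "- 1" and t = 0]) auto
  also have "\<dots> = (\<integral>x. - (cauchy_pre (- w) x * cis (2 * pi * x * (- t))) \<partial>lborel)"
    using False assms by (simp add: cauchy_pre_reflect[of w])
  also have "\<dots> = - fourier (cauchy_pre (- w)) (- t)"
    by (simp add: fourier_def)
  also have "\<dots> = 1 / (of_real t - \<i> * w)"
    using False assms by (subst fourier_cauchy_pre_neg) (auto simp: field_simps divide_simps)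
  finally show ?thesis .
qed (rule fourier_cauchy_pre_neg)

subsection \<open>Elimination with entire coefficients\<close>

text \<open>The source of all genericity statements: a condition expressed by a nonzero entire
  function fails only on a countable, hence null, set of parameters.\<close>

lemma entire_countable_zeros:
  assumes "f holomorphic_on UNIV" "f z0 \<noteq> 0"
  shows "countable {z. f z = 0}"
  using holomorphic_countable_equal_UNIV[OF assms(1) holomorphic_on_const[of 0]] assms(2) by metis

lemma entire_mult_nonzero:
  assumes "f holomorphic_on UNIV" "g holomorphic_on UNIV" "f u \<noteq> 0" "g v \<noteq> 0"
  shows "\<exists>z. f z * g z \<noteq> 0"
proof (rule ccontr)
  assume "\<not> ?thesis"
  then have "UNIV = {z. f z = 0} \<union> {z. g z = 0}" by auto
  also have "countable \<dots>" using assms by (intro countable_Un entire_countable_zeros)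
  finally show False using uncountable_UNIV_complex by simp
qed

text \<open>Fraction-free Gaussian elimination: rows are cross-multiplied by the pivot instead of
  being divided by it, so all entries stay entire. Products of nonzero entire functions are nonzero,
  which keeps the solution nontrivial.\<close>

lemma entire_kernel:
  fixes A :: "'i \<Rightarrow> 'j \<Rightarrow> complex \<Rightarrow> complex"
  assumes "finite I" "finite J" "card I < card J" "\<And>i j. A i j holomorphic_on UNIV"
  shows "\<exists>d. (\<forall>j. d j holomorphic_on UNIV) \<and> (\<exists>j\<in>J. \<exists>z. d j z \<noteq> 0) \<and>
    (\<forall>i\<in>I. \<forall>z. (\<Sum>j\<in>J. A i j z * d j z) = 0)"
  using assms
proof (induction I arbitrary: A J rule: finite_induct)
  case empty
  then show ?case by (intro exI[of _ "\<lambda>_ _. 1"]) (auto simp: card_gt_0_iff)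
next
  case (insert i I)
  show ?case
  proof (cases "\<forall>j\<in>J. \<forall>z. A i j z = 0")
    case True
    have "card I < card J" using insert by simp
    then obtain d where "\<forall>j. d j holomorphic_on UNIV" "\<exists>j\<in>J. \<exists>z. d j z \<noteq> 0"
      "\<forall>k\<in>I. \<forall>z. (\<Sum>j\<in>J. A k j z * d j z) = 0"
      using insert.IH[of J A] insert.prems by auto
    with True show ?thesis by (intro exI[of _ d]) auto
  next
    case False
    then obtain p zp where p: "p \<in> J" "A i p zp \<noteq> 0" by auto
    define B where "B k j = (\<lambda>z. A i p z * A k j z - A k p z * A i j z)" for k j
    have "card I < card (J - {p})" using insert p by simp
    moreover have "B k j holomorphic_on UNIV" for k j
      unfolding B_def by (intro holomorphic_intros insert.prems)
    ultimately have "\<exists>d. (\<forall>j. d j holomorphic_on UNIV) \<and> (\<exists>j\<in>J - {p}. \<exists>z. d j z \<noteq> 0) \<and>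
        (\<forall>k\<in>I. \<forall>z. (\<Sum>j\<in>J - {p}. B k j z * d j z) = 0)"
      using insert.prems(1) by (intro insert.IH) auto
    then obtain e where e: "\<And>j. e j holomorphic_on UNIV" "\<exists>j\<in>J - {p}. \<exists>z. e j z \<noteq> 0"
      "\<And>k z. k \<in> I \<Longrightarrow> (\<Sum>j\<in>J - {p}. B k j z * e j z) = 0" by blast
    \<comment> \<open>Back substitution multiplied by the pivot \<open>A i p\<close>: row i then
      vanishes identically, and the other rows reduce to the eliminated system B.\<close>
    define d where "d j = (if j = p then (\<lambda>z. - (\<Sum>j\<in>J - {p}. A i j z * e j z))
      else (\<lambda>z. A i p z * e j z))" for j
    have "d j holomorphic_on UNIV" for j
      unfolding d_def using insert.prems(3) e(1) by (auto intro!: holomorphic_intros)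
    moreover obtain j z where j: "j \<in> J" "j \<noteq> p" "e j z \<noteq> 0" using e(2) by auto
    have "\<exists>z. d j z \<noteq> 0"
      using entire_mult_nonzero[OF insert.prems(3)[of i p] e(1)[of j] p(2) j(3)] j by (simp add: d_def)
    moreover have "(\<Sum>j\<in>J. A k j z * d j z) = 0" if "k \<in> insert i I" for k z
    proof -
      have "(\<Sum>j\<in>J. A k j z * d j z) = A k p z * d p z + (\<Sum>j\<in>J - {p}. A k j z * d j z)"
        using insert.prems p by (simp add: sum.remove)
      also have "\<dots> = (\<Sum>j\<in>J - {p}. B k j z * e j z)"
        by (auto simp: d_def B_def sum_distrib_left left_diff_distrib sum_subtractf algebra_simps intro!: sum.cong)
      also have "\<dots> = 0" using that e(3) by (auto simp: B_def)
      finally show ?thesis .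
    qed
    ultimately show ?thesis using j by blast
  qed
qed

text \<open>Elimination over the ring of entire functions with a limit at \<open>+\<infinity>\<close>; the pivots are chosen nonzero in the limit.\<close>

lemma entire_left_inverse:
  fixes M :: "'n \<Rightarrow> 'j \<Rightarrow> complex \<Rightarrow> complex"
  assumes "finite J" "j0 \<notin> J"
    and "\<And>n j. M n j holomorphic_on UNIV"
    and "\<And>n j. ((\<lambda>x. M n j (of_real x)) \<longlongrightarrow> L n j) at_top"
    and "\<And>v j. (\<And>n. n \<in> R \<Longrightarrow> (\<Sum>j\<in>insert j0 J. L n j * v j) = 0) \<Longrightarrow> j \<in> insert j0 J \<Longrightarrow> v j = 0"
  shows "\<exists>T c D l. finite T \<and> T \<subseteq> R \<and> (\<forall>n. c n holomorphic_on UNIV) \<and> D holomorphic_on UNIV \<and>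
    l \<noteq> 0 \<and> ((\<lambda>x. D (of_real x)) \<longlongrightarrow> l) at_top \<and>
    (\<forall>j\<in>insert j0 J. \<forall>z. (\<Sum>n\<in>T. c n z * M n j z) = (if j = j0 then D z else 0))"
  using assms
proof (induction J arbitrary: M L rule: finite_induct)
  case empty
  have "\<exists>n\<in>R. L n j0 \<noteq> 0"
    using empty.prems(4)[of "\<lambda>_. 1" j0] by auto
  then obtain n where "n \<in> R" "L n j0 \<noteq> 0" by auto
  then show ?case using empty.prems(2,3)
    by (intro exI[of _ "{n}"] exI[of _ "\<lambda>_ _. 1"] exI[of _ "M n j0"] exI[of _ "L n j0"]) auto
next
  case (insert p J)
  have pj0: "p \<noteq> j0" "j0 \<notin> J" using insert by auto
  have "\<exists>n\<in>R. L n p \<noteq> 0"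
  proof (rule ccontr)
    assume "\<not> ?thesis"
    then have "(\<Sum>j\<in>insert j0 (insert p J). L n j * (if j = p then 1 else 0)) = 0" if "n \<in> R" for n
      using that insert by (intro sum.neutral) auto
    then show False using insert.prems(4)[of "\<lambda>j. if j = p then 1 else 0" p] by simp
  qed
  then obtain q where q: "q \<in> R" "L q p \<noteq> 0" by auto
  \<comment> \<open>Row q clears column p without division; \<open>L'\<close> is the same
    elimination carried out on the limits.\<close>
  define M' where "M' n j = (\<lambda>z. M q p z * M n j z - M n p z * M q j z)" for n j
  define L' where "L' n j = L q p * L n j - L n p * L q j" for n j
  have "M' n j holomorphic_on UNIV" for n j
    unfolding M'_def by (intro holomorphic_intros insert.prems)
  moreover have "((\<lambda>x. M' n j (of_real x)) \<longlongrightarrow> L' n j) at_top" for n j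
    unfolding M'_def L'_def by (intro tendsto_intros insert.prems)
  moreover have "v j = 0" if v: "\<And>n. n \<in> R \<Longrightarrow> (\<Sum>j\<in>insert j0 J. L' n j * v j) = 0"
    and j: "j \<in> insert j0 J" for v j
  proof -
    \<comment> \<open>A kernel vector of \<open>L'\<close> extends to one of L by solving limit row
      q for coordinate p, which is possible since \<open>L q p\<close> is nonzero.\<close>
    define u where "u j = (if j = p then - (\<Sum>j\<in>insert j0 J. L q j * v j) / L q p else v j)" for j
    have "(\<Sum>j\<in>insert j0 (insert p J). L n j * u j) = 0" if n: "n \<in> R" for n
    proof -
      have "(\<Sum>j\<in>insert j0 (insert p J). L n j * u j) = (\<Sum>j\<in>insert p (insert j0 J). L n j * u j)"
        by (simp add: insert_commute)
      also have "\<dots> = L n p * u p + (\<Sum>j\<in>insert j0 J. L n j * u j)"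
        using insert pj0 by (subst sum.insert) auto
      also have "(\<Sum>j\<in>insert j0 J. L n j * u j) = (\<Sum>j\<in>insert j0 J. L n j * v j)"
        using insert pj0 by (intro sum.cong) (auto simp: u_def)
      finally have "L q p * (\<Sum>j\<in>insert j0 (insert p J). L n j * u j)
          = L q p * (\<Sum>j\<in>insert j0 J. L n j * v j) - L n p * (\<Sum>j\<in>insert j0 J. L q j * v j)"
        using q(2) by (simp add: u_def field_simps)
      also have "\<dots> = (\<Sum>j\<in>insert j0 J. L' n j * v j)"
        unfolding sum_distrib_left sum_subtractf[symmetric] by (intro sum.cong) (auto simp: L'_def algebra_simps)
      also have "\<dots> = 0" by (rule v[OF n])
      finally show ?thesis using q(2) by simp
    qed
    then have "u j = 0" using insert.prems(4)[of u j] j by blast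
    moreover have "j \<noteq> p" using j insert.hyps pj0 by auto
    ultimately show ?thesis by (simp add: u_def)
  qed
  ultimately have "\<exists>T c D l. finite T \<and> T \<subseteq> R \<and> (\<forall>n. c n holomorphic_on UNIV) \<and> D holomorphic_on UNIV \<and>
    l \<noteq> 0 \<and> ((\<lambda>x. D (of_real x)) \<longlongrightarrow> l) at_top \<and>
    (\<forall>j\<in>insert j0 J. \<forall>z. (\<Sum>n\<in>T. c n z * M' n j z) = (if j = j0 then D z else 0))"
    by (intro insert.IH[OF pj0(2)]) auto
  then obtain T c D l where T: "finite T" "T \<subseteq> R" and c: "\<And>n. c n holomorphic_on UNIV"
    and D: "D holomorphic_on UNIV" "l \<noteq> 0" "((\<lambda>x. D (of_real x)) \<longlongrightarrow> l) at_top"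
    and eq: "\<And>j z. j \<in> insert j0 J \<Longrightarrow> (\<Sum>n\<in>T. c n z * M' n j z) = (if j = j0 then D z else 0)"
    by blast
  define s where "s z = (\<Sum>n\<in>T. c n z * M n p z)" for z
  \<comment> \<open>Expanding \<open>M'\<close> collects all its subtracted terms in row q with
    total weight s. Both contributions are kept when q already lies in T.\<close>
  define c' where "c' n = (\<lambda>z. (if n \<in> T then c n z * M q p z else 0) - (if n = q then s z else 0))" for n
  have sum: "(\<Sum>n\<in>insert q T. c' n z * M n j z) = (\<Sum>n\<in>T. c n z * M' n j z)" for j z
  proof -
    have "(\<Sum>n\<in>insert q T. c' n z * M n j z)
      = (\<Sum>n\<in>insert q T. (if n \<in> T then c n z * M q p z * M n j z else 0))
        - (\<Sum>n\<in>insert q T. if n = q then s z * M n j z else 0)"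
      unfolding c'_def sum_subtractf[symmetric] by (intro sum.cong) (auto simp: algebra_simps)
    also have "(\<Sum>n\<in>insert q T. if n = q then s z * M n j z else 0) = s z * M q j z"
      using T by (subst sum.delta) auto
    also have "(\<Sum>n\<in>insert q T. (if n \<in> T then c n z * M q p z * M n j z else 0))
      = (\<Sum>n\<in>T. c n z * M q p z * M n j z)"
      using T by (intro sum.mono_neutral_cong_right) auto
    finally show ?thesis
      unfolding s_def M'_def by (simp add: sum_distrib_right sum_distrib_left sum_subtractf algebra_simps)
  qed
  show ?case
  proof (intro exI conjI)
    show "finite (insert q T)" "insert q T \<subseteq> R" using T q by auto
    show "\<forall>n. c' n holomorphic_on UNIV"
    proof
      fix n
      have "(\<lambda>z. if n \<in> T then c n z * M q p z else 0) holomorphic_on UNIV"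
        by (cases "n \<in> T") (auto intro!: holomorphic_intros c insert.prems)
      moreover have "(\<lambda>z. if n = q then s z else 0) holomorphic_on UNIV"
        unfolding s_def by (cases "n = q") (auto intro!: holomorphic_intros c insert.prems)
      ultimately show "c' n holomorphic_on UNIV" unfolding c'_def by (intro holomorphic_intros)
    qed
    show "\<forall>j\<in>insert j0 (insert p J). \<forall>z. (\<Sum>n\<in>insert q T. c' n z * M n j z) = (if j = j0 then D z else 0)"
    proof (intro ballI allI)
      fix j z assume "j \<in> insert j0 (insert p J)"
      then consider "j = p" | "j \<in> insert j0 J" by auto
      then show "(\<Sum>n\<in>insert q T. c' n z * M n j z) = (if j = j0 then D z else 0)"
      proof cases
        case 1
        then have "(\<Sum>n\<in>T. c n z * M' n j z) = 0" by (simp add: M'_def mult.commute)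
        then show ?thesis using 1 pj0 by (simp only: sum if_False)
      next
        case 2
        then show ?thesis by (simp only: sum eq)
      qed
    qed
  qed (rule D)+
qed

text \<open>Induction on the modulus, adding the largest z p last. By the induction hypothesis the
  relations on T form a space of dimension at most one; if it is nontrivial, one more exponent n, so
  large that z p ^ n dominates, destroys it. An infinite S supplies such an n.\<close>

lemma power_independent:
  fixes z :: "'k \<Rightarrow> complex"
  assumes "finite K" "inj_on (\<lambda>k. norm (z k)) K" "\<And>k. k \<in> K \<Longrightarrow> z k \<noteq> 0" and S: "infinite S"
  shows "\<exists>T\<subseteq>S. finite T \<and> (\<forall>B. (\<forall>n\<in>T. (\<Sum>k\<in>K. B k * z k ^ n) = 0) \<longrightarrow> (\<forall>k\<in>K. B k = 0))"
  using assms(1-3)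
proof (induction K rule: finite_ranking_induct[where f = "\<lambda>k. norm (z k)"])
  case empty
  then show ?case by auto
next
  case (insert p K)
  show ?case
  proof (cases "p \<in> K")
    case True
    then show ?thesis using insert by (simp add: insert_absorb)
  next
    case False
    have less: "norm (z k) < norm (z p)" if "k \<in> K" for k
      using insert.hyps(2)[OF that] insert.prems(1) that False
      by (auto simp: inj_on_def order_le_less)
    obtain T where T: "T \<subseteq> S" "finite T"
      and IH: "\<And>B k. (\<And>n. n \<in> T \<Longrightarrow> (\<Sum>k\<in>K. B k * z k ^ n) = 0) \<Longrightarrow> k \<in> K \<Longrightarrow> B k = 0"
      using insert.IH insert.prems by (auto simp: inj_on_def)
    note sum_ins = sum.insert[OF insert.hyps(1) False]
    show ?thesis
    \<comment> \<open>By scaling, any relation with nonzero coefficient at p can be normalised to b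
      p = 1. If there is none, T already works.\<close>
    proof (cases "\<exists>b. b p = 1 \<and> (\<forall>n\<in>T. (\<Sum>k\<in>insert p K. b k * z k ^ n) = 0)")
      case True
      then obtain b where b: "b p = 1" "\<And>n. n \<in> T \<Longrightarrow> (\<Sum>k\<in>insert p K. b k * z k ^ n) = 0" by auto
      \<comment> \<open>After division by z p ^ n all other terms decay, so the sum tends to b p = 1
        and cannot vanish for large n.\<close>
      have "(\<lambda>n. \<Sum>k\<in>insert p K. b k * (z k / z p) ^ n) \<longlonglongrightarrow> (\<Sum>k\<in>insert p K. if k = p then 1 else 0)"
      proof (intro tendsto_sum)
        fix k assume "k \<in> insert p K"
        show "(\<lambda>n. b k * (z k / z p) ^ n) \<longlonglongrightarrow> (if k = p then 1 else 0)"
        proof (cases "k = p")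
          case True
          then show ?thesis using insert.prems(2)[of p] b(1) by simp
        next
          case False
          then have "norm (z k / z p) < 1"
            using less[of k] \<open>k \<in> insert p K\<close> insert.prems(2)[of p] by (simp add: norm_divide divide_less_eq)
          then have "(\<lambda>n. b k * (z k / z p) ^ n) \<longlonglongrightarrow> b k * 0"
            by (intro tendsto_mult tendsto_const LIMSEQ_power_zero)
          then show ?thesis using False by simp
        qed
      qed
      moreover have "(\<Sum>k\<in>insert p K. if k = p then 1 else 0) = (1 :: complex)"
        using insert.hyps(1) by (subst sum.delta) auto
      ultimately have "eventually (\<lambda>n. (\<Sum>k\<in>insert p K. b k * (z k / z p) ^ n) \<noteq> 0) sequentially"
        by (intro tendsto_imp_eventually_ne[of _ 1]) auto
      then obtain n0 where n0: "\<And>n. n \<ge> n0 \<Longrightarrow> (\<Sum>k\<in>insert p K. b k * (z k / z p) ^ n) \<noteq> 0"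
        by (auto simp: eventually_sequentially)
      obtain n where n: "n \<in> S" "n \<ge> n0" using S unfolding infinite_nat_iff_unbounded_le by auto
      have "(\<Sum>k\<in>insert p K. b k * z k ^ n) = (\<Sum>k\<in>insert p K. b k * (z k / z p) ^ n) * z p ^ n"
        using insert.prems(2)[of p] by (simp add: sum_distrib_right power_divide)
      then have nz: "(\<Sum>k\<in>insert p K. b k * z k ^ n) \<noteq> 0"
        using n0[OF n(2)] insert.prems(2)[of p] by simp
      show ?thesis
      proof (intro exI[of _ "insert n T"] conjI allI impI)
        fix B assume B: "\<forall>n\<in>insert n T. (\<Sum>k\<in>insert p K. B k * z k ^ n) = 0"
        \<comment> \<open>B - B p b has no component at p, so the induction hypothesis makes it
          vanish on K: every relation on T is a multiple of b.\<close>
        have eq: "B k = B p * b k" if "k \<in> K" for k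
        proof -
          have "(\<Sum>k\<in>K. (B k - B p * b k) * z k ^ m) = 0" if "m \<in> T" for m
          proof -
            have "(\<Sum>k\<in>K. (B k - B p * b k) * z k ^ m)
               = (\<Sum>k\<in>insert p K. B k * z k ^ m) - B p * (\<Sum>k\<in>insert p K. b k * z k ^ m)"
              unfolding sum_ins using b(1)
              by (simp add: algebra_simps sum_subtractf sum_distrib_left)
            then show ?thesis using B b(2) that by simp
          qed
          from IH[of "\<lambda>k. B k - B p * b k", OF this that] show ?thesis by simp
        qed
        have eq': "B k = B p * b k" if "k \<in> insert p K" for k using eq that b(1) by auto
        have "0 = (\<Sum>k\<in>insert p K. B k * z k ^ n)" using B by simp
        also have "\<dots> = B p * (\<Sum>k\<in>insert p K. b k * z k ^ n)"
          unfolding sum_distrib_left by (intro sum.cong refl) (subst eq', simp_all add: mult.assoc)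
        finally have "B p = 0" using nz by simp
        then show "\<forall>k\<in>insert p K. B k = 0" using eq by auto
      qed (use T n in auto)
    next
      case False
      show ?thesis
      proof (intro exI[of _ T] conjI allI impI)
        fix B assume B: "\<forall>n\<in>T. (\<Sum>k\<in>insert p K. B k * z k ^ n) = 0"
        have Bp: "B p = 0"
        proof (rule ccontr)
          assume "B p \<noteq> 0"
          then have "(\<Sum>k\<in>insert p K. (B k / B p) * z k ^ n) = 0" if "n \<in> T" for n
          proof -
            have "(\<Sum>k\<in>insert p K. (B k / B p) * z k ^ n) = (\<Sum>k\<in>insert p K. B k * z k ^ n) / B p"
              by (simp add: sum_divide_distrib)
            then show ?thesis using B that by simp
          qed
          with False \<open>B p \<noteq> 0\<close> show False by (auto dest!: spec[of _ "\<lambda>k. B k / B p"])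
        qed
        then have "(\<Sum>k\<in>K. B k * z k ^ n) = 0" if "n \<in> T" for n
          using B that by (simp add: sum_ins)
        then have "B k = 0" if "k \<in> K" for k using IH[of B k] that by blast
        then show "\<forall>k\<in>insert p K. B k = 0" using Bp by auto
      qed (use T in auto)
    qed
  qed
qed

text \<open>The condition says that the floor of \<beta> n - \<xi> does not change from n to n + 1.
  If this happened only finitely often, the floor would eventually grow by at least 1 per step, too
  fast for the slope \<beta> < 1.\<close>

lemma infinite_gap_pairs:
  fixes \<beta> \<xi> :: real
  assumes "0 < \<beta>" "\<beta> < 1"
  shows "infinite {n::nat. \<forall>j::int. \<beta> * n < \<xi> + j \<longleftrightarrow> \<beta> * (n + 1) < \<xi> + j}" (is "infinite ?S")
proof
  assume "finite ?S"
  define f where "f n = \<lfloor>\<beta> * real n - \<xi>\<rfloor>" for n :: nat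
  have less: "\<beta> * real n < \<xi> + j \<longleftrightarrow> f n < j" for n and j :: int
    unfolding f_def floor_less_iff by auto
  have inS: "n \<in> ?S" if "f (Suc n) = f n" for n
    using that less[of n] less[of "Suc n"] by (simp add: add.commute)
  obtain n0 where n0: "\<And>n. n \<in> ?S \<Longrightarrow> n < n0"
    using \<open>finite ?S\<close> finite_nat_set_iff_bounded by auto
  have mono: "f n \<le> f (Suc n)" for n
    unfolding f_def using assms(1) by (intro floor_mono) (simp add: algebra_simps)
  have ne: "f (Suc n) \<noteq> f n" if "n0 \<le> n" for n
    using inS[of n] n0[of n] that by linarith
  have step: "f n + 1 \<le> f (Suc n)" if "n0 \<le> n" for n
    using mono[of n] ne[OF that] by linarith
  have grow: "f n0 + int m \<le> f (n0 + m)" for m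
  proof (induction m)
    case (Suc m)
    then show ?case using step[of "n0 + m"] by simp
  qed simp
  have bound: "(1 - \<beta>) * real m \<le> \<beta> * real n0 - \<xi> - of_int (f n0)" for m
  proof -
    have "of_int (f n0) + real m \<le> of_int (f (n0 + m))" using grow[of m] by linarith
    also have "\<dots> \<le> \<beta> * real (n0 + m) - \<xi>" by (simp add: f_def)
    finally show ?thesis by (simp add: algebra_simps)
  qed
  obtain m :: nat where "(\<beta> * real n0 - \<xi> - of_int (f n0)) / (1 - \<beta>) < real m"
    using reals_Archimedean2 by blast
  then show False using bound[of m] assms by (simp add: divide_less_eq mult.commute)
qed

subsection \<open>Multiples of a polynomial close to a monomial\<close>

definition l2_coeffs :: "complex poly \<Rightarrow> real" where
  "l2_coeffs p = L2_set (\<lambda>i. norm (coeff p i)) {..degree p}"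

lemma l2_coeffs_eq:
  assumes "degree p \<le> n" shows "l2_coeffs p = L2_set (\<lambda>i. norm (coeff p i)) {..n}"
  unfolding l2_coeffs_def L2_set_def using assms
  by (intro arg_cong[where f = sqrt] sum.mono_neutral_left) (auto simp: coeff_eq_0)

lemma l2_coeffs_triangle: "l2_coeffs (p + q) \<le> l2_coeffs p + l2_coeffs q"
proof -
  define n where "n = max (degree p) (degree q)"
  have n: "degree p \<le> n" "degree q \<le> n" "degree (p + q) \<le> n"
    by (auto simp: n_def degree_add_le)
  have "l2_coeffs (p + q) \<le> L2_set (\<lambda>i. norm (coeff p i) + norm (coeff q i)) {..n}"
    unfolding l2_coeffs_eq[OF n(3)] by (intro L2_set_mono) (auto intro: norm_triangle_ineq)
  also have "\<dots> \<le> l2_coeffs p + l2_coeffs q"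
    unfolding l2_coeffs_eq[OF n(1)] l2_coeffs_eq[OF n(2)] by (rule L2_set_triangle_ineq)
  finally show ?thesis .
qed

lemma l2_coeffs_smult: "l2_coeffs (smult c p) = norm c * l2_coeffs p"
proof -
  have "l2_coeffs (smult c p) = L2_set (\<lambda>i. norm c * norm (coeff p i)) {..degree p}"
    unfolding l2_coeffs_eq[OF degree_smult_le] by (simp add: norm_mult)
  then show ?thesis by (simp only: L2_set_right_distrib[OF norm_ge_zero] l2_coeffs_def)
qed

lemma l2_coeffs_pCons_0: "l2_coeffs (pCons 0 p) = l2_coeffs p"
proof -
  have "l2_coeffs (pCons 0 p) = L2_set (\<lambda>i. norm (coeff (pCons 0 p) i)) {..Suc (degree p)}"
    by (rule l2_coeffs_eq) (rule degree_pCons_le)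
  also have "\<dots> = l2_coeffs p"
    unfolding l2_coeffs_def L2_set_def by (simp add: sum.atMost_Suc_shift del: sum.atMost_Suc)
  finally show ?thesis .
qed

text \<open>Multiplication by a fixed polynomial is bounded on coefficient sequences. The induction
  follows the Horner form; each coefficient a adds |a| to the constant.\<close>

lemma l2_coeffs_mult: "\<exists>C>0. \<forall>q. l2_coeffs (p * q) \<le> C * l2_coeffs q"
proof (induction p)
  case 0
  show ?case by (intro exI[of _ 1]) (auto simp: l2_coeffs_def L2_set_nonneg)
next
  case (pCons a p)
  then obtain C where C: "0 < C" "\<And>q. l2_coeffs (p * q) \<le> C * l2_coeffs q" by auto
  have "l2_coeffs (pCons a p * q) \<le> (norm a + C) * l2_coeffs q" for q
    using l2_coeffs_triangle[of "smult a q" "pCons 0 (p * q)"] C(2)[of q]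
    by (simp add: l2_coeffs_smult l2_coeffs_pCons_0 distrib_right)
  then show ?case using C(1) by (intro exI[of _ "norm a + C"]) (auto intro: add_nonneg_pos)
qed

text \<open>Multiples of x - z are the polynomials vanishing at z, so x^m is corrected by the
  smallest polynomial with the same value at z. The exponent m lies in the middle of the degrees
  0..2m: for |z| \<le> 1 the lower half, and for |z| > 1 the upper half, contributes m + 1 terms of
  size at least |z|^(2m) to s.\<close>

lemma linear_factor_approx:
  fixes z :: complex
  assumes "0 < e"
  shows "\<exists>Y m. l2_coeffs ([:- z, 1:] * Y - monom 1 m) < e"
proof -
  obtain m :: nat where m: "1 / e\<^sup>2 < real m" using reals_Archimedean2 by blast
  define s where "s = (\<Sum>i\<le>2 * m. norm z ^ (2 * i))"
  have s1: "norm z ^ (2 * i) \<le> s" if "i \<le> 2 * m" for i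
    unfolding s_def using that by (intro member_le_sum) auto
  have s: "0 < s" using s1[of 0] by simp
  text \<open>Minimal coefficient norm among the polynomials of degree at most \<open>2 * m\<close> agreeing with \<open>x ^ m\<close> at \<open>z\<close>.\<close>
  define R where "R = Poly (map (\<lambda>i. z ^ m * cnj z ^ i / of_real s) [0..<Suc (2 * m)])"
  have coeff_R: "coeff R i = (if i \<le> 2 * m then z ^ m * cnj z ^ i / of_real s else 0)" for i
    unfolding R_def coeff_Poly_eq nth_default_def by (auto simp del: upt_Suc)
  have deg: "degree R \<le> 2 * m" by (rule degree_le) (simp add: coeff_R)
  have "poly R z = (\<Sum>i\<le>2 * m. coeff R i * z ^ i)"
    unfolding poly_altdef using deg by (intro sum.mono_neutral_left) (auto simp: coeff_eq_0)
  also have "\<dots> = z ^ m / of_real s * (\<Sum>i\<le>2 * m. of_real (norm z ^ (2 * i)))"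
    unfolding sum_distrib_left
  proof (intro sum.cong refl)
    fix i assume "i \<in> {..2 * m}"
    moreover have "complex_of_real (norm z ^ (2 * i)) = z ^ i * cnj z ^ i"
      by (simp only: power_mult of_real_power[of _ i] complex_norm_square power_mult_distrib)
    ultimately show "coeff R i * z ^ i = z ^ m / of_real s * of_real (norm z ^ (2 * i))"
      by (simp add: coeff_R)
  qed
  also have "(\<Sum>i\<le>2 * m. complex_of_real (norm z ^ (2 * i))) = of_real s"
    unfolding s_def by (rule of_real_sum[symmetric])
  also have "z ^ m / of_real s * of_real s = z ^ m" using s by simp
  finally have "poly (monom 1 m - R) z = 0" by (simp add: poly_monom)
  then obtain Y where Y: "monom 1 m - R = [:- z, 1:] * Y"
    unfolding poly_eq_0_iff_dvd by (elim dvdE)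
  have "(l2_coeffs R)\<^sup>2 = (\<Sum>i\<le>2 * m. norm z ^ (2 * m) * norm z ^ (2 * i) / s\<^sup>2)"
    unfolding l2_coeffs_eq[OF deg] L2_set_def using s
    by (subst real_sqrt_pow2)
       (auto intro!: sum_nonneg sum.cong simp: coeff_R norm_mult norm_divide norm_power
          power_mult_distrib power_divide power_mult[symmetric] mult.commute)
  also have "\<dots> = norm z ^ (2 * m) / s"
    using s by (simp add: s_def power2_eq_square flip: sum_divide_distrib sum_distrib_left)
  also have "\<dots> \<le> 1 / (m + 1)"
  proof -
    have "real (m + 1) * norm z ^ (2 * m) \<le> s"
    proof (cases "norm z \<le> 1")
      case True
      have "real (m + 1) * norm z ^ (2 * m) = (\<Sum>i\<le>m. norm z ^ (2 * m))" by simp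
      also have "\<dots> \<le> (\<Sum>i\<le>m. norm z ^ (2 * i))"
        using True by (intro sum_mono power_decreasing) auto
      also have "\<dots> \<le> s" unfolding s_def by (intro sum_mono2) auto
      finally show ?thesis .
    next
      case False
      have "real (m + 1) * norm z ^ (2 * m) = (\<Sum>i\<in>{m..2 * m}. norm z ^ (2 * m))" by simp
      also have "\<dots> \<le> (\<Sum>i\<in>{m..2 * m}. norm z ^ (2 * i))"
        using False by (intro sum_mono power_increasing) auto
      also have "\<dots> \<le> s" unfolding s_def by (intro sum_mono2) auto
      finally show ?thesis .
    qed
    then show ?thesis using s by (simp add: field_simps)
  qed
  also have "\<dots> < e\<^sup>2"
  proof -
    have "1 < e\<^sup>2 * real m" using m assms by (simp add: field_simps)
    also have "\<dots> \<le> e\<^sup>2 * (m + 1)" by (intro mult_left_mono) auto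
    finally show ?thesis by (simp add: field_simps)
  qed
  finally have "l2_coeffs R < e" using assms by (simp add: power2_less_imp_less)
  moreover have "l2_coeffs ([:- z, 1:] * Y - monom 1 m) = l2_coeffs R"
    unfolding Y[symmetric] using l2_coeffs_smult[of "- 1" R] by simp
  ultimately show ?thesis by metis
qed

text \<open>Roots are split off one at a time and the approximants multiplied. The exponent m stays
  free; a shift of indices later moves the monomial to any prescribed place.\<close>

lemma poly_approx_monom:
  assumes "p \<noteq> 0" "0 < e"
  shows "\<exists>Y m. l2_coeffs (p * Y - monom 1 m) < e"
  using assms
proof (induction "degree p" arbitrary: p e)
  case 0
  then obtain a where "p = [:a:]" "a \<noteq> 0" by (metis degree_0_id of_nat_0 pCons_eq_0_iff degree_eq_zeroE)
  then have "p * [:1 / a:] - monom 1 0 = 0" by (simp add: monom_0)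
  then show ?case using 0 by (intro exI[of _ "[:1 / a:]"] exI[of _ 0]) (simp add: l2_coeffs_def)
next
  case (Suc d)
  then obtain z where "poly p z = 0"
    using Suc.hyps(2) by (metis degree_pCons_0 fundamental_theorem_of_algebra_alt old.nat.distinct(1))
  then obtain q where q: "p = [:- z, 1:] * q" unfolding poly_eq_0_iff_dvd by (elim dvdE)
  then have "q \<noteq> 0" using Suc.prems by auto
  then have "degree q = d" using Suc.hyps(2) unfolding q by (subst (asm) degree_mult_eq) auto
  obtain Y m where Y: "l2_coeffs ([:- z, 1:] * Y - monom 1 m) < e / 2"
    using linear_factor_approx[of "e / 2" z] Suc.prems(2) by auto
  \<comment> \<open>C depends on Y, so Y' is chosen afterwards with its tolerance divided by
    C.\<close>
  obtain C where C: "0 < C" "\<And>r. l2_coeffs ([:- z, 1:] * Y * r) \<le> C * l2_coeffs r"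
    using l2_coeffs_mult by blast
  obtain Y' m' where Y': "l2_coeffs (q * Y' - monom 1 m') < e / 2 / C"
    using Suc.hyps(1)[of q "e / 2 / C"] \<open>q \<noteq> 0\<close> \<open>degree q = d\<close> Suc.prems(2) C(1) by auto
  have mono: "l2_coeffs (monom 1 n * r) = l2_coeffs r" for n r
  proof (induction n)
    case (Suc n)
    then show ?case by (simp add: monom_Suc l2_coeffs_pCons_0)
  qed (simp add: monom_0 one_pCons[symmetric])
  have "p * (Y * Y') - monom 1 (m + m')
      = [:- z, 1:] * Y * (q * Y' - monom 1 m') + monom 1 m' * ([:- z, 1:] * Y - monom 1 m)"
  proof -
    have "monom 1 (m + m') = (monom 1 m :: complex poly) * monom 1 m'" by (simp add: mult_monom)
    then show ?thesis unfolding q by (simp only: ring_distribs right_diff_distrib left_diff_distrib mult_ac) simp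
  qed
  then have "l2_coeffs (p * (Y * Y') - monom 1 (m + m'))
      \<le> l2_coeffs ([:- z, 1:] * Y * (q * Y' - monom 1 m')) + l2_coeffs (monom 1 m' * ([:- z, 1:] * Y - monom 1 m))"
    by (metis l2_coeffs_triangle)
  also have "\<dots> < C * (e / 2 / C) + e / 2"
    unfolding mono
    using le_less_trans[OF C(2) mult_strict_left_mono[OF Y' C(1)]] Y by (rule add_strict_mono)
  also have "\<dots> = e" using C(1) by simp
  finally show ?case by metis
qed

subsection \<open>Fibres of sums of one-sided exponentials\<close>

lemma non_integer_distance:
  fixes x :: real
  assumes "\<And>j::int. x + j \<noteq> 0"
  shows "\<exists>d>0. \<forall>j::int. d \<le> \<bar>x + j\<bar>"
proof (intro exI conjI allI)
  have f: "0 < frac x" "frac x < 1"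
    using assms[of "- \<lfloor>x\<rfloor>"] frac_ge_0[of x] frac_lt_1[of x] by (auto simp: frac_def less_le)
  then show "0 < min (frac x) (1 - frac x)" by simp
  fix j :: int
  have x: "x = of_int \<lfloor>x\<rfloor> + frac x" by (simp add: frac_def)
  show "min (frac x) (1 - frac x) \<le> \<bar>x + j\<bar>"
  proof (cases "0 \<le> \<lfloor>x\<rfloor> + j")
    case True
    then have "(0::real) \<le> of_int \<lfloor>x\<rfloor> + of_int j" by (metis of_int_0_le_iff of_int_add)
    then show ?thesis using x f by linarith
  next
    case False
    then have "\<lfloor>x\<rfloor> + j \<le> - 1" by simp
    then have "of_int \<lfloor>x\<rfloor> + of_int j \<le> (- 1 :: real)" by (metis of_int_add of_int_le_iff of_int_minus of_int_1)
    then show ?thesis using x f by linarith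
  qed
qed

text \<open>The gap d makes order patterns stable: moving every f n by less than d carries no point
  f n + j across 0.\<close>

lemma finite_non_integer_distance:
  fixes f :: "'n \<Rightarrow> real"
  assumes "finite R" "\<And>n j. n \<in> R \<Longrightarrow> f n + real_of_int j \<noteq> 0"
  shows "\<exists>d>0. \<forall>n\<in>R. \<forall>j::int. d \<le> \<bar>f n + j\<bar>"
  using assms
proof (induction R rule: finite_induct)
  case empty
  then show ?case by (intro exI[of _ 1]) auto
next
  case (insert n R)
  then obtain d where "0 < d" "\<forall>n\<in>R. \<forall>j::int. d \<le> \<bar>f n + j\<bar>" by auto
  moreover obtain e where "0 < e" "\<forall>j::int. e \<le> \<bar>f n + j\<bar>"
    using non_integer_distance[of "f n"] insert.prems by blast
  ultimately show ?case by (intro exI[of _ "min d e"]) (auto intro: min.coboundedI1 min.coboundedI2)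
qed

lemma exists_multiple_between:
  fixes \<beta> y :: real
  assumes "0 < \<beta>" "\<beta> < 1"
  shows "\<exists>n::int. y < \<beta> * n \<and> \<beta> * n < y + 1"
proof (intro exI[of _ "\<lfloor>y / \<beta>\<rfloor> + 1"] conjI)
  have 1: "y / \<beta> < of_int (\<lfloor>y / \<beta>\<rfloor> + 1)" "of_int (\<lfloor>y / \<beta>\<rfloor> + 1) \<le> y / \<beta> + 1"
    by linarith+
  show "y < \<beta> * of_int (\<lfloor>y / \<beta>\<rfloor> + 1)" using mult_strict_left_mono[OF 1(1) assms(1)] assms by simp
  have "\<beta> * of_int (\<lfloor>y / \<beta>\<rfloor> + 1) \<le> \<beta> * (y / \<beta> + 1)" using 1(2) assms by (intro mult_left_mono) auto
  also have "\<dots> < y + 1" using assms by (simp add: distrib_left)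
  finally show "\<beta> * of_int (\<lfloor>y / \<beta>\<rfloor> + 1) < y + 1" .
qed

text \<open>Exceptional sets are found only locally, near uncountably many points; Lindelof's
  theorem reduces the neighbourhoods to countably many.\<close>

lemma countable_of_locally_countable:
  fixes X B :: "real set"
  assumes "\<And>x. x \<in> X \<Longrightarrow> \<exists>U. open U \<and> x \<in> U \<and> countable (U \<inter> B)"
  shows "countable (X \<inter> B)"
proof -
  define \<F> where "\<F> = {U. open U \<and> countable (U \<inter> B)}"
  obtain \<F>' where F': "\<F>' \<subseteq> \<F>" "countable \<F>'" "\<Union>\<F>' = \<Union>\<F>"
    using Lindelof[of \<F>] by (auto simp: \<F>_def)
  have "X \<subseteq> \<Union>\<F>" using assms by (fastforce simp: \<F>_def)
  then have "X \<inter> B \<subseteq> (\<Union>U\<in>\<F>'. U \<inter> B)" using F'(3) by blast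
  moreover have "countable (\<Union>U\<in>\<F>'. U \<inter> B)" using F'(1,2) unfolding \<F>_def by (intro countable_UN) auto
  ultimately show ?thesis using countable_subset by blast
qed

section \<open>The window on the Fourier side and its fibres\<close>

locale cauchy_sum =
  fixes K :: "nat set" and a w :: "nat \<Rightarrow> complex" and \<beta> :: real
  assumes K: "finite K" "K \<noteq> {}" and a: "\<And>k. k \<in> K \<Longrightarrow> a k \<noteq> 0"
    and w: "\<And>k. k \<in> K \<Longrightarrow> Re (w k) \<noteq> 0" and inj: "inj_on (\<lambda>k. Re (w k)) K" and \<beta>: "0 < \<beta>"
begin

text \<open>The argument is complex so that dependence on \<xi> extends to an entire
  function.\<close>

definition ex :: "nat \<Rightarrow> complex \<Rightarrow> complex" where
  "ex k s = exp (2 * of_real pi * w k * s)"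

text \<open>Up to the factor -2 pi \<i>, the difference between the analytic formulas for
  \<open>kap\<close> on the right and on the left of 0.\<close>

definition jump :: "complex \<Rightarrow> complex" where
  "jump s = (\<Sum>k\<in>K. a k * ex k s)"

definition kap :: "real \<Rightarrow> complex" where
  "kap y = (\<Sum>k\<in>K. a k * cauchy_pre (w k) y)"

definition left_part :: "complex \<Rightarrow> complex" where
  "left_part s = (\<Sum>k\<in>{k\<in>K. 0 < Re (w k)}. 2 * of_real pi * \<i> * a k * ex k s)"

lemma ex_add: "ex k (s + t) = ex k s * ex k t"
  by (simp add: ex_def distrib_left exp_add)

lemma ex_minus: "ex k (- s) = inverse (ex k s)"
  by (simp add: ex_def exp_minus)

lemma ex_nonzero [simp]: "ex k s \<noteq> 0"
  by (simp add: ex_def)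

lemma ex_0 [simp]: "ex k 0 = 1"
  by (simp add: ex_def)

lemma norm_ex: "norm (ex k (of_real y)) = exp (2 * pi * Re (w k) * y)"
  by (simp add: ex_def)

text \<open>Terms with \<open>Re (w k)\<close> > 0 are present on the left and must cancel on the
  right, the others must appear on the right. Subtracting the full sum does both, because all jumps
  have the same factor.\<close>

lemma kap_eq:
  assumes "y \<noteq> 0"
  shows "kap y = left_part (of_real y) - (if 0 < y then 2 * of_real pi * \<i> * jump (of_real y) else 0)"
proof -
  have "kap y = (\<Sum>k\<in>K. (if 0 < Re (w k) then 2 * of_real pi * \<i> * a k * ex k (of_real y) else 0)
      - (if 0 < y then 2 * of_real pi * \<i> * a k * ex k (of_real y) else 0))"
    unfolding kap_def
    using assms w by (intro sum.cong) (auto simp: cauchy_pre_def ex_def indicator_def)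
  also have "\<dots> = left_part (of_real y) - (if 0 < y then 2 * of_real pi * \<i> * jump (of_real y) else 0)"
    unfolding sum_subtractf left_part_def jump_def using K
    by (simp add: sum.inter_filter sum_distrib_left mult.assoc cong: if_cong)
  finally show ?thesis .
qed

lemma tame_kap: "tame kap"
  unfolding kap_def[abs_def] by (intro tame_sum tame_cmult tame_cauchy_pre w)

lemma isCont_kap: "x \<noteq> 0 \<Longrightarrow> isCont kap x"
  unfolding kap_def[abs_def] by (intro continuous_intros isCont_cauchy_pre)

text \<open>This condition makes the sequences \<open>fib T c \<xi>\<close> finitely supported.\<close>

definition annihilating :: "int set \<Rightarrow> (int \<Rightarrow> complex) \<Rightarrow> bool" where
  "annihilating T c \<longleftrightarrow> (\<forall>k\<in>K. (\<Sum>n\<in>T. c n * ex k (- of_real (\<beta> * n))) = 0)"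

definition fib :: "int set \<Rightarrow> (int \<Rightarrow> complex) \<Rightarrow> real \<Rightarrow> int \<Rightarrow> complex" where
  "fib T c \<xi> j = (\<Sum>n\<in>T. c n * kap (\<xi> + j - \<beta> * n))"

definition err :: "int set \<Rightarrow> (int \<Rightarrow> complex) \<Rightarrow> int \<Rightarrow> real \<Rightarrow> ennreal" where
  "err T c j0 \<xi> = (\<integral>\<^sup>+ j. ennreal ((norm (fib T c \<xi> j - (if j = j0 then 1 else 0)))\<^sup>2) \<partial>count_space UNIV)"

lemma annihilating_sum:
  assumes "annihilating T c" "k \<in> K"
  shows "(\<Sum>n\<in>T. c n * ex k (of_real (y - \<beta> * n))) = 0"
proof -
  have "(\<Sum>n\<in>T. c n * ex k (of_real (y - \<beta> * n))) = ex k (of_real y) * (\<Sum>n\<in>T. c n * ex k (- of_real (\<beta> * n)))"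
    unfolding sum_distrib_left
    by (intro sum.cong) (simp_all add: ex_add[symmetric])
  then show ?thesis using assms by (simp add: annihilating_def)
qed

lemma annihilating_comb:
  assumes "annihilating T c" "I \<subseteq> K"
  shows "(\<Sum>n\<in>T. c n * (\<Sum>k\<in>I. b k * ex k (of_real (y - \<beta> * n)))) = 0"
proof -
  have "(\<Sum>n\<in>T. c n * (\<Sum>k\<in>I. b k * ex k (of_real (y - \<beta> * n))))
      = (\<Sum>k\<in>I. b k * (\<Sum>n\<in>T. c n * ex k (of_real (y - \<beta> * n))))"
    unfolding sum_distrib_left by (subst sum.swap) (simp add: mult.left_commute)
  also have "\<dots> = 0" using annihilating_sum[OF assms(1)] assms(2) by (intro sum.neutral) auto
  finally show ?thesis .
qed

lemma annihilating_jump: "annihilating T c \<Longrightarrow> (\<Sum>n\<in>T. c n * jump (of_real (y - \<beta> * n))) = 0"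
  unfolding jump_def by (rule annihilating_comb) auto

lemma annihilating_left_part: "annihilating T c \<Longrightarrow> (\<Sum>n\<in>T. c n * left_part (of_real (y - \<beta> * n))) = 0"
  unfolding left_part_def by (rule annihilating_comb) auto

text \<open>Annihilation removes the \<open>left_part\<close> of all shifts together; what remains
  are the jump terms of the shifts lying to the left of \<xi> + j. Ties are excluded because
  \<open>kap_eq\<close> fails at 0.\<close>

lemma fib_eq:
  assumes "annihilating T c" "finite T" and ne: "\<And>n. n \<in> T \<Longrightarrow> \<xi> + j \<noteq> \<beta> * n"
  shows "fib T c \<xi> j = - 2 * of_real pi * \<i> *
    (\<Sum>n\<in>{n\<in>T. \<beta> * n < \<xi> + j}. c n * jump (of_real (\<xi> + j - \<beta> * n)))"
proof -
  have "fib T c \<xi> j = (\<Sum>n\<in>T. c n * left_part (of_real (\<xi> + j - \<beta> * n)))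
      - (\<Sum>n\<in>T. if \<beta> * n < \<xi> + j then 2 * of_real pi * \<i> * (c n * jump (of_real (\<xi> + j - \<beta> * n))) else 0)"
    unfolding fib_def sum_subtractf[symmetric]
    by (intro sum.cong refl, subst kap_eq) (use ne in \<open>auto simp: algebra_simps\<close>)
  also have "\<dots> = - (\<Sum>n\<in>{n\<in>T. \<beta> * n < \<xi> + j}. 2 * of_real pi * \<i> * (c n * jump (of_real (\<xi> + j - \<beta> * n))))"
    unfolding annihilating_left_part[OF assms(1)] by (simp only: sum.inter_filter[OF assms(2)] diff_0)
  finally show ?thesis unfolding sum_distrib_left[symmetric] by (simp only: mult_minus_left)
qed

text \<open>Left of all shifts no jump term is present; right of them the complete jump sum appears,
  and annihilation makes it vanish.\<close>

lemma fib_outside: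
  assumes "annihilating T c" "finite T"
    and "(\<forall>n\<in>T. \<xi> + j < \<beta> * n) \<or> (\<forall>n\<in>T. \<beta> * n < \<xi> + j)"
  shows "fib T c \<xi> j = 0"
proof -
  have "fib T c \<xi> j = - 2 * of_real pi * \<i> *
    (\<Sum>n\<in>{n\<in>T. \<beta> * n < \<xi> + j}. c n * jump (of_real (\<xi> + j - \<beta> * n)))"
    using assms(3) by (intro fib_eq assms(1,2)) auto
  moreover have "{n\<in>T. \<beta> * n < \<xi> + j} = {} \<or> {n\<in>T. \<beta> * n < \<xi> + j} = T" using assms(3) by fastforce
  then have "(\<Sum>n\<in>{n\<in>T. \<beta> * n < \<xi> + j}. c n * jump (of_real (\<xi> + j - \<beta> * n))) = 0"
    by (elim disjE) (simp_all only: sum.empty annihilating_jump[OF assms(1)])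
  ultimately show ?thesis by (simp only: mult_zero_right)
qed

lemma err_eq:
  assumes "finite J" "j0 \<in> J" "\<And>j. j \<notin> J \<Longrightarrow> fib T c \<xi> j = 0"
  shows "err T c j0 \<xi> = ennreal (\<Sum>j\<in>J. (norm (fib T c \<xi> j - (if j = j0 then 1 else 0)))\<^sup>2)"
proof -
  have "err T c j0 \<xi> = (\<Sum>j\<in>J. ennreal ((norm (fib T c \<xi> j - (if j = j0 then 1 else 0)))\<^sup>2))"
    unfolding err_def using assms by (intro nn_integral_count_space') auto
  then show ?thesis by simp
qed

text \<open>Near \<xi> the fibres are supported in one fixed finite set and their entries vary
  continuously because no tie occurs, so the error is a finite sum of continuous functions.\<close>

lemma err_continuous:
  assumes ann: "annihilating T c" and T: "finite T" and ne: "\<And>n j. n \<in> T \<Longrightarrow> \<xi> + real_of_int j \<noteq> \<beta> * n"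
    and e: "err T c j0 \<xi> < ennreal e"
  shows "\<exists>d>0. \<forall>x. \<bar>x - \<xi>\<bar> < d \<longrightarrow> err T c j0 x < ennreal e"
proof -
  obtain B where B: "\<And>n. n \<in> T \<Longrightarrow> \<bar>\<beta> * real_of_int n\<bar> \<le> B"
    using T finite_imp_bounded[of "(\<lambda>n. \<beta> * real_of_int n) ` T"] unfolding bounded_iff by auto
  \<comment> \<open>The extra unit beyond B leaves room for moving \<xi> by less than 1.\<close>
  define J where "J = insert j0 {j. \<bar>\<xi> + real_of_int j\<bar> \<le> B + 1}"
  have "{j. \<bar>\<xi> + real_of_int j\<bar> \<le> B + 1} \<subseteq> {\<lfloor>- B - 1 - \<xi>\<rfloor>..\<lceil>B + 1 - \<xi>\<rceil>}"
    by (auto simp: abs_le_iff) linarith+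
  then have J: "finite J" "j0 \<in> J" unfolding J_def using finite_subset by auto
  have out: "fib T c x j = 0" if "j \<notin> J" "\<bar>x - \<xi>\<bar> < 1" for x j
  proof (rule fib_outside[OF ann T])
    have "B < \<bar>x + real_of_int j\<bar>" using that by (auto simp: J_def)
    then show "(\<forall>n\<in>T. x + j < \<beta> * n) \<or> (\<forall>n\<in>T. \<beta> * n < x + j)"
      using B by (cases "0 \<le> x + real_of_int j") (fastforce simp: abs_le_iff)+
  qed
  define S where "S x = (\<Sum>j\<in>J. (norm (fib T c x j - (if j = j0 then 1 else 0)))\<^sup>2)" for x
  have err: "err T c j0 x = ennreal (S x)" if "\<bar>x - \<xi>\<bar> < 1" for x
    unfolding S_def using J out that by (intro err_eq) auto
  have "isCont (\<lambda>x. fib T c x j) \<xi>" for j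
    unfolding fib_def
  proof (intro continuous_intros)
    fix n assume "n \<in> T"
    then have "\<xi> + real_of_int j - \<beta> * n \<noteq> 0" using ne[of n j] by simp
    then show "isCont (\<lambda>x. kap (x + real_of_int j - \<beta> * n)) \<xi>"
      by (intro isCont_o2[of \<xi> "\<lambda>x. x + real_of_int j - \<beta> * n" kap] isCont_kap) auto
  qed
  then have "isCont S \<xi>" unfolding S_def by (intro continuous_intros)
  moreover have "0 \<le> S \<xi>" unfolding S_def by (intro sum_nonneg) auto
  then have "S \<xi> < e" using e err[of \<xi>] by (auto simp: ennreal_less_iff)
  ultimately have "\<forall>\<^sub>F x in at \<xi>. S x < e" unfolding isCont_def by (rule order_tendstoD)
  then obtain d where "0 < d" "\<And>x. x \<noteq> \<xi> \<Longrightarrow> dist x \<xi> < d \<Longrightarrow> S x < e"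
    unfolding eventually_at by auto
  with \<open>S \<xi> < e\<close> have "S x < e" if "\<bar>x - \<xi>\<bar> < d" for x
    using that by (cases "x = \<xi>") (auto simp: dist_real_def)
  then have "err T c j0 x < ennreal e" if "\<bar>x - \<xi>\<bar> < min d 1" for x
    using that err[of x] unfolding S_def
    by (auto simp: ennreal_less_iff sum_nonneg)
  then show ?thesis using \<open>0 < d\<close> by (intro exI[of _ "min d 1"]) auto
qed

text \<open>Ties are excluded so that the same T and c remain within the tolerance near \<xi>, by
  \<open>err_continuous\<close>.\<close>

definition good :: "int \<Rightarrow> real \<Rightarrow> real \<Rightarrow> bool" where
  "good j0 e \<xi> \<longleftrightarrow> (\<exists>T c. finite T \<and> annihilating T c \<and>
     (\<forall>n\<in>T. \<forall>j::int. \<xi> + j \<noteq> \<beta> * n) \<and> err T c j0 \<xi> < ennreal e)"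

section \<open>Exact unit vectors on generic fibres for \<beta> < 1\<close>

lemma ex_quotient_tendsto:
  assumes "k \<in> K" "p \<in> K" "\<And>k. k \<in> K \<Longrightarrow> Re (w k) \<le> Re (w p)"
  shows "((\<lambda>x. ex k (of_real x + t) * inverse (ex p (of_real x + t))) \<longlongrightarrow> (if k = p then 1 else 0)) at_top"
proof (cases "k = p")
  case False
  then have "Re (w k) < Re (w p)" using assms inj by (metis inj_onD order_le_less)
  then have neg: "2 * pi * (Re (w k) - Re (w p)) < 0" by (simp add: mult_pos_neg)
  have "((\<lambda>x. exp (2 * pi * (Re (w k) - Re (w p)) * x)) \<longlongrightarrow> 0) at_top"
    by (rule filterlim_compose[OF exp_at_bot])
       (auto intro!: filterlim_tendsto_neg_mult_at_bot[OF tendsto_const neg] filterlim_ident)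
  moreover have "norm (ex k (of_real x) * inverse (ex p (of_real x))) = exp (2 * pi * (Re (w k) - Re (w p)) * x)" for x
    by (simp add: norm_mult norm_inverse norm_ex exp_minus[symmetric] exp_add[symmetric] algebra_simps)
  ultimately have "((\<lambda>x. ex k (of_real x) * inverse (ex p (of_real x))) \<longlongrightarrow> 0) at_top"
    by (subst tendsto_norm_zero_iff[symmetric]) simp
  then have "((\<lambda>x. ex k (of_real x) * inverse (ex p (of_real x)) * (ex k t * inverse (ex p t))) \<longlongrightarrow> 0) at_top"
    by (rule tendsto_mult_left_zero)
  then show ?thesis using False by (simp add: ex_add mult_ac)
qed simp

text \<open>For \<open>\<beta> < 1\<close> some unit intervals between consecutive points of \<open>\<xi> + \<int>\<close> contain two points of
  \<open>\<beta>\<int>\<close>, so that in a large window there are at least as many conditions as unknowns. As \<open>\<xi>\<close> tends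
  formally to \<open>+\<infinity>\<close> with the order pattern frozen, only the dominant exponential survives and the conditions
  become independent.\<close>

lemma local_exact:
  assumes \<beta>1: "\<beta> < 1" and ne: "\<And>(n::int) (j::int). \<xi>\<^sub>0 + j \<noteq> \<beta> * n"
  shows "\<exists>d>0. \<exists>C. countable C \<and> (\<forall>\<xi>. \<bar>\<xi> - \<xi>\<^sub>0\<bar> < d \<longrightarrow> \<xi> \<notin> C \<longrightarrow>
    (\<exists>T c. finite T \<and> annihilating T c \<and> (\<forall>n\<in>T. \<forall>j::int. \<xi> + j \<noteq> \<beta> * n) \<and>
      (\<forall>j. fib T c \<xi> j = (if j = j0 then 1 else 0))))"
proof -
  obtain p where p: "p \<in> K" "\<And>k. k \<in> K \<Longrightarrow> Re (w k) \<le> Re (w p)"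
    using K obtains_MAX[of K "\<lambda>k. Re (w k)"] by (metis Max_ge finite_imageI imageI)
  \<comment> \<open>The number exp (2 pi \<beta> (w p - w k)): its modulus is 1 for k = p and
    exceeds 1 otherwise, with distinct moduli for distinct k.\<close>
  define z where "z k = inverse (ex k (of_real \<beta>)) * ex p (of_real \<beta>)" for k
  have norm_z: "norm (z k) = exp (2 * pi * \<beta> * (Re (w p) - Re (w k)))" for k
    by (simp add: z_def norm_mult norm_inverse norm_ex exp_minus[symmetric] exp_add[symmetric] algebra_simps)
  define K' where "K' = K - {p}"
  have z_gt: "1 < norm (z k)" if "k \<in> K'" for k
  proof -
    have "Re (w k) < Re (w p)" using p(2)[of k] inj that p(1) unfolding K'_def
      by (metis Diff_iff inj_onD insertI1 order_le_less)
    then show ?thesis using \<beta> by (simp add: norm_z)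
  qed
  have z_inj: "inj_on (\<lambda>k. norm (z k)) K'"
    using inj \<beta> by (auto simp: inj_on_def norm_z K'_def)
  have z_pow: "z k ^ n = inverse (ex k (of_real (\<beta> * n))) * ex p (of_real (\<beta> * n))" for k n
    unfolding z_def power_mult_distrib power_inverse
    by (simp add: ex_def exp_of_nat_mult[symmetric] mult_ac)
  \<comment> \<open>For these n no point of the fibre separates \<beta> n from \<beta> (n + 1), so
    the jump parts of rows n and n + 1 coincide in the limit.\<close>
  define S where "S = {n::nat. \<forall>j::int. \<beta> * n < \<xi>\<^sub>0 + j \<longleftrightarrow> \<beta> * (n + 1) < \<xi>\<^sub>0 + j}"
  have "infinite S" unfolding S_def by (rule infinite_gap_pairs[OF \<beta> \<beta>1])
  moreover have "z k \<noteq> 0" if "k \<in> K'" for k using z_gt[OF that] by auto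
  moreover have "finite K'" using K by (simp add: K'_def)
  ultimately have "\<exists>T\<subseteq>S. finite T \<and> (\<forall>B. (\<forall>n\<in>T. (\<Sum>k\<in>K'. B k * z k ^ n) = 0) \<longrightarrow> (\<forall>k\<in>K'. B k = 0))"
    by (intro power_independent z_inj) auto
  then obtain T' where T': "T' \<subseteq> S" "finite T'"
    and T'_indep: "\<forall>B. (\<forall>n\<in>T'. (\<Sum>k\<in>K'. B k * z k ^ n) = 0) \<longrightarrow> (\<forall>k\<in>K'. B k = 0)"
    by (elim exE conjE)
  have indep: "B k = 0" if "\<And>n. n \<in> T' \<Longrightarrow> (\<Sum>k\<in>K'. B k * z k ^ n) = 0" "k \<in> K'" for B k
    using T'_indep[THEN spec, of B] that by simp
  obtain n0 where n0: "\<And>n. n \<in> T' \<Longrightarrow> n < n0" using T'(2) finite_nat_set_iff_bounded by auto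
  \<comment> \<open>The window must contain j0, and the rows n and n + 1 for n in T' must be
    available.\<close>
  obtain L :: nat where L: "\<bar>of_int j0\<bar> + \<bar>\<xi>\<^sub>0\<bar> + \<beta> * (n0 + 1) < real L" using reals_Archimedean2 by blast
  have "0 \<le> \<beta> * (n0 + 1)" using \<beta> by simp
  then have "\<bar>of_int j0\<bar> < real L" and L\<xi>: "\<bar>\<xi>\<^sub>0\<bar> < real L" using L by linarith+
  then have Lj0: "j0 \<in> {- int L..int L}" by (simp add: abs_less_iff)
  \<comment> \<open>One unit beyond the window on either side guarantees a multiple of \<beta> to
    the left and to the right of each window point.\<close>
  define R where "R = {n::int. \<xi>\<^sub>0 - L - 1 < \<beta> * n \<and> \<beta> * n < \<xi>\<^sub>0 + L + 1}"
  have finR: "finite R"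
  proof (rule finite_subset)
    show "R \<subseteq> {\<lfloor>(\<xi>\<^sub>0 - L - 1) / \<beta>\<rfloor>..\<lceil>(\<xi>\<^sub>0 + L + 1) / \<beta>\<rceil>}"
    proof
      fix n assume "n \<in> R"
      then have "(\<xi>\<^sub>0 - L - 1) / \<beta> < n" "n < (\<xi>\<^sub>0 + L + 1) / \<beta>"
        using \<beta> by (auto simp: R_def divide_less_eq less_divide_eq mult.commute)
      then show "n \<in> {\<lfloor>(\<xi>\<^sub>0 - L - 1) / \<beta>\<rfloor>..\<lceil>(\<xi>\<^sub>0 + L + 1) / \<beta>\<rceil>}"
        by auto linarith+
    qed
  qed auto
  have T'_R: "int n \<in> R" "int n + 1 \<in> R" if "n \<in> T'" for n
  proof -
    have "real n + 1 \<le> n0 + 1" using n0[OF that] by simp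
    then have "\<beta> * (real n + 1) \<le> \<beta> * (n0 + 1)" using \<beta> by (intro mult_left_mono) auto
    then have "\<beta> * (real n + 1) < \<xi>\<^sub>0 + L + 1" using L L\<xi> by linarith
    moreover have "0 \<le> \<beta> * real n" "\<beta> * real n \<le> \<beta> * (real n + 1)" using \<beta> by (auto simp: distrib_left)
    moreover have "\<xi>\<^sub>0 - L - 1 < 0" using L\<xi> by linarith
    ultimately show "int n \<in> R" "int n + 1 \<in> R" unfolding R_def by auto
  qed
  \<comment> \<open>Rows are shifts n. A column \<open>Inl k\<close> expresses annihilation of the
    k-th exponential; a column \<open>Inr j\<close> gives the jump contribution at position j with
    the order pattern of \<open>\<xi>\<^sub>0\<close>, divided by the dominant exponential so that a
    limit exists.\<close>
  define M where "M n j = (case j of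
      Inl k \<Rightarrow> (\<lambda>s. if k \<in> K then inverse (ex k (of_real (\<beta> * of_int n))) else 0)
    | Inr j \<Rightarrow> (\<lambda>s. if \<beta> * of_int n < \<xi>\<^sub>0 + of_int j
        then jump (s + of_int j - of_real (\<beta> * of_int n)) * inverse (ex p (s + of_int j)) else 0))"
    for n :: int and j :: "nat + int"
  define Lm where "Lm n j = (case j of
      Inl k \<Rightarrow> (if k \<in> K then inverse (ex k (of_real (\<beta> * of_int n))) else 0)
    | Inr j \<Rightarrow> (if \<beta> * of_int n < \<xi>\<^sub>0 + of_int j then a p * inverse (ex p (of_real (\<beta> * of_int n))) else 0))"
    for n :: int and j :: "nat + int"
  define JJ where "JJ = (Inl ` K \<union> Inr ` {- int L..int L} :: (nat + int) set)"
  have JJ: "insert (Inr j0) (JJ - {Inr j0}) = JJ" "finite JJ" using Lj0 K by (auto simp: JJ_def)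
  have sum_JJ: "(\<Sum>j\<in>JJ. f j) = (\<Sum>k\<in>K. f (Inl k)) + (\<Sum>j\<in>{- int L..int L}. f (Inr j))"
    for f :: "nat + int \<Rightarrow> complex"
    unfolding JJ_def using K by (subst sum.union_disjoint) (auto simp: sum.reindex)
  have M_hol: "M n j holomorphic_on UNIV" for n j
  proof (cases j)
    case (Inr j)
    have "(\<lambda>s. jump (s + of_int j - of_real (\<beta> * of_int n)) * inverse (ex p (s + of_int j))) holomorphic_on UNIV"
      unfolding jump_def ex_def by (intro holomorphic_intros) auto
    then show ?thesis unfolding M_def Inr sum.case
      by (cases "\<beta> * of_int n < \<xi>\<^sub>0 + of_int j") (simp_all only: if_True if_False holomorphic_on_const)
  qed (auto simp: M_def)
  have M_lim: "((\<lambda>x. M n j (of_real x)) \<longlongrightarrow> Lm n j) at_top" for n j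
  proof (cases j)
    case (Inr j)
    have eq: "jump (of_real x + of_int j - of_real (\<beta> * of_int n)) * inverse (ex p (of_real x + of_int j))
      = (\<Sum>k\<in>K. a k * (ex k (of_real x + of_int j) * inverse (ex p (of_real x + of_int j)))
          * inverse (ex k (of_real (\<beta> * of_int n))))" for x
      unfolding jump_def sum_distrib_right diff_conv_add_uminus[of _ "of_real (\<beta> * of_int n)"] ex_add ex_minus
      by (intro sum.cong) (simp_all add: mult_ac)
    have "((\<lambda>x. \<Sum>k\<in>K. a k * (ex k (of_real x + of_int j) * inverse (ex p (of_real x + of_int j)))
          * inverse (ex k (of_real (\<beta> * of_int n)))) \<longlongrightarrow>
        (\<Sum>k\<in>K. a k * (if k = p then 1 else 0) * inverse (ex k (of_real (\<beta> * of_int n))))) at_top"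
      using p by (intro tendsto_intros ex_quotient_tendsto) auto
    moreover have "(\<Sum>k\<in>K. a k * (if k = p then 1 else 0) * inverse (ex k (of_real (\<beta> * of_int n))))
        = (\<Sum>k\<in>K. if k = p then a p * inverse (ex p (of_real (\<beta> * of_int n))) else 0)"
      by (intro sum.cong) auto
    ultimately have lim: "((\<lambda>x. jump (of_real x + of_int j - of_real (\<beta> * of_int n)) * inverse (ex p (of_real x + of_int j)))
        \<longlongrightarrow> a p * inverse (ex p (of_real (\<beta> * of_int n)))) at_top"
      unfolding eq using K p(1) by simp
    show ?thesis
    proof (cases "\<beta> * of_int n < \<xi>\<^sub>0 + of_int j")
      case True
      then show ?thesis unfolding M_def Lm_def Inr sum.case using lim by (simp only: if_True)
    qed (simp add: M_def Lm_def Inr)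
  qed (auto simp: M_def Lm_def)
  \<comment> \<open>Row differences over S remove H and kill all coordinates \<open>Inl k\<close>
    with k different from p. A row beyond the right end has H = 0 and kills \<open>Inl p\<close>.
    Then H vanishes on R, and its increments are the coordinates \<open>Inr j\<close>.\<close>
  have M_inj: "v j = 0" if v: "\<And>n. n \<in> R \<Longrightarrow> (\<Sum>j\<in>JJ. Lm n j * v j) = 0" and j: "j \<in> JJ" for v j
  proof -
    define H where "H n = (\<Sum>j\<in>{- int L..int L}. if \<beta> * of_int n < \<xi>\<^sub>0 + of_int j then v (Inr j) else 0)" for n :: int
    have eq: "(\<Sum>k\<in>K. v (Inl k) * (inverse (ex k (of_real (\<beta> * of_int n))) * ex p (of_real (\<beta> * of_int n)))) + a p * H n = 0"
      if "n \<in> R" for n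
    proof -
      have "0 = ex p (of_real (\<beta> * of_int n)) * (\<Sum>j\<in>JJ. Lm n j * v j)" using v[OF that] by simp
      also have "\<dots> = (\<Sum>k\<in>K. v (Inl k) * (inverse (ex k (of_real (\<beta> * of_int n))) * ex p (of_real (\<beta> * of_int n)))) + a p * H n"
        unfolding sum_JJ distrib_left sum_distrib_left H_def
        by (intro arg_cong2[where f = plus] sum.cong) (simp_all add: Lm_def)
      finally show ?thesis by simp
    qed
    have split: "(\<Sum>k\<in>K. f k) = f p + (\<Sum>k\<in>K'. f k)" for f :: "nat \<Rightarrow> complex"
      unfolding K'_def by (rule sum.remove[OF K(1) p(1)])
    have "v (Inl k) * (z k - 1) = 0" if "k \<in> K'" for k
    proof (rule indep[OF _ that])
      fix n assume n: "n \<in> T'"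
      have nS: "\<beta> * n < \<xi>\<^sub>0 + of_int j \<longleftrightarrow> \<beta> * (n + 1) < \<xi>\<^sub>0 + of_int j" for j
        using subsetD[OF T'(1) n] unfolding S_def by (simp add: add.commute)
      have "H (int n) = H (int n + 1)"
        unfolding H_def using nS by (intro sum.cong) (auto simp: add.commute)
      moreover have "(\<Sum>k\<in>K. v (Inl k) * z k ^ n) + a p * H (int n) = 0"
        using eq[OF T'_R(1)[OF n]] by (simp add: z_pow)
      moreover have "(\<Sum>k\<in>K. v (Inl k) * z k ^ Suc n) + a p * H (int n + 1) = 0"
        using eq[OF T'_R(2)[OF n]] unfolding z_pow by (simp add: add.commute)
      ultimately have "(\<Sum>k\<in>K. v (Inl k) * z k ^ Suc n) - (\<Sum>k\<in>K. v (Inl k) * z k ^ n) = 0"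
        by (simp add: eq_neg_iff_add_eq_0[symmetric])
      then have "(\<Sum>k\<in>K. v (Inl k) * (z k - 1) * z k ^ n) = 0"
        unfolding sum_subtractf[symmetric] by (simp add: algebra_simps)
      \<comment> \<open>The term of p drops out because z p = 1.\<close>
      then show "(\<Sum>k\<in>K'. v (Inl k) * (z k - 1) * z k ^ n) = 0"
        unfolding split by (simp add: z_def)
    qed
    moreover have "z k \<noteq> 1" if "k \<in> K'" for k using z_gt[OF that] by auto
    ultimately have vK': "v (Inl k) = 0" if "k \<in> K'" for k using that by auto
    have H: "v (Inl p) + a p * H n = 0" if "n \<in> R" for n
      using eq[OF that] vK' unfolding split by simp
    obtain nt :: int where nt: "\<xi>\<^sub>0 + L < \<beta> * nt" "\<beta> * nt < \<xi>\<^sub>0 + L + 1"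
      using exists_multiple_between[OF \<beta> \<beta>1, of "\<xi>\<^sub>0 + L"] by auto
    have "nt \<in> R" using nt L\<xi> by (auto simp: R_def)
    moreover have "H nt = 0" unfolding H_def
    proof (intro sum.neutral ballI)
      fix j assume "j \<in> {- int L..int L}"
      then have "of_int j \<le> real L" by (metis atLeastAtMost_iff of_int_le_iff of_int_of_nat_eq)
      then show "(if \<beta> * of_int nt < \<xi>\<^sub>0 + of_int j then v (Inr j) else 0) = 0" using nt by auto
    qed
    ultimately have vp: "v (Inl p) = 0" using H[of nt] by simp
    then have H0: "H n = 0" if "n \<in> R" for n using H[OF that] a[OF p(1)] by simp
    have "v (Inr j) = 0" if j: "j \<in> {- int L..int L}" for j
    proof -
      have jL: "- real L \<le> of_int j" "of_int j \<le> real L" using j by (simp_all add: minus_le_iff)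
      \<comment> \<open>The multiples \<beta> n1 and \<beta> n2 enclose the single fibre point with
        index j, so H n1 - H n2 is exactly its coordinate.\<close>
      obtain n1 :: int where n1: "\<xi>\<^sub>0 + of_int j - 1 < \<beta> * n1" "\<beta> * n1 < \<xi>\<^sub>0 + of_int j"
        using exists_multiple_between[OF \<beta> \<beta>1, of "\<xi>\<^sub>0 + of_int j - 1"] by auto
      obtain n2 :: int where n2: "\<xi>\<^sub>0 + of_int j < \<beta> * n2" "\<beta> * n2 < \<xi>\<^sub>0 + of_int j + 1"
        using exists_multiple_between[OF \<beta> \<beta>1, of "\<xi>\<^sub>0 + of_int j"] by auto
      have "n1 \<in> R" "n2 \<in> R" using n1 n2 jL by (auto simp: R_def)
      then have "0 = H n1 - H n2" using H0 by simp
      also have "\<dots> = (\<Sum>i\<in>{- int L..int L}. if i = j then v (Inr j) else 0)"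
        unfolding H_def sum_subtractf[symmetric]
      proof (intro sum.cong refl)
        fix i :: int
        consider "i = j" | "i \<le> j - 1" | "j + 1 \<le> i" by linarith
        then show "(if \<beta> * of_int n1 < \<xi>\<^sub>0 + of_int i then v (Inr i) else 0)
            - (if \<beta> * of_int n2 < \<xi>\<^sub>0 + of_int i then v (Inr i) else 0) = (if i = j then v (Inr j) else 0)"
        proof cases
          case 1
          then show ?thesis using n1 n2 by auto
        next
          case 2
          then have "real_of_int i \<le> real_of_int j - 1" by linarith
          then show ?thesis using 2 n1 n2 by auto
        next
          case 3
          then have "real_of_int j + 1 \<le> real_of_int i" by linarith
          then show ?thesis using 3 n1 n2 by auto
        qed
      qed
      also have "\<dots> = v (Inr j)" using j by (subst sum.delta) auto
      finally show ?thesis by simp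
    qed
    then show "v j = 0" using j vp vK' by (auto simp: JJ_def K'_def)
  qed
  have "\<exists>T c D l. finite T \<and> T \<subseteq> R \<and> (\<forall>n. c n holomorphic_on UNIV) \<and> D holomorphic_on UNIV \<and>
    l \<noteq> 0 \<and> ((\<lambda>x. D (of_real x)) \<longlongrightarrow> l) at_top \<and>
    (\<forall>j\<in>insert (Inr j0) (JJ - {Inr j0}). \<forall>z. (\<Sum>n\<in>T. c n z * M n j z) = (if j = Inr j0 then D z else 0))"
  proof (rule entire_left_inverse[where L = Lm])
    show "v j = 0" if "\<And>n. n \<in> R \<Longrightarrow> (\<Sum>j\<in>insert (Inr j0) (JJ - {Inr j0}). Lm n j * v j) = 0"
      "j \<in> insert (Inr j0) (JJ - {Inr j0})" for v j
      using that unfolding JJ(1) by (rule M_inj)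
  qed (use JJ(2) M_hol M_lim in auto)
  then obtain T c D l where T: "finite T" "T \<subseteq> R" and D: "D holomorphic_on UNIV" "l \<noteq> 0"
    "((\<lambda>x. D (of_real x)) \<longlongrightarrow> l) at_top"
    and inv_all: "\<forall>j\<in>JJ. \<forall>z. (\<Sum>n\<in>T. c n z * M n j z) = (if j = Inr j0 then D z else 0)"
    unfolding JJ(1) by (elim exE conjE)
  note inv = inv_all[rule_format]
  have "\<forall>\<^sub>F x in at_top. D (of_real x) \<noteq> 0" using D by (intro tendsto_imp_eventually_ne) auto
  then have "\<exists>x::real. D (of_real x) \<noteq> 0" by (rule eventually_happens'[rotated]) simp
  then obtain x0 :: real where "D (of_real x0) \<noteq> 0" ..
  then have "countable {s. D s = 0}" by (rule entire_countable_zeros[OF D(1)])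
  then have C: "countable {x::real. D (of_real x) = 0}"
    using countable_image_inj[of "{s. D s = 0}" "of_real :: real \<Rightarrow> complex"] by (simp add: inj_of_real)
  have "\<xi>\<^sub>0 - \<beta> * of_int n + real_of_int j \<noteq> 0" for n j using ne[of j n] by linarith
  then obtain d where d: "0 < d" "\<And>n j. n \<in> R \<Longrightarrow> d \<le> \<bar>\<xi>\<^sub>0 - \<beta> * of_int n + real_of_int j\<bar>"
    using finite_non_integer_distance[OF finR, of "\<lambda>n. \<xi>\<^sub>0 - \<beta> * of_int n"] by blast
  show ?thesis
  proof (intro exI[of _ d] exI[of _ "{x::real. D (of_real x) = 0}"] conjI allI impI)
    fix \<xi> assume \<xi>: "\<bar>\<xi> - \<xi>\<^sub>0\<bar> < d" "\<xi> \<notin> {x::real. D (of_real x) = 0}"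
    have pat: "\<beta> * of_int n < \<xi> + of_int j \<longleftrightarrow> \<beta> * of_int n < \<xi>\<^sub>0 + of_int j" and ne': "\<xi> + of_int j \<noteq> \<beta> * of_int n"
      if "n \<in> T" for n j using d(2)[of n j] that T(2) \<xi>(1) by (auto simp: abs_if split: if_splits)
    \<comment> \<open>Undoes the division by the dominant exponential in column j0 and the factor -2
      pi \<i> of \<open>fib_eq\<close>, making the entry at j0 equal to 1.\<close>
    define h where "h = - 2 * of_real pi * \<i> * D (of_real \<xi>) * ex p (of_real \<xi> + of_int j0)"
    have h: "h \<noteq> 0" using \<xi>(2) by (simp add: h_def)
    define c' where "c' n = c n (of_real \<xi>) / h" for n
    have "(\<Sum>n\<in>T. c n (of_real \<xi>) * ex k (- of_real (\<beta> * n))) = 0" if "k \<in> K" for k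
      using inv[of "Inl k" "of_real \<xi>"] that by (simp add: JJ_def M_def ex_minus)
    then have ann: "annihilating T c'"
      unfolding annihilating_def c'_def by (simp add: sum_divide_distrib[symmetric])
    have "fib T c' \<xi> j = (if j = j0 then 1 else 0)" for j
    proof (cases "j \<in> {- int L..int L}")
      case True
      have "(\<Sum>n\<in>T. c n (of_real \<xi>) * M n (Inr j) (of_real \<xi>)) = (if j = j0 then D (of_real \<xi>) else 0)"
        using inv[of "Inr j" "of_real \<xi>"] True by (simp add: JJ_def)
      moreover have "(\<Sum>n\<in>T. c n (of_real \<xi>) * M n (Inr j) (of_real \<xi>))
        = (\<Sum>n\<in>{n\<in>T. \<beta> * n < \<xi> + j}. c' n * jump (of_real (\<xi> + j - \<beta> * n))) * (h * inverse (ex p (of_real \<xi> + of_int j)))"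
        unfolding sum_distrib_right sum.inter_filter[OF T(1)] using h
        by (intro sum.cong refl) (simp add: M_def pat c'_def)
      ultimately have 1: "(\<Sum>n\<in>{n\<in>T. \<beta> * n < \<xi> + j}. c' n * jump (of_real (\<xi> + j - \<beta> * n))) * (h * inverse (ex p (of_real \<xi> + of_int j)))
          = (if j = j0 then D (of_real \<xi>) else 0)" by simp
      have "fib T c' \<xi> j = - 2 * of_real pi * \<i> * (\<Sum>n\<in>{n\<in>T. \<beta> * n < \<xi> + j}. c' n * jump (of_real (\<xi> + j - \<beta> * n)))"
        using ne' by (intro fib_eq ann T) auto
      also have "\<dots> = - 2 * of_real pi * \<i> * ((if j = j0 then D (of_real \<xi>) else 0) * ex p (of_real \<xi> + of_int j) / h)"
        unfolding 1[symmetric] using h by simp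
      also have "\<dots> = (if j = j0 then 1 else 0)" using h by (auto simp: h_def)
      finally show ?thesis .
    next
      case False
      \<comment> \<open>An index outside the window is off by at least one whole unit, which is
        beyond all multiples indexed by R.\<close>
      have "(\<forall>n\<in>T. \<xi> + j < \<beta> * n) \<or> (\<forall>n\<in>T. \<beta> * n < \<xi> + j)"
      proof (cases "0 < j")
        case True
        then have "real L + 1 \<le> of_int j" using False by auto
        then have "\<beta> * n < \<xi>\<^sub>0 + j" if "n \<in> T" for n using that T(2) by (auto simp: R_def)
        then show ?thesis using pat by auto
      next
        case neg: False
        then have "of_int j \<le> - real L - 1" using False by auto
        then have "\<not> \<beta> * n < \<xi>\<^sub>0 + j" if "n \<in> T" for n using that T(2) by (auto simp: R_def)
        then have "\<xi> + j < \<beta> * n" if "n \<in> T" for n using pat[OF that] ne'[OF that, of j] that by fastforce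
        then show ?thesis by auto
      qed
      then show ?thesis using False Lj0 fib_outside[OF ann T(1)] by auto
    qed
    then show "\<exists>T c. finite T \<and> annihilating T c \<and> (\<forall>n\<in>T. \<forall>j::int. \<xi> + j \<noteq> \<beta> * n) \<and>
        (\<forall>j. fib T c \<xi> j = (if j = j0 then 1 else 0))"
      using ann T(1) ne' by (intro exI[of _ T] exI[of _ c'] conjI) auto
  qed (use d C in auto)
qed

lemma good_AE_less:
  assumes "\<beta> < 1" "0 < e" shows "AE \<xi> in lborel. good j0 e \<xi>"
proof -
  define X where "X = {\<xi>::real. \<forall>(n::int) (j::int). \<xi> + j \<noteq> \<beta> * n}"
  have "countable (X \<inter> {\<xi>. \<not> good j0 e \<xi>})"
  proof (rule countable_of_locally_countable)
    fix x assume "x \<in> X"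
    then obtain d C where d: "0 < d" "countable C" and
      *: "\<And>\<xi>. \<bar>\<xi> - x\<bar> < d \<Longrightarrow> \<xi> \<notin> C \<Longrightarrow>
        \<exists>T c. finite T \<and> annihilating T c \<and> (\<forall>n\<in>T. \<forall>j::int. \<xi> + j \<noteq> \<beta> * n) \<and>
          (\<forall>j. fib T c \<xi> j = (if j = j0 then 1 else 0))"
      using local_exact[OF assms(1), of x j0] unfolding X_def by blast
    have "good j0 e \<xi>" if "\<xi> \<in> ball x d" "\<xi> \<notin> C" for \<xi>
    proof -
      have "\<bar>\<xi> - x\<bar> < d" using that by (simp add: dist_real_def)
      from *[OF this that(2)] obtain T c where T: "finite T" "annihilating T c"
        "\<forall>n\<in>T. \<forall>j::int. \<xi> + j \<noteq> \<beta> * n" "\<And>j. fib T c \<xi> j = (if j = j0 then 1 else 0)" by blast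
      have "err T c j0 \<xi> = 0" unfolding err_def T(4) by simp
      then show ?thesis unfolding good_def using T assms(2) by (metis ennreal_less_zero_iff)
    qed
    then have "ball x d \<inter> {\<xi>. \<not> good j0 e \<xi>} \<subseteq> C" by blast
    then show "\<exists>U. open U \<and> x \<in> U \<and> countable (U \<inter> {\<xi>. \<not> good j0 e \<xi>})"
      using d countable_subset by (intro exI[of _ "ball x d"]) auto
  qed
  moreover have "- X \<subseteq> (\<lambda>(n, j). \<beta> * of_int n - of_int j) ` (UNIV :: (int \<times> int) set)"
  proof
    fix x assume "x \<in> - X"
    then obtain n j :: int where "x + of_int j = \<beta> * of_int n" by (auto simp: X_def)
    then have "x = (\<lambda>(n, j). \<beta> * of_int n - of_int j) (n, j)" by simp
    then show "x \<in> (\<lambda>(n, j). \<beta> * of_int n - of_int j) ` (UNIV :: (int \<times> int) set)" by blast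
  qed
  then have "countable (- X)" by (rule countable_subset) simp
  ultimately have "countable (- X \<union> (X \<inter> {\<xi>. \<not> good j0 e \<xi>}))" by auto
  then have "- X \<union> (X \<inter> {\<xi>. \<not> good j0 e \<xi>}) \<in> null_sets lborel" by (rule countable_imp_null_set_lborel)
  then show ?thesis by (rule AE_I') auto
qed

end

section \<open>The critical density \<beta> = 1\<close>

text \<open>The left side is the coefficient of x^i in F(x) / (1 - u x) for F = (x - q) p. As u q =
  1, x - q = -q (1 - u x), so this power series is just -q p.\<close>

lemma partial_sum_root:
  fixes q u :: complex
  assumes "u * q = 1"
  shows "(\<Sum>n\<le>i. coeff ([:- q, 1:] * p) n * u ^ (i - n)) = - q * coeff p i"
proof (induction i)
  case (Suc i)
  have "(\<Sum>n\<le>Suc i. coeff ([:- q, 1:] * p) n * u ^ (Suc i - n))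
      = u * (\<Sum>n\<le>i. coeff ([:- q, 1:] * p) n * u ^ (i - n)) + coeff ([:- q, 1:] * p) (Suc i)"
    by (simp add: sum_distrib_left Suc_diff_le mult_ac)
  also have "\<dots> = - (u * q) * coeff p i + (coeff p i - q * coeff p (Suc i))"
    unfolding Suc.IH by simp
  finally show ?case using assms by simp
qed simp

context cauchy_sum
begin

text \<open>In terms of generating polynomials, annihilation means that F vanishes at every
  \<open>q k\<close>, so F is a multiple Y of the product of all x - q l. The fibre then has
  generating polynomial P Y, up to an index shift, with P independent of Y; Y is chosen to bring P Y
  close to a monomial.\<close>

lemma good_one:
  assumes \<beta>1: "\<beta> = 1" and \<xi>: "0 < \<xi>" "\<xi> < 1" and e: "0 < e"
  shows "good j0 e \<xi>"
proof -
  define q where "q k = ex k (- 1)" for k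
  have q_nonzero: "q k \<noteq> 0" for k by (simp add: q_def)
  have uq: "ex k 1 * q k = 1" for k by (simp add: q_def ex_add[symmetric])
  have q_inj: "q k \<noteq> q l" if "k \<in> K" "l \<in> K" "k \<noteq> l" for k l
  proof
    assume "q k = q l"
    then have "norm (ex k (of_real (- 1))) = norm (ex l (of_real (- 1)))" by (simp add: q_def)
    then have "Re (w k) = Re (w l)" unfolding norm_ex by simp
    then show False using inj that by (auto dest: inj_onD)
  qed
  define Q where "Q k = (\<Prod>l\<in>K - {k}. [:- q l, 1:])" for k
  define P where "P = (\<Sum>k\<in>K. smult (2 * of_real pi * \<i> * a k * ex k (of_real \<xi>) * q k) (Q k))"
  obtain p where p: "p \<in> K" using K by auto
  \<comment> \<open>As in Lagrange interpolation, only the summand of p survives at q p, and it is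
    nonzero because the nodes are distinct.\<close>
  have "poly P (q p) \<noteq> 0"
  proof -
    have "poly (Q k) (q p) = 0" if "k \<in> K" "k \<noteq> p" for k
      unfolding Q_def poly_prod using that p K by (intro prod_zero bexI[of _ p]) auto
    then have "poly P (q p) = (\<Sum>k\<in>K. if k = p then 2 * of_real pi * \<i> * a p * ex p (of_real \<xi>) * q p * poly (Q p) (q p) else 0)"
      unfolding P_def poly_sum by (intro sum.cong) auto
    also have "\<dots> = 2 * of_real pi * \<i> * a p * ex p (of_real \<xi>) * q p * poly (Q p) (q p)"
      using K p by simp
    moreover have "poly (Q p) (q p) \<noteq> 0"
      unfolding Q_def poly_prod using K q_inj p by (subst prod_zero_iff) auto
    ultimately show ?thesis using a[OF p] q_nonzero by simp
  qed
  then have "P \<noteq> 0" by auto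
  then obtain Y m where Y: "l2_coeffs (P * Y - monom 1 m) < sqrt e"
    using poly_approx_monom[of P "sqrt e"] e by auto
  define F where "F = (\<Prod>l\<in>K. [:- q l, 1:]) * Y"
  have F: "F = [:- q k, 1:] * (Q k * Y)" if "k \<in> K" for k
    unfolding F_def Q_def prod.remove[OF K(1) that] by (simp only: mult.assoc)
  \<comment> \<open>Index s + i carries coefficient i, so the approximated monomial x^m lands at
    position j0.\<close>
  define s where "s = j0 - int m"
  define T where "T = {s..s + int (degree F)}"
  define c where "c n = coeff F (nat (n - s))" for n
  have T_eq: "T = (\<lambda>i. s + int i) ` {..degree F}"
    unfolding T_def by (auto simp: image_iff intro!: bexI[of _ "nat (x - s)" for x])
  have sum_T: "(\<Sum>n\<in>T. f n) = (\<Sum>i\<le>degree F. f (s + int i))" for f :: "int \<Rightarrow> complex"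
    unfolding T_eq by (subst sum.reindex) (auto simp: inj_on_def)
  have finT: "finite T" by (simp add: T_def)
  have q_pow: "ex k (- of_nat i) = q k ^ i" for k i
    unfolding q_def ex_def by (simp add: exp_of_nat_mult[symmetric] mult_ac)
  have u_pow: "ex k (of_nat i) = ex k 1 ^ i" for k i
    unfolding ex_def by (simp add: exp_of_nat_mult[symmetric] mult_ac)
  have ann: "annihilating T c"
    unfolding annihilating_def
  proof
    fix k assume k: "k \<in> K"
    have "(\<Sum>n\<in>T. c n * ex k (- of_real (\<beta> * n))) = ex k (- of_int s) * (\<Sum>i\<le>degree F. coeff F i * q k ^ i)"
      unfolding sum_T sum_distrib_left c_def \<beta>1
      by (intro sum.cong refl) (simp add: q_pow[symmetric] ex_add[symmetric] mult.left_commute)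
    also have "(\<Sum>i\<le>degree F. coeff F i * q k ^ i) = 0"
      using F[OF k] by (subst poly_altdef[symmetric]) simp
    finally show "(\<Sum>n\<in>T. c n * ex k (- of_real (\<beta> * n))) = 0" by simp
  qed
  have no_tie: "\<xi> + real_of_int j \<noteq> \<beta> * n" for n j :: int
  proof
    assume "\<xi> + real_of_int j = \<beta> * n"
    then have "\<xi> = real_of_int (n - j)" by (simp add: \<beta>1)
    then have "0 < n - j" "n - j < 1" using \<xi> by (metis of_int_0_less_iff, metis of_int_less_1_iff)
    then show False by simp
  qed
  have less: "\<beta> * of_int n < \<xi> + of_int j \<longleftrightarrow> n \<le> j" for n j :: int
  proof
    assume "\<beta> * of_int n < \<xi> + of_int j"
    then have "real_of_int n < real_of_int (j + 1)" using \<xi> by (simp add: \<beta>1)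
    then show "n \<le> j" by linarith
  next
    assume "n \<le> j"
    then have "real_of_int n \<le> real_of_int j" by simp
    then show "\<beta> * of_int n < \<xi> + of_int j" using \<xi> by (simp add: \<beta>1)
  qed
  have fib_neg: "fib T c \<xi> j = 0" if "j < s" for j
  proof (rule fib_outside[OF ann finT], rule disjI1, rule ballI)
    fix n assume "n \<in> T"
    then have "\<not> n \<le> j" using that by (simp add: T_def)
    then show "\<xi> + real_of_int j < \<beta> * real_of_int n" using less[of n j] no_tie[of j n] by linarith
  qed
  have fib_nonneg: "fib T c \<xi> (s + int i) = coeff (P * Y) i" for i
  proof -
    have "fib T c \<xi> (s + int i) = - 2 * of_real pi * \<i> *
        (\<Sum>n\<in>{n\<in>T. \<beta> * n < \<xi> + of_int (s + int i)}. c n * jump (of_real (\<xi> + of_int (s + int i) - \<beta> * n)))"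
      by (intro fib_eq ann finT no_tie)
    also have "(\<Sum>n\<in>{n\<in>T. \<beta> * n < \<xi> + of_int (s + int i)}. c n * jump (of_real (\<xi> + of_int (s + int i) - \<beta> * n)))
        = (\<Sum>n\<le>i. coeff F n * jump (of_real (\<xi> + of_nat (i - n))))"
    proof -
      have "(\<Sum>n\<in>{n\<in>T. \<beta> * n < \<xi> + of_int (s + int i)}. c n * jump (of_real (\<xi> + of_int (s + int i) - \<beta> * n)))
        = (\<Sum>n\<le>degree F. if n \<le> i then coeff F n * jump (of_real (\<xi> + of_int (s + int i) - \<beta> * of_int (s + int n))) else 0)"
        unfolding sum.inter_filter[OF finT] sum_T less by (intro sum.cong refl) (simp add: c_def)
      also have "\<dots> = (\<Sum>n\<in>{n\<in>{..degree F}. n \<le> i}. coeff F n * jump (of_real (\<xi> + of_int (s + int i) - \<beta> * of_int (s + int n))))"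
        by (rule sum.inter_filter[symmetric]) simp
      also have "\<dots> = (\<Sum>n\<le>i. coeff F n * jump (of_real (\<xi> + of_nat (i - n))))"
        by (rule sum.mono_neutral_cong_left) (auto simp: \<beta>1 of_nat_diff algebra_simps intro: le_degree)
      finally show ?thesis .
    qed
    also have "\<dots> = (\<Sum>k\<in>K. a k * ex k (of_real \<xi>) * (\<Sum>n\<le>i. coeff F n * ex k 1 ^ (i - n)))"
      unfolding jump_def sum_distrib_left
      by (subst sum.swap) (simp add: u_pow[symmetric] ex_add mult_ac)
    also have "\<dots> = (\<Sum>k\<in>K. a k * ex k (of_real \<xi>) * (- q k * coeff (Q k * Y) i))"
    proof (intro sum.cong refl arg_cong2[where f = times])
      fix k assume "k \<in> K"
      then show "(\<Sum>n\<le>i. coeff F n * ex k 1 ^ (i - n)) = - q k * coeff (Q k * Y) i"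
        using partial_sum_root[OF uq[of k], of "Q k * Y" i] F[of k] by simp
    qed
    also have "- 2 * of_real pi * \<i> * \<dots> = (\<Sum>k\<in>K. 2 * of_real pi * \<i> * a k * ex k (of_real \<xi>) * q k * coeff (Q k * Y) i)"
      unfolding sum_distrib_left by (intro sum.cong) auto
    also have "\<dots> = coeff (P * Y) i"
      unfolding P_def sum_distrib_right coeff_sum mult_smult_left coeff_smult ..
    finally show ?thesis .
  qed
  define r where "r = P * Y - monom 1 m"
  define n where "n = max (degree r) (max (degree (P * Y)) m)"
  define J where "J = (\<lambda>i. s + int i) ` {..n}"
  have "j0 \<in> J" unfolding J_def by (intro image_eqI[of _ _ m]) (auto simp: s_def n_def)
  moreover have "fib T c \<xi> j = 0" if "j \<notin> J" for j
  proof (cases "j < s")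
    case False
    define i where "i = nat (j - s)"
    have j: "j = s + int i" using False by (simp add: i_def)
    then have "n < i" using that unfolding J_def by (metis atMost_iff imageI leI)
    then show ?thesis unfolding j fib_nonneg by (intro coeff_eq_0) (simp add: n_def)
  qed (rule fib_neg)
  ultimately have "err T c j0 \<xi> = ennreal (\<Sum>j\<in>J. (norm (fib T c \<xi> j - (if j = j0 then 1 else 0)))\<^sup>2)"
    by (intro err_eq) (auto simp: J_def)
  also have "(\<Sum>j\<in>J. (norm (fib T c \<xi> j - (if j = j0 then 1 else 0)))\<^sup>2) = (\<Sum>i\<le>n. (norm (coeff r i))\<^sup>2)"
  proof -
    have "s + int i = j0 \<longleftrightarrow> m = i" for i by (auto simp: s_def)
    then show ?thesis
      unfolding J_def
      by (subst sum.reindex) (auto simp: inj_on_def fib_nonneg r_def intro!: sum.cong)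
  qed
  also have "\<dots> = (l2_coeffs r)\<^sup>2"
    by (subst l2_coeffs_eq[of r n]) (simp_all add: n_def L2_set_def sum_nonneg)
  also have "ennreal ((l2_coeffs r)\<^sup>2) < ennreal e"
  proof -
    have "(l2_coeffs r)\<^sup>2 < (sqrt e)\<^sup>2"
      using Y unfolding r_def by (intro power_strict_mono) (auto simp: l2_coeffs_def)
    then show ?thesis using e by (simp add: ennreal_less_iff)
  qed
  finally show ?thesis unfolding good_def using ann finT no_tie by blast
qed

lemma good_AE:
  assumes "\<beta> \<le> 1" "0 < e"
  shows "AE \<xi> in lborel. 0 < \<xi> \<longrightarrow> \<xi> < 1 \<longrightarrow> good j0 e \<xi>"
proof (cases "\<beta> = 1")
  case True
  then show ?thesis using good_one assms(2) by simp
next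
  case False
  then show ?thesis using good_AE_less[of e j0] assms by auto
qed

end

subsection \<open>Completeness at density at least one\<close>

lemma fourier_measurable:
  assumes "tame k" shows "fourier k \<in> borel_measurable borel"
proof -
  have [measurable]: "k \<in> borel_measurable borel" using assms by (simp add: tame_def)
  have [measurable]: "cis \<in> borel_measurable borel"
    by (intro borel_measurable_continuous_onI) (auto simp: cis_conv_exp intro!: continuous_intros)
  show ?thesis unfolding fourier_def[abs_def] by measurable
qed

lemma square_integrable_fourier: "tame k \<Longrightarrow> square_integrable (fourier k)"
  using tame_square_integrable[of k] fourier_measurable[of k]
  by (simp add: square_integrable_iff plancherel)

lemma tame_diff: "tame f \<Longrightarrow> tame g \<Longrightarrow> tame (\<lambda>x. f x - g x)"
  using tame_add[of f "\<lambda>x. - 1 * g x"] tame_cmult[of g "- 1"] by simp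

text \<open>Every approximation error is the transform of a tame function, so Plancherel's identity
  transfers it without a transform on all square integrable functions.\<close>

lemma fourier_span_closure_iff:
  assumes k: "tame k" and \<Psi>: "\<And>i. tame (\<Psi> i)"
  shows "fourier k \<in> span_closure (\<lambda>i. fourier (\<Psi> i)) \<longleftrightarrow> k \<in> span_closure \<Psi>"
proof -
  have "energy (\<lambda>x. fourier k x - (\<Sum>i\<in>S. c i * fourier (\<Psi> i) x)) = energy (\<lambda>x. k x - (\<Sum>i\<in>S. c i * \<Psi> i x))"
    for S and c :: "'a \<Rightarrow> complex"
  proof -
    have comb: "tame (\<lambda>x. \<Sum>i\<in>S. c i * \<Psi> i x)" by (intro tame_sum tame_cmult \<Psi>)
    have "(\<lambda>x. fourier k x - (\<Sum>i\<in>S. c i * fourier (\<Psi> i) x)) = fourier (\<lambda>x. k x - (\<Sum>i\<in>S. c i * \<Psi> i x))"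
      by (intro ext) (simp add: fourier_diff[OF k comb] fourier_sum[OF \<Psi>])
    then show ?thesis by (simp only: plancherel[OF tame_diff[OF k comb]])
  qed
  then show ?thesis
    unfolding span_closure_def
    by (simp add: square_integrable_fourier[OF k] tame_square_integrable[OF k])
qed

lemma tame_modulated: "tame k \<Longrightarrow> tame (\<lambda>x. cis (2 * pi * b * x) * k x)"
  by (rule tame_mult[where C = 1]) (auto simp: cis_conv_exp)

section \<open>Periodisation and periodic cells\<close>

lemma nn_integral_periodize:
  fixes u :: "real \<Rightarrow> ennreal"
  assumes [measurable]: "u \<in> borel_measurable borel"
  shows "(\<integral>\<^sup>+ x. u x \<partial>lborel)
    = (\<integral>\<^sup>+ \<xi>. indicator {0..<1} \<xi> * (\<integral>\<^sup>+ j. u (\<xi> + real_of_int j) \<partial>count_space UNIV) \<partial>lborel)"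
proof -
  have "u x = (\<integral>\<^sup>+ j. u x * indicator {real_of_int j..<real_of_int j + 1} x \<partial>count_space UNIV)" for x
  proof -
    have "(\<integral>\<^sup>+ j. u x * indicator {real_of_int j..<real_of_int j + 1} x \<partial>count_space UNIV)
        = (\<Sum>j\<in>{\<lfloor>x\<rfloor>}. u x * indicator {real_of_int j..<real_of_int j + 1} x)"
      by (rule nn_integral_count_space') (auto simp: indicator_def floor_unique)
    also have "\<dots> = u x" by (simp add: indicator_def)
    finally show ?thesis by simp
  qed
  then have "(\<integral>\<^sup>+ x. u x \<partial>lborel)
      = (\<integral>\<^sup>+ x. (\<integral>\<^sup>+ j. u x * indicator {real_of_int j..<real_of_int j + 1} x \<partial>count_space UNIV) \<partial>lborel)"
    by simp
  also have "\<dots> = (\<integral>\<^sup>+ j. (\<integral>\<^sup>+ x. u x * indicator {real_of_int j..<real_of_int j + 1} x \<partial>lborel) \<partial>count_space UNIV)"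
    by (rule nn_integral_count_space_nn_integral) auto
  also have "\<dots> = (\<integral>\<^sup>+ j. (\<integral>\<^sup>+ \<xi>. indicator {0..<1} \<xi> * u (\<xi> + real_of_int j) \<partial>lborel) \<partial>count_space UNIV)"
  proof (rule nn_integral_cong)
    fix j :: int
    have "(\<integral>\<^sup>+ x. u x * indicator {real_of_int j..<real_of_int j + 1} x \<partial>lborel)
        = (\<integral>\<^sup>+ \<xi>. u (real_of_int j + 1 * \<xi>) * indicator {real_of_int j..<real_of_int j + 1} (real_of_int j + 1 * \<xi>) \<partial>lborel)"
      by (subst nn_integral_real_affine[where c = 1 and t = "real_of_int j"]) auto
    also have "\<dots> = (\<integral>\<^sup>+ \<xi>. indicator {0..<1} \<xi> * u (\<xi> + real_of_int j) \<partial>lborel)"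
      by (intro nn_integral_cong) (auto simp: indicator_def add.commute)
    finally show "(\<integral>\<^sup>+ x. u x * indicator {real_of_int j..<real_of_int j + 1} x \<partial>lborel)
        = (\<integral>\<^sup>+ \<xi>. indicator {0..<1} \<xi> * u (\<xi> + real_of_int j) \<partial>lborel)" .
  qed
  also have "\<dots> = (\<integral>\<^sup>+ \<xi>. (\<integral>\<^sup>+ j. indicator {0..<1} \<xi> * u (\<xi> + real_of_int j) \<partial>count_space UNIV) \<partial>lborel)"
    by (rule nn_integral_count_space_nn_integral[symmetric]) auto
  finally show ?thesis by (simp add: nn_integral_cmult)
qed

text \<open>For r < n this is the open interval from r/n to (r + 1)/n made 1-periodic: centre (r +
  1/2)/n, half-width 1/(2n). Written with a cosine, its indicator is a multiplier as soon as the
  modulations of frequency 1 and -1 are.\<close>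

definition cell :: "nat \<Rightarrow> nat \<Rightarrow> real set" where
  "cell n r = {x. cos (2 * pi * (x - (real r + 1 / 2) / n)) > cos (pi / n)}"

lemma cell_iff:
  assumes r: "r < n" and \<xi>: "0 < \<xi>" "\<xi> < 1"
  shows "\<xi> + real_of_int j \<in> cell n r \<longleftrightarrow> real r / n < \<xi> \<and> \<xi> < (real r + 1) / n"
proof -
  define y where "y = 2 * pi * (\<xi> - (real r + 1 / 2) / n)"
  have n: "0 < real n" using r by simp
  have bound: "1 / (2 * n) \<le> (real r + 1 / 2) / n" "(real r + 1 / 2) / n \<le> 1 - 1 / (2 * n)"
  proof -
    have "real r + 1 \<le> n" using r by linarith
    then have "(real r + 1) / n \<le> 1" using n by (simp add: divide_le_eq)
    moreover have "(real r + 1 / 2) / n = (real r + 1) / n - 1 / (2 * n)" using n by (simp add: field_simps)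
    ultimately show "(real r + 1 / 2) / n \<le> 1 - 1 / (2 * n)" by simp
    show "1 / (2 * n) \<le> (real r + 1 / 2) / n" using n by (simp add: field_simps)
  qed
  then have "\<bar>\<xi> - (real r + 1 / 2) / n\<bar> \<le> 1 - 1 / (2 * n)" using \<xi> by (simp add: abs_le_iff)
  then have "2 * pi * \<bar>\<xi> - (real r + 1 / 2) / n\<bar> \<le> 2 * pi * (1 - 1 / (2 * n))" by (intro mult_left_mono) auto
  moreover have "\<bar>y\<bar> = 2 * pi * \<bar>\<xi> - (real r + 1 / 2) / n\<bar>" by (simp add: y_def abs_mult)
  moreover have "2 * pi * (1 - 1 / (2 * n)) = 2 * pi - pi / n" by (simp add: right_diff_distrib)
  ultimately have y: "\<bar>y\<bar> \<le> 2 * pi - pi / n" by linarith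
  have "cos (2 * pi * (\<xi> + real_of_int j - (real r + 1 / 2) / n)) = cos (y + 2 * pi * of_int j)"
    by (simp add: y_def algebra_simps)
  also have "\<dots> = cos y" by (simp add: cos_add)
  finally have "\<xi> + real_of_int j \<in> cell n r \<longleftrightarrow> cos (pi / n) < cos y" by (simp add: cell_def)
  also have "\<dots> \<longleftrightarrow> \<bar>y\<bar> < pi / n"
  proof (cases "\<bar>y\<bar> \<le> pi")
    case True
    then show ?thesis using n by (intro cos_less_cos_iff) (auto simp: field_simps)
  next
    case False
    \<comment> \<open>Beyond pi the angle is reflected; the bound 2 pi - pi / n on |y| prevents it
      from re-entering the cell from the other side.\<close>
    have "cos y = cos (2 * pi - \<bar>y\<bar>)" by (simp add: cos_diff)
    also have "\<dots> \<le> cos (pi / n)" using y False n by (intro cos_monotone_0_pi_le) auto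
    finally have "\<not> cos (pi / n) < cos y" by simp
    moreover have "pi / n \<le> pi" using r by (simp add: field_simps)
    ultimately show ?thesis using False by auto
  qed
  also have "\<bar>y\<bar> = 2 * pi * \<bar>\<xi> - (real r + 1 / 2) / n\<bar>" by (simp add: y_def abs_mult)
  also have "2 * pi * \<bar>\<xi> - (real r + 1 / 2) / n\<bar> < pi / n \<longleftrightarrow> \<bar>\<xi> - (real r + 1 / 2) / n\<bar> < 1 / (2 * n)"
  proof -
    have "pi / n = 2 * pi * (1 / (2 * n))" by simp
    then show ?thesis using pi_gt_zero by (simp only: mult_less_cancel_left_pos)
  qed
  also have "\<dots> \<longleftrightarrow> real r / n < \<xi> \<and> \<xi> < (real r + 1) / n"
    by (auto simp: abs_less_iff add_divide_distrib)
  finally show ?thesis .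
qed

lemma cell_unique:
  fixes n :: nat
  assumes "real r / n < \<xi>" "\<xi> < (real r + 1) / n" "real s / n < \<xi>" "\<xi> < (real s + 1) / n"
  shows "r = s"
proof -
  have n: "0 < real n" using assms(1,2) by (cases "n = 0") auto
  have "real r < \<xi> * n" "\<xi> * n < real r + 1" "real s < \<xi> * n" "\<xi> * n < real s + 1"
    using assms n by (auto simp: field_simps)
  then show ?thesis by linarith
qed

lemma cell_exists:
  assumes "0 < n" "0 < \<xi>" "\<xi> < 1" "\<xi> \<notin> \<rat>"
  shows "\<exists>r<n. real r / n < \<xi> \<and> \<xi> < (real r + 1) / n"
proof -
  define r where "r = nat \<lfloor>\<xi> * n\<rfloor>"
  have r: "real r = of_int \<lfloor>\<xi> * n\<rfloor>" using assms by (simp add: r_def)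
  have "real r \<noteq> \<xi> * n"
  proof
    assume "real r = \<xi> * n"
    then have "\<xi> = of_nat r / of_nat n" using assms(1) by (simp add: field_simps)
    then show False using assms(4) by (metis Rats_divide Rats_of_nat)
  qed
  then have "real r < \<xi> * n" "\<xi> * n < real r + 1" using r by linarith+
  moreover have "\<xi> * n < n" using assms by simp
  then have "r < n" using \<open>real r < \<xi> * n\<close> by linarith
  ultimately show ?thesis using assms by (auto simp: field_simps)
qed

text \<open>All cell endpoints are rational, so discarding the rationals removes them for every n at
  once.\<close>

lemma AE_irrational: "AE x in lborel. x \<notin> (\<rat> :: real set)"
  by (rule AE_I'[OF countable_imp_null_set_lborel[OF countable_rat]]) auto

context cauchy_sum
begin

text \<open>The modulation is placed inside the shift so that the transform is
  \<open>gabor_atom\<close> with no extra phase.\<close>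

definition kap_atom :: "int \<times> int \<Rightarrow> real \<Rightarrow> complex" where
  "kap_atom = (\<lambda>(m, n) x. cis (2 * pi * - real_of_int m * (x - \<beta> * n)) * kap (x - \<beta> * n))"

definition V where "V = span_closure kap_atom"

lemma tame_kap_atom: "tame (kap_atom i)"
proof (cases i)
  case (Pair m n)
  have "tame (\<lambda>x. cis (2 * pi * - real_of_int m * (x - \<beta> * n)) * kap (x - \<beta> * n))"
    by (rule tame_shift[OF tame_modulated[OF tame_kap]])
  then show ?thesis by (simp only: kap_atom_def prod.case Pair)
qed

sublocale V: closed_subspace V
  unfolding V_def by (intro closed_subspace_span_closure tame_square_integrable tame_kap_atom)

lemma kap_atom_in_V: "kap_atom i \<in> V"
  unfolding V_def by (intro span_closure_base tame_square_integrable tame_kap_atom)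

text \<open>A modulation of integer frequency permutes the atoms up to constant phases.\<close>

lemma cis_multiplier_V:
  assumes "s = 1 \<or> s = - 1"
  shows "(\<lambda>x. cis (2 * pi * (real_of_int s * x))) \<in> V.multipliers"
proof (rule V.span_closure_multiplier[OF V_def, where B = 1])
  show "(\<lambda>x. cis (2 * pi * (real_of_int s * x))) \<in> borel_measurable borel"
    by (intro borel_measurable_continuous_onI) (auto simp: cis_conv_exp intro!: continuous_intros)
  show "(\<lambda>x. cis (2 * pi * (real_of_int s * x)) * kap_atom i x) \<in> V" for i
  proof (cases i)
    case (Pair m n)
    have "cis (2 * pi * (real_of_int s * x)) * kap_atom (m, n) x
        = cis (2 * pi * real_of_int s * \<beta> * n) * kap_atom (m - s, n) x" for x
      unfolding kap_atom_def by (simp add: cis_mult mult.assoc[symmetric]) (simp add: algebra_simps)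
    then show ?thesis
      unfolding Pair using V.cmult[OF kap_atom_in_V[of "(m - s, n)"], of "cis (2 * pi * real_of_int s * \<beta> * n)"] by simp
  qed
qed (auto intro: tame_square_integrable tame_kap_atom)

lemma cell_multiplier: "indicator (cell n r) \<in> V.multipliers"
  unfolding cell_def
  using cis_multiplier_V[of 1] cis_multiplier_V[of "- 1"]
  by (intro V.multipliers_indicator_cos) auto

text \<open>The indicator of a unit interval has a unit vector on every fibre. On each cell where
  one combination approximates that vector throughout, it is used; elsewhere the approximant is 0
  and the fibre error is 1. Periodisation sums these errors.\<close>

lemma unit_interval_in_V:
  assumes \<beta>1: "\<beta> \<le> 1"
  shows "indicator {real_of_int j0..<real_of_int j0 + 1} \<in> V"
proof (rule V.closed)
  define f0 :: "real \<Rightarrow> complex" where "f0 = indicator {real_of_int j0..<real_of_int j0 + 1}"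
  have "energy f0 = (\<integral>\<^sup>+ x. indicator {real_of_int j0..<real_of_int j0 + 1} x \<partial>lborel)"
    unfolding energy_def f0_def by (intro nn_integral_cong) (simp add: indicator_def)
  then show "square_integrable (indicator {real_of_int j0..<real_of_int j0 + 1} :: real \<Rightarrow> complex)"
    by (simp add: square_integrable_iff f0_def)
  fix e :: real assume "0 < e"
  define e2 where "e2 = e / 2"
  have e2: "0 < e2" using \<open>0 < e\<close> by (simp add: e2_def)
  \<comment> \<open>One pair must serve the whole open cell, which makes the approximant a finite
    sum and avoids choosing coefficients as functions of \<xi>.\<close>
  define ok where "ok n r T c \<longleftrightarrow> finite T \<and> (\<forall>\<xi>. real r / real n < \<xi> \<longrightarrow> \<xi> < (real r + 1) / real n \<longrightarrow>
    err T c j0 \<xi> < ennreal e2)" for n r :: nat and T c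
  define good_cell where "good_cell n r \<longleftrightarrow> (\<exists>T c. ok n r T c)" for n r
  define T where "T n r = (SOME T. \<exists>c. ok n r T c)" for n r
  define c where "c n r = (SOME c. ok n r (T n r) c)" for n r
  have ok: "ok n r (T n r) (c n r)" if "good_cell n r" for n r
  proof -
    have "\<exists>c. ok n r (T n r) c"
      unfolding T_def by (rule someI_ex) (use that in \<open>simp add: good_cell_def\<close>)
    then show ?thesis unfolding c_def by (rule someI_ex)
  qed
  \<comment> \<open>Only atoms with m = 0 appear explicitly; the modulations are hidden in the cell
    indicators.\<close>
  define f where "f n x = (\<Sum>r\<in>{r\<in>{..<n}. good_cell n r}. indicator (cell n r) x *
    (\<Sum>i\<in>T n r. c n r i * kap_atom (0, i) x))" for n :: nat and x
  have fV: "f n \<in> V" for n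
    unfolding f_def
  proof (intro V.sum)
    fix r
    have "(\<lambda>x. \<Sum>i\<in>T n r. c n r i * kap_atom (0, i) x) \<in> V"
      by (intro V.sum V.cmult kap_atom_in_V)
    then show "(\<lambda>x. indicator (cell n r) x * (\<Sum>i\<in>T n r. c n r i * kap_atom (0, i) x)) \<in> V"
      using cell_multiplier[of n r] by (auto simp: V.multipliers_def)
  qed
  define bad where "bad n = (\<Union>r\<in>{r\<in>{..<n}. \<not> good_cell n r}. {real r / real n<..<(real r + 1) / real n})" for n :: nat
  have bad_meas [measurable]: "bad n \<in> sets borel" for n unfolding bad_def by measurable
  have bad_sub: "bad n \<subseteq> {0<..<1}" for n
  proof
    fix x assume "x \<in> bad n"
    then obtain r where r: "r < n" "real r / real n < x" "x < (real r + 1) / real n" by (auto simp: bad_def)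
    have "(real r + 1) / real n \<le> 1" using r(1) by (simp add: divide_le_eq)
    moreover have "0 \<le> real r / real n" by simp
    ultimately have "0 < x" "x < 1" using r(2,3) by linarith+
    then show "x \<in> {0<..<1}" by simp
  qed
  have "(\<lambda>n. \<integral>\<^sup>+ \<xi>. indicator (bad n) \<xi> \<partial>lborel) \<longlonglongrightarrow> (\<integral>\<^sup>+ (\<xi> :: real). 0 \<partial>lborel)"
  proof (rule nn_integral_dominated_convergence[where w = "indicator {0<..<1}"])
    show "(\<integral>\<^sup>+ x. indicator {0<..<1::real} x \<partial>lborel) < \<infinity>" by simp
    show "AE x in lborel. indicator (bad n) x \<le> (indicator {0<..<1} x :: ennreal)" for n
      using bad_sub[of n] by (intro AE_I2) (auto simp: indicator_def)
    show "AE \<xi> in lborel. (\<lambda>n. indicator (bad n) \<xi> :: ennreal) \<longlonglongrightarrow> 0"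
      using good_AE[OF \<beta>1 e2, of j0]
    proof eventually_elim
      case (elim \<xi>)
      show ?case
      proof (cases "0 < \<xi> \<and> \<xi> < 1")
        case True
        with elim obtain T0 c0 where T0: "finite T0" "annihilating T0 c0"
          "\<And>n j. n \<in> T0 \<Longrightarrow> \<xi> + real_of_int j \<noteq> \<beta> * n" "err T0 c0 j0 \<xi> < ennreal e2"
          unfolding good_def by auto
        obtain d where d: "0 < d" "\<And>x. \<bar>x - \<xi>\<bar> < d \<Longrightarrow> err T0 c0 j0 x < ennreal e2"
          using err_continuous[OF T0(2,1,3,4)] by auto
        obtain n0 :: nat where n0: "1 / d < real n0" using reals_Archimedean2 by blast
        have "indicator (bad n) \<xi> = (0 :: ennreal)" if n: "n \<ge> n0" for n
        proof -
          have "\<xi> \<notin> bad n"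
          proof
            assume "\<xi> \<in> bad n"
            then obtain r where r: "r < n" "\<not> good_cell n r" "real r / real n < \<xi>" "\<xi> < (real r + 1) / real n"
              by (auto simp: bad_def)
            have "1 / real n < d"
            proof -
              have "1 / d < real n" using n0 n by linarith
              then show ?thesis using d(1) r(1) by (simp add: field_simps)
            qed
            \<comment> \<open>A cell around a good point lies inside its neighbourhood of radius d
              once 1/n < d, so the point is eventually outside \<open>bad n\<close>.\<close>
            then have "\<bar>x - \<xi>\<bar> < d" if "real r / real n < x" "x < (real r + 1) / real n" for x
              using that r(3,4) by (simp add: add_divide_distrib abs_less_iff)
            then have "ok n r T0 c0" unfolding ok_def using T0(1) d(2) by blast
            then show False using r(2) by (auto simp: good_cell_def)
          qed
          then show ?thesis by simp
        qed
        then show ?thesis by (intro tendsto_eventually eventually_sequentiallyI)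
      next
        case False
        then have "\<xi> \<notin> bad n" for n using bad_sub[of n] by auto
        then show ?thesis by simp
      qed
    qed
  qed auto
  then have "(\<lambda>n. \<integral>\<^sup>+ \<xi>. indicator (bad n) \<xi> \<partial>lborel) \<longlonglongrightarrow> 0" by simp
  then have "\<forall>\<^sub>F n in sequentially. (\<integral>\<^sup>+ \<xi>. indicator (bad n) \<xi> \<partial>lborel) < ennreal e2"
    by (rule order_tendstoD) (simp add: e2)
  then have "\<forall>\<^sub>F n in sequentially. (\<integral>\<^sup>+ \<xi>. indicator (bad n) \<xi> \<partial>lborel) < ennreal e2 \<and> 0 < n"
    by (intro eventually_conj eventually_gt_at_top)
  then obtain n where n: "(\<integral>\<^sup>+ \<xi>. indicator (bad n) \<xi> \<partial>lborel) < ennreal e2" "0 < n"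
    using eventually_happens' sequentially_bot by blast
  have [measurable]: "f n \<in> borel_measurable borel" "f0 \<in> borel_measurable borel"
    using square_integrable_measurable[OF V.sq[OF fV]] by (auto simp: f0_def)
  have fiber: "(\<integral>\<^sup>+ j. ennreal ((norm (f0 (\<xi> + real_of_int j) - f n (\<xi> + real_of_int j)))\<^sup>2) \<partial>count_space UNIV)
      \<le> ennreal e2 + indicator (bad n) \<xi>" if \<xi>: "0 < \<xi>" "\<xi> < 1" "\<xi> \<notin> \<rat>" for \<xi>
  proof -
    obtain r where r: "r < n" "real r / n < \<xi>" "\<xi> < (real r + 1) / n"
      using cell_exists[OF n(2) \<xi>] by auto
    have cell: "\<xi> + real_of_int j \<in> cell n s \<longleftrightarrow> s = r" if "s < n" for s j
      unfolding cell_iff[OF that \<xi>(1,2)] using cell_unique[OF r(2,3), of s] r by blast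
    have f0: "f0 (\<xi> + real_of_int j) = (if j = j0 then 1 else 0)" for j
    proof -
      have "real_of_int j0 \<le> \<xi> + real_of_int j \<and> \<xi> + real_of_int j < real_of_int j0 + 1 \<longleftrightarrow> j = j0"
        using \<xi> by linarith
      then show ?thesis by (simp add: f0_def indicator_def)
    qed
    have fn: "f n (\<xi> + real_of_int j) = (if good_cell n r then fib (T n r) (c n r) \<xi> j else 0)" for j
    proof -
      have "f n (\<xi> + real_of_int j) = (\<Sum>s\<in>{s\<in>{..<n}. good_cell n s}. if s = r then fib (T n r) (c n r) \<xi> j else 0)"
        unfolding f_def by (intro sum.cong) (auto simp: cell fib_def kap_atom_def)
      then show ?thesis using r(1) by simp
    qed
    show ?thesis
    proof (cases "good_cell n r")
      case True
      have "(\<integral>\<^sup>+ j. ennreal ((norm (f0 (\<xi> + real_of_int j) - f n (\<xi> + real_of_int j)))\<^sup>2) \<partial>count_space UNIV)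
          = err (T n r) (c n r) j0 \<xi>"
        unfolding err_def f0 fn using True by (simp add: norm_minus_commute)
      also have "\<dots> \<le> ennreal e2" using ok[OF True] r unfolding ok_def by (simp add: less_imp_le)
      finally show ?thesis by (rule order_trans) simp
    next
      case False
      then have "\<xi> \<in> bad n" unfolding bad_def using r by auto
      have "(\<integral>\<^sup>+ j. ennreal ((norm (f0 (\<xi> + real_of_int j) - f n (\<xi> + real_of_int j)))\<^sup>2) \<partial>count_space UNIV)
          = (\<Sum>j\<in>{j0}. ennreal ((norm (f0 (\<xi> + real_of_int j) - f n (\<xi> + real_of_int j)))\<^sup>2))"
        by (rule nn_integral_count_space') (use False in \<open>auto simp: f0 fn\<close>)
      also have "\<dots> = 1" using False by (simp add: f0 fn)
      finally show ?thesis using \<open>\<xi> \<in> bad n\<close> by simp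
    qed
  qed
  have "energy (\<lambda>x. f0 x - f n x) = (\<integral>\<^sup>+ \<xi>. indicator {0..<1} \<xi> *
      (\<integral>\<^sup>+ j. ennreal ((norm (f0 (\<xi> + real_of_int j) - f n (\<xi> + real_of_int j)))\<^sup>2) \<partial>count_space UNIV) \<partial>lborel)"
    unfolding energy_def by (rule nn_integral_periodize) measurable
  also have "\<dots> \<le> (\<integral>\<^sup>+ \<xi>. ennreal e2 * indicator {0..<1} \<xi> + indicator (bad n) \<xi> \<partial>lborel)"
  proof (rule nn_integral_mono_AE)
    show "AE \<xi> in lborel. indicator {0..<1} \<xi> *
      (\<integral>\<^sup>+ j. ennreal ((norm (f0 (\<xi> + real_of_int j) - f n (\<xi> + real_of_int j)))\<^sup>2) \<partial>count_space UNIV)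
      \<le> ennreal e2 * indicator {0..<1} \<xi> + indicator (bad n) \<xi>"
      using AE_irrational
    proof eventually_elim
      case (elim \<xi>)
      show ?case
      proof (cases "0 \<le> \<xi> \<and> \<xi> < 1")
        case True
        moreover have "\<xi> \<noteq> 0" using elim by auto
        ultimately show ?thesis using fiber[of \<xi>] elim by simp
      qed auto
    qed
  qed
  also have "\<dots> = ennreal e2 + (\<integral>\<^sup>+ \<xi>. indicator (bad n) \<xi> \<partial>lborel)"
    by (subst nn_integral_add) (auto simp: nn_integral_cmult)
  also have "\<dots> < ennreal e2 + ennreal e2"
    using n(1) by (intro ennreal_add_left_cancel_less[THEN iffD2]) auto
  also have "\<dots> = ennreal e" using e2 by (simp add: e2_def flip: ennreal_plus)
  finally show "\<exists>v\<in>V. energy (\<lambda>x. indicator {real_of_int j0..<real_of_int j0 + 1} x - v x) < ennreal e"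
    using fV[of n] unfolding f0_def by blast
qed

lemma interval_in_V:
  assumes \<beta>1: "\<beta> \<le> 1" and n: "0 < n"
  shows "indicator {real_of_int i / real n<..<(real_of_int i + 1) / real n} \<in> V"
proof -
  define j r where "j = i div int n" and "r = nat (i mod int n)"
  have r: "r < n" "int r = i mod int n" using n by (auto simp: r_def nat_less_iff)
  have "i = int n * j + int r" by (simp add: j_def r)
  then have "real_of_int i = real n * real_of_int j + real r" by (metis of_int_add of_int_mult of_int_of_nat_eq)
  then have i: "real_of_int i / real n = real_of_int j + real r / n" "(real_of_int i + 1) / real n = real_of_int j + (real r + 1) / n"
    using n by (auto simp: field_simps)
  have "(\<lambda>x. indicator (cell n r) x * indicator {real_of_int j..<real_of_int j + 1} x) \<in> V"
    using unit_interval_in_V[OF \<beta>1, of j] cell_multiplier[of n r] by (auto simp: V.multipliers_def)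
  then show ?thesis
  proof (rule V.cong_AE)
    show "AE x in lborel. indicator (cell n r) x * indicator {real_of_int j..<real_of_int j + 1} x
      = (indicator {real_of_int i / real n<..<(real_of_int i + 1) / real n} x :: complex)"
      using AE_irrational
    proof eventually_elim
      case (elim x)
      define \<xi> where "\<xi> = x - real_of_int j"
      have x: "x = \<xi> + real_of_int j" by (simp add: \<xi>_def)
      have "\<xi> \<noteq> 0" using elim x by auto
      have rn: "0 \<le> real r / n" "(real r + 1) / n \<le> 1" using r(1) by (auto simp: divide_le_eq)
      have "x \<in> cell n r \<and> real_of_int j \<le> x \<and> x < real_of_int j + 1 \<longleftrightarrow>
          real_of_int i / real n < x \<and> x < (real_of_int i + 1) / real n"
      proof (cases "0 < \<xi> \<and> \<xi> < 1")
        case True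
        then show ?thesis unfolding i x using cell_iff[OF r(1), of \<xi> j] by auto
      next
        case False
        then have "\<not> (real r / n < \<xi> \<and> \<xi> < (real r + 1) / n)" "\<not> (0 \<le> \<xi> \<and> \<xi> < 1)"
          using rn \<open>\<xi> \<noteq> 0\<close> by linarith+
        then show ?thesis unfolding i x by auto
      qed
      then show ?case by (auto simp: indicator_def)
    qed
  qed simp
qed

text \<open>The transform is a modulation of 1 / (t + \<i>), which vanishes nowhere.\<close>

definition test_pre :: "real \<Rightarrow> real \<Rightarrow> complex" where
  "test_pre b x = cauchy_pre (- 1) (x - b)"

lemma tame_test_pre: "tame (test_pre b)"
  unfolding test_pre_def[abs_def] by (intro tame_shift tame_cauchy_pre) simp

lemma test_pre_in_V:
  assumes \<beta>1: "\<beta> \<le> 1"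
  shows "test_pre b \<in> V"
proof (rule V.dominated)
  define m where "m n = Suc n" for n
  \<comment> \<open>A step function with mesh 1 / m n; about m n squared intervals on each side
    reach out to distance m n.\<close>
  define s where "s n x = (\<Sum>i\<in>{- int (m n * m n)..int (m n * m n)}. test_pre b (of_int i / m n) *
    indicator {of_int i / real (m n)<..<(of_int i + 1) / real (m n)} x)" for n x
  show "s n \<in> V" for n
    unfolding s_def by (intro V.sum V.cmult interval_in_V \<beta>1) (simp add: m_def)
  show "test_pre b \<in> borel_measurable borel" using tame_test_pre[of b] by (simp add: tame_def)
  \<comment> \<open>Samples are taken at left endpoints at distance at most 1, where the exponential
    is larger by at most exp (2 pi). A nonzero sample lies right of b, and so does x.\<close>
  show "square_integrable (\<lambda>x. of_real (exp (2 * pi)) * test_pre b x)"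
    by (intro square_integrable_cmult tame_square_integrable tame_test_pre)
  have mem: "x \<in> {of_int i / real (m n)<..<(of_int i + 1) / real (m n)} \<Longrightarrow> i = \<lfloor>x * m n\<rfloor>" for x :: real and n i
    by (rule floor_unique[symmetric]) (auto simp: m_def field_simps)
  have s_eq: "s n x = (if \<lfloor>x * m n\<rfloor> \<in> {- int (m n * m n)..int (m n * m n)} \<and> of_int \<lfloor>x * m n\<rfloor> / real (m n) < x
      then test_pre b (of_int \<lfloor>x * m n\<rfloor> / m n) else 0)" for n and x :: real
  proof -
    have "x < (of_int \<lfloor>x * m n\<rfloor> + 1) / real (m n)"
      by (simp add: m_def pos_less_divide_eq)
    then have "x \<in> {of_int i / real (m n)<..<(of_int i + 1) / real (m n)} \<longleftrightarrow>
        i = \<lfloor>x * m n\<rfloor> \<and> of_int \<lfloor>x * m n\<rfloor> / real (m n) < x" for i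
      using mem[of x i n] by (metis greaterThanLessThan_iff)
    then have "s n x = (\<Sum>i\<in>{- int (m n * m n)..int (m n * m n)}. if i = \<lfloor>x * m n\<rfloor> then
        (if of_int \<lfloor>x * m n\<rfloor> / real (m n) < x then test_pre b (of_int \<lfloor>x * m n\<rfloor> / m n) else 0) else 0)"
      unfolding s_def indicator_def by (intro sum.cong) simp_all
    then show ?thesis by simp
  qed
  have near: "\<bar>of_int \<lfloor>x * m n\<rfloor> / real (m n) - x\<bar> \<le> 1 / m n" for x :: real and n
  proof -
    have "\<bar>of_int \<lfloor>x * m n\<rfloor> - x * m n\<bar> \<le> 1" by linarith
    then have "\<bar>of_int \<lfloor>x * m n\<rfloor> - x * m n\<bar> / m n \<le> 1 / m n" by (intro divide_right_mono) auto
    moreover have "of_int \<lfloor>x * m n\<rfloor> / real (m n) - x = (of_int \<lfloor>x * m n\<rfloor> - x * m n) / m n"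
      by (simp add: m_def diff_divide_distrib)
    ultimately show ?thesis by (simp only: abs_divide abs_of_nat)
  qed
  show "norm (s n x) \<le> norm (of_real (exp (2 * pi)) * test_pre b x)" for n x
  proof (cases "s n x = 0")
    case False
    define y where "y = of_int \<lfloor>x * m n\<rfloor> / real (m n)"
    have y: "s n x = test_pre b y" "y < x" using False by (auto simp: s_eq y_def split: if_splits)
    have "1 / real (m n) \<le> 1" by (simp add: m_def)
    then have "x - 1 \<le> y" using near[of x n] unfolding y_def by linarith
    have "b < y" using False y by (auto simp: test_pre_def cauchy_pre_def indicator_def split: if_splits)
    then have "norm (s n x) = 2 * pi * exp (- (2 * pi * (y - b)))" "norm (test_pre b x) = 2 * pi * exp (- (2 * pi * (x - b)))"
      using y by (auto simp: test_pre_def cauchy_pre_def norm_mult)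
    moreover have "exp (- (2 * pi * (y - b))) \<le> exp (2 * pi) * exp (- (2 * pi * (x - b)))"
    proof -
      have "2 * pi * (x - 1) \<le> 2 * pi * y" using \<open>x - 1 \<le> y\<close> by (intro mult_left_mono) auto
      then have "- (2 * pi * (y - b)) \<le> 2 * pi + - (2 * pi * (x - b))" by (simp add: algebra_simps)
      then show ?thesis unfolding exp_add[symmetric] by simp
    qed
    ultimately show ?thesis by (simp add: norm_mult)
  qed simp
  have "AE x in lborel. x \<noteq> b" by (rule AE_I'[of "{b}"]) auto
  with AE_irrational show "AE x in lborel. (\<lambda>n. s n x) \<longlonglongrightarrow> test_pre b x"
  proof eventually_elim
    case (elim x)
    have "(\<lambda>n. of_int \<lfloor>x * m n\<rfloor> / real (m n) - x) \<longlonglongrightarrow> 0"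
    proof (rule Lim_null_comparison)
      show "(\<lambda>n. 1 / real (m n)) \<longlonglongrightarrow> 0"
        unfolding m_def using LIMSEQ_inverse_real_of_nat by (simp add: inverse_eq_divide)
    qed (use near in auto)
    then have "(\<lambda>n. of_int \<lfloor>x * m n\<rfloor> / real (m n)) \<longlonglongrightarrow> x" by (rule LIM_zero_cancel)
    moreover have "isCont (test_pre b) x"
      unfolding test_pre_def[abs_def] using elim(2)
      by (intro isCont_o2[of x "\<lambda>x. x - b" "cauchy_pre (- 1)"] isCont_cauchy_pre) auto
    ultimately have lim: "(\<lambda>n. test_pre b (of_int \<lfloor>x * m n\<rfloor> / real (m n))) \<longlonglongrightarrow> test_pre b x"
      by (intro isCont_tendsto_compose[of x "test_pre b"])
    obtain n0 :: nat where n0: "\<bar>x\<bar> + 1 < real n0" using reals_Archimedean2 by blast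
    have "s n x = test_pre b (of_int \<lfloor>x * m n\<rfloor> / real (m n))" if "n \<ge> n0" for n
    proof -
      have mpos: "1 \<le> real (m n)" by (simp add: m_def)
      have "\<bar>x\<bar> + 1 \<le> real (m n)" using n0 that by (simp add: m_def)
      then have "(\<bar>x\<bar> + 1) * real (m n) \<le> real (m n) * real (m n)" using mpos by (intro mult_right_mono) auto
      define q where "q = m n * m n"
      have "\<bar>x * real (m n)\<bar> + 1 \<le> real q"
        using \<open>(\<bar>x\<bar> + 1) * real (m n) \<le> real (m n) * real (m n)\<close> mpos by (simp add: q_def abs_mult distrib_right)
      then have "- int q \<le> \<lfloor>x * m n\<rfloor>" "\<lfloor>x * m n\<rfloor> \<le> int q" by linarith+
      then have "\<lfloor>x * m n\<rfloor> \<in> {- int (m n * m n)..int (m n * m n)}" by (simp add: q_def)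
      moreover have "of_int \<lfloor>x * m n\<rfloor> / real (m n) < x"
      proof -
        have "of_int \<lfloor>x * m n\<rfloor> \<noteq> x * m n"
        proof
          assume eq: "of_int \<lfloor>x * m n\<rfloor> = x * m n"
          have "x = x * m n / m n" using mpos by simp
          also have "\<dots> = of_int \<lfloor>x * m n\<rfloor> / of_nat (m n)" by (simp only: eq)
          finally have "x = of_int \<lfloor>x * m n\<rfloor> / of_nat (m n)" .
          then show False using elim(1) by (metis Rats_divide Rats_of_int Rats_of_nat)
        qed
        then have "of_int \<lfloor>x * m n\<rfloor> < x * m n" by linarith
        then show ?thesis using mpos by (simp add: divide_less_eq)
      qed
      ultimately show ?thesis by (simp add: s_eq)
    qed
    then show ?case
      by (intro Lim_transform_eventually[OF lim] eventually_sequentiallyI[of n0]) simp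
  qed
qed

section \<open>Transfer to the Gabor system\<close>

definition g where "g t = (\<Sum>k\<in>K. a k / (of_real t - \<i> * w k))"

lemma fourier_kap: "fourier kap t = g t"
  unfolding kap_def[abs_def] g_def using w
  by (subst fourier_sum) (auto simp: fourier_cauchy_pre tame_cauchy_pre intro!: sum.cong)

lemma fourier_kap_atom: "fourier (kap_atom (m, n)) t = gabor_atom g 1 \<beta> m n t"
proof -
  have "fourier (kap_atom (m, n)) t = cis (2 * pi * (\<beta> * n) * t) * fourier (\<lambda>x. cis (2 * pi * - real_of_int m * x) * kap x) t"
    unfolding kap_atom_def prod.case by (rule fourier_shift)
  also have "fourier (\<lambda>x. cis (2 * pi * - real_of_int m * x) * kap x) t = g (t - m)"
    by (subst fourier_modulate) (simp add: fourier_kap)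
  finally show ?thesis
    by (simp add: gabor_atom_def cis_conv_exp mult_ac)
qed

lemma fourier_test_pre: "fourier (test_pre b) t = cis (2 * pi * b * t) / (of_real t + \<i>)"
  unfolding test_pre_def[abs_def] by (subst fourier_shift) (simp add: fourier_cauchy_pre)

lemma gabor_span_eq: "span_closure (\<lambda>(m, n). gabor_atom g 1 \<beta> m n) = span_closure (\<lambda>i. fourier (kap_atom i))"
  by (intro arg_cong[where f = span_closure] ext) (auto simp: fourier_kap_atom)

lemma test_in_gabor_span_iff:
  "fourier (test_pre b) \<in> span_closure (\<lambda>(m, n). gabor_atom g 1 \<beta> m n) \<longleftrightarrow> test_pre b \<in> V"
  unfolding gabor_span_eq V_def by (rule fourier_span_closure_iff[OF tame_test_pre tame_kap_atom])

text \<open>The test transforms generate everything: modulating one of them only moves b, so all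
  modulations are multipliers of their closed span, and \<open>eq_all_square_integrable\<close>
  applies to the kernel at b = 0.\<close>

lemma complete_if:
  assumes "\<beta> \<le> 1" shows "gabor_complete g 1 \<beta>"
  unfolding gabor_complete_iff
proof (intro allI impI)
  fix f assume f: "square_integrable f"
  define W where "W = span_closure (\<lambda>b. fourier (test_pre b))"
  have sq: "square_integrable (fourier (test_pre b))" for b by (intro square_integrable_fourier tame_test_pre)
  have base: "fourier (test_pre b) \<in> W" for b unfolding W_def by (rule span_closure_base[OF sq])
  interpret W: closed_subspace W unfolding W_def by (rule closed_subspace_span_closure[OF sq])
  have "(\<lambda>x. cis (c * x)) \<in> W.multipliers" for c
  proof (rule W.span_closure_multiplier[OF W_def, where B = 1])
    show "(\<lambda>x. cis (c * x)) \<in> borel_measurable borel"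
      by (intro borel_measurable_continuous_onI) (auto simp: cis_conv_exp intro!: continuous_intros)
    have "(\<lambda>x. cis (c * x) * fourier (test_pre b) x) = fourier (test_pre (b + c / (2 * pi)))" for b
      unfolding fourier_test_pre by (auto simp: cis_mult algebra_simps add_divide_distrib)
    then show "(\<lambda>x. cis (c * x) * fourier (test_pre b) x) \<in> W" for b using base by simp
  qed (auto intro: sq)
  moreover have "fourier (test_pre 0) x \<noteq> 0" for x
  proof -
    have "of_real x + \<i> \<noteq> 0" by (simp add: complex_eq_iff)
    then show ?thesis unfolding fourier_test_pre by simp
  qed
  ultimately have "f \<in> W" by (intro W.eq_all_square_integrable[OF _ base _ f])
  moreover have "W \<subseteq> span_closure (\<lambda>(m, n). gabor_atom g 1 \<beta> m n)"
    unfolding W_def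
  proof (rule span_closure_minimal)
    show "closed_subspace (span_closure (\<lambda>(m, n). gabor_atom g 1 \<beta> m n))"
      unfolding gabor_span_eq by (intro closed_subspace_span_closure square_integrable_fourier tame_kap_atom)
  qed (simp add: test_in_gabor_span_iff test_pre_in_V assms)
  ultimately show "f \<in> span_closure (\<lambda>(m, n). gabor_atom g 1 \<beta> m n)" by auto
qed

end

subsection \<open>Incompleteness at density below one\<close>

lemma square_integrable_product:
  assumes "square_integrable f" "square_integrable h"
  shows "integrable lborel (\<lambda>x. f x * h x)"
proof (rule Bochner_Integration.integrable_bound)
  show "integrable lborel (\<lambda>x. (norm (f x))\<^sup>2 + (norm (h x))\<^sup>2)"
    using assms by (simp add: square_integrable_def)
  show "(\<lambda>x. f x * h x) \<in> borel_measurable lborel"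
    using assms by (auto dest!: square_integrable_measurable)
  have "norm (f x * h x) \<le> (norm (f x))\<^sup>2 + (norm (h x))\<^sup>2" for x
  proof -
    have "2 * norm (f x) * norm (h x) \<le> (norm (f x))\<^sup>2 + (norm (h x))\<^sup>2" by (rule sum_squares_bound)
    moreover have "0 \<le> norm (f x) * norm (h x)" by simp
    ultimately show ?thesis unfolding norm_mult by linarith
  qed
  then show "AE x in lborel. norm (f x * h x) \<le> norm ((norm (f x))\<^sup>2 + (norm (h x))\<^sup>2)" by simp
qed

lemma energy_eq_integral:
  "square_integrable f \<Longrightarrow> energy f = ennreal (\<integral>x. (norm (f x))\<^sup>2 \<partial>lborel)"
  unfolding energy_def square_integrable_def by (subst nn_integral_eq_integral) auto

text \<open>Pairing with h is continuous for the energy. The pairing is bilinear, without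
  conjugation, so the fibre vectors d enter h unchanged.\<close>

lemma closed_subspace_annihilator:
  assumes h: "square_integrable h"
  shows "closed_subspace {f. square_integrable f \<and> (\<integral>x. f x * h x \<partial>lborel) = 0}" (is "closed_subspace ?A")
proof
  show "(\<lambda>x. f x + g x) \<in> ?A" if "f \<in> ?A" "g \<in> ?A" for f g
    using that square_integrable_product[OF _ h]
    by (auto simp: distrib_right intro: square_integrable_add)
  show "(\<lambda>x. c * f x) \<in> ?A" if "f \<in> ?A" for f c
    using that by (auto simp: mult.assoc intro: square_integrable_cmult)
  fix f assume f: "square_integrable f"
    and *: "\<And>e. 0 < e \<Longrightarrow> \<exists>v\<in>?A. energy (\<lambda>x. f x - v x) < ennreal e"
  define H where "H = (\<integral>x. (norm (h x))\<^sup>2 \<partial>lborel)"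
  have H: "0 \<le> H" by (simp add: H_def)
  have "norm (\<integral>x. f x * h x \<partial>lborel) \<le> e" if e: "0 < e" for e
  proof -
    text \<open>AM-GM: \<open>2 * norm (u * h) \<le> s * (norm u)\<^sup>2 + (norm h)\<^sup>2 / s\<close>.\<close>
    define s where "s = H / e + 1"
    have s: "0 < s" "H / s \<le> e" using H e by (auto simp: s_def field_simps add_nonneg_pos)
    have es: "0 < e / s" using e s by simp
    obtain v where v: "v \<in> ?A" "energy (\<lambda>x. f x - v x) < ennreal (e / s)" using *[OF es] by auto
    define u where "u x = f x - v x" for x
    have u: "square_integrable u"
      using square_integrable_add[OF f square_integrable_cmult[of v "- 1"]] v(1) by (simp add: u_def[abs_def])
    have uh: "integrable lborel (\<lambda>x. u x * h x)" by (rule square_integrable_product[OF u h])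
    have "energy u = ennreal (\<integral>x. (norm (u x))\<^sup>2 \<partial>lborel)" by (rule energy_eq_integral[OF u])
    then have Eu: "(\<integral>x. (norm (u x))\<^sup>2 \<partial>lborel) < e / s"
      using v(2) es unfolding u_def by (simp add: ennreal_less_iff)
    have "(\<integral>x. f x * h x \<partial>lborel) = (\<integral>x. u x * h x \<partial>lborel) + (\<integral>x. v x * h x \<partial>lborel)"
      using uh square_integrable_product[OF _ h, of v] v(1)
      by (subst Bochner_Integration.integral_add[symmetric]) (auto simp: u_def algebra_simps)
    then have "norm (\<integral>x. f x * h x \<partial>lborel) \<le> (\<integral>x. norm (u x * h x) \<partial>lborel)"
      using v(1) by simp
    also have "\<dots> \<le> (\<integral>x. (s * (norm (u x))\<^sup>2 + (norm (h x))\<^sup>2 / s) / 2 \<partial>lborel)"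
    proof (rule integral_mono)
      show "integrable lborel (\<lambda>x. norm (u x * h x))" using uh by (rule integrable_norm)
      show "integrable lborel (\<lambda>x. (s * (norm (u x))\<^sup>2 + (norm (h x))\<^sup>2 / s) / 2)"
        using u h by (simp add: square_integrable_def)
      show "norm (u x * h x) \<le> (s * (norm (u x))\<^sup>2 + (norm (h x))\<^sup>2 / s) / 2" for x
      proof -
        have "0 \<le> (s * norm (u x) - norm (h x))\<^sup>2 / s" using s by simp
        also have "\<dots> = s * (norm (u x))\<^sup>2 + (norm (h x))\<^sup>2 / s - 2 * (norm (u x) * norm (h x))"
          using s by (simp add: power2_diff power_mult_distrib field_simps power2_eq_square)
        finally show ?thesis by (simp add: norm_mult)
      qed
    qed
    also have "\<dots> = (s * (\<integral>x. (norm (u x))\<^sup>2 \<partial>lborel) + H / s) / 2"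
      using u h unfolding H_def by (simp add: square_integrable_def)
    also have "\<dots> \<le> (e + e) / 2"
    proof -
      have "s * (\<integral>x. (norm (u x))\<^sup>2 \<partial>lborel) \<le> e" using Eu s by (simp add: less_divide_eq mult.commute less_imp_le)
      then show ?thesis using s by simp
    qed
    finally show ?thesis by simp
  qed
  then have "norm (\<integral>x. f x * h x \<partial>lborel) \<le> 0" by (rule field_le_epsilon[of _ 0, simplified])
  then show "f \<in> ?A" using f by simp
qed (auto simp: square_integrable_0)

lemma exists_gap_of_finite:
  fixes F :: "real set"
  assumes "finite F"
  shows "\<exists>\<eta>. 0 < \<eta> \<and> \<eta> \<le> 1 \<and> F \<inter> {0<..<\<eta>} = {}"
  using assms
proof (induction F rule: finite_induct)
  case empty
  then show ?case by (intro exI[of _ 1]) auto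
next
  case (insert x F)
  then obtain \<eta> where \<eta>: "0 < \<eta>" "\<eta> \<le> 1" "F \<inter> {0<..<\<eta>} = {}" by auto
  show ?case
  proof (cases "0 < x")
    case True
    then show ?thesis using \<eta> by (intro exI[of _ "min \<eta> x"]) auto
  next
    case False
    then show ?thesis using \<eta> by (intro exI[of _ \<eta>]) auto
  qed
qed

context cauchy_sum
begin

text \<open>For \<open>\<beta> > 1\<close> long windows contain more points of \<open>\<xi> + \<int>\<close> than of \<open>\<beta>\<int>\<close>, which leaves room for a
  nonzero finitely supported sequence orthogonal to all fibres, depending analytically on \<open>\<xi>\<close>.\<close>

lemma orthogonal_fibres:
  assumes \<beta>1: "1 < \<beta>"
  shows "\<exists>M \<eta> d. 0 < \<eta> \<and> \<eta> \<le> 1 \<and> (\<forall>j. d j holomorphic_on UNIV) \<and> (\<exists>j\<le>M. \<exists>z. d j z \<noteq> 0) \<and>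
    (\<forall>\<xi> n. 0 < \<xi> \<longrightarrow> \<xi> < \<eta> \<longrightarrow> (\<Sum>j\<le>M. d j (of_real \<xi>) * kap (\<xi> + real j - \<beta> * real_of_int n)) = 0)"
proof -
  \<comment> \<open>Chosen so that the \<open>card K\<close> exponential conditions and the at most
    (M + 1)/\<beta> jump conditions are fewer than the M + 1 unknowns.\<close>
  obtain M :: nat where M: "card K / (1 - 1 / \<beta>) < real M" using reals_Archimedean2 by blast
  have "0 < 1 - 1 / \<beta>" using \<beta>1 by simp
  then have M': "card K < real M * (1 - 1 / \<beta>)" using M by (simp add: divide_less_eq)
  \<comment> \<open>Outside this range all positions lie on one side of the jump, and the
    exponential conditions alone suffice.\<close>
  define R where "R = {n::int. 0 < \<beta> * n \<and> \<beta> * n < real M + 1}"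
  have R_sub: "R \<subseteq> {1..\<lfloor>(real M + 1) / \<beta>\<rfloor>}"
  proof
    fix n assume n: "n \<in> R"
    then have "0 < n" using \<beta> by (simp add: R_def zero_less_mult_iff)
    moreover have "real_of_int n < (real M + 1) / \<beta>" using n \<beta> by (simp add: R_def less_divide_eq mult.commute)
    then have "n \<le> \<lfloor>(real M + 1) / \<beta>\<rfloor>" by linarith
    ultimately show "n \<in> {1..\<lfloor>(real M + 1) / \<beta>\<rfloor>}" by simp
  qed
  then have finR: "finite R" by (rule finite_subset) simp
  have cR: "real (card R) \<le> (real M + 1) / \<beta>"
  proof -
    have "card R \<le> card {1..\<lfloor>(real M + 1) / \<beta>\<rfloor>}" using R_sub by (intro card_mono) auto
    then have "real (card R) \<le> of_int \<lfloor>(real M + 1) / \<beta>\<rfloor>"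
      using \<beta> by (simp add: le_nat_iff)
    then show ?thesis by linarith
  qed
  define II where "II = (Inl ` K \<union> Inr ` R :: (nat + int) set)"
  have "card II = card K + card R"
    unfolding II_def using K finR by (subst card_Un_disjoint) (auto simp: card_image)
  moreover have "real (card K) + real (card R) < real M + 1"
  proof -
    have "(real M + 1) / \<beta> = real M / \<beta> + 1 / \<beta>" by (simp add: add_divide_distrib)
    moreover have "1 / \<beta> < 1" using \<beta>1 by simp
    moreover have "real (card K) < real M - real M / \<beta>" using M' by (simp add: algebra_simps)
    ultimately show ?thesis using cR by linarith
  qed
  ultimately have card: "card II < card {..M}" by simp
  \<comment> \<open>The comparison is non-strict because the pattern is frozen just to the right of
    \<xi> = 0: there \<xi> + j exceeds \<beta> n exactly when j \<ge> \<beta> n.\<close>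
  define A where "A i j = (case i of
      Inl k \<Rightarrow> (\<lambda>s. ex k (of_nat j))
    | Inr n \<Rightarrow> (\<lambda>s. if \<beta> * of_int n \<le> real j then jump (s + of_nat j - of_real (\<beta> * of_int n)) else 0))"
    for i :: "nat + int" and j :: nat
  have A_hol: "A i j holomorphic_on UNIV" for i j
  proof (cases i)
    case (Inr n)
    have "(\<lambda>s. jump (s + of_nat j - of_real (\<beta> * of_int n))) holomorphic_on UNIV"
      unfolding jump_def ex_def by (intro holomorphic_intros)
    then show ?thesis unfolding A_def Inr sum.case
      by (cases "\<beta> * of_int n \<le> real j") (simp_all only: if_True if_False holomorphic_on_const)
  qed (auto simp: A_def)
  have "finite II" using K finR by (simp add: II_def)
  then have "\<exists>d. (\<forall>j. d j holomorphic_on UNIV) \<and> (\<exists>j\<in>{..M}. \<exists>z. d j z \<noteq> 0) \<and>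
      (\<forall>i\<in>II. \<forall>z. (\<Sum>j\<le>M. A i j z * d j z) = 0)"
    by (rule entire_kernel[OF _ _ card A_hol]) simp
  then obtain d where d: "\<forall>j. d j holomorphic_on UNIV" "\<exists>j\<in>{..M}. \<exists>z. d j z \<noteq> 0"
    and d0: "\<forall>i\<in>II. \<forall>z. (\<Sum>j\<le>M. A i j z * d j z) = 0" by (elim exE conjE)
  \<comment> \<open>The values of \<xi> at which the pattern changes; \<eta> stays below the
    positive ones.\<close>
  define F where "F = (\<lambda>(n, j). \<beta> * of_int n - real j) ` (R \<times> {..M})"
  have "finite F" using finR by (simp add: F_def)
  then obtain \<eta> where \<eta>: "0 < \<eta>" "\<eta> \<le> 1" "F \<inter> {0<..<\<eta>} = {}" using exists_gap_of_finite by blast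
  have "(\<Sum>j\<le>M. d j (of_real \<xi>) * kap (\<xi> + real j - \<beta> * real_of_int n)) = 0" if \<xi>: "0 < \<xi>" "\<xi> < \<eta>" for \<xi> n
  proof -
    define t where "t = \<xi> - \<beta> * real_of_int n"
    have ex0: "(\<Sum>j\<le>M. d j (of_real \<xi>) * ex k (of_real (t + real j))) = 0" if "k \<in> K" for k
    proof -
      have "(\<Sum>j\<le>M. d j (of_real \<xi>) * ex k (of_real (t + real j)))
          = ex k (of_real t) * (\<Sum>j\<le>M. A (Inl k) j (of_real \<xi>) * d j (of_real \<xi>))"
        unfolding sum_distrib_left by (intro sum.cong) (simp_all add: A_def ex_add)
      then show ?thesis using d0 that by (simp add: II_def)
    qed
    have comb: "(\<Sum>j\<le>M. d j (of_real \<xi>) * (\<Sum>k\<in>I. b k * ex k (of_real (t + real j)))) = 0" if "I \<subseteq> K" for b I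
    proof -
      have "(\<Sum>j\<le>M. d j (of_real \<xi>) * (\<Sum>k\<in>I. b k * ex k (of_real (t + real j))))
          = (\<Sum>k\<in>I. b k * (\<Sum>j\<le>M. d j (of_real \<xi>) * ex k (of_real (t + real j))))"
        unfolding sum_distrib_left by (subst sum.swap) (simp add: mult.left_commute)
      also have "\<dots> = 0" using ex0 that by (intro sum.neutral) auto
      finally show ?thesis .
    qed
    have left0: "(\<Sum>j\<le>M. d j (of_real \<xi>) * left_part (of_real (t + real j))) = 0"
      unfolding left_part_def by (rule comb) auto
    have jump0: "(\<Sum>j\<le>M. d j (of_real \<xi>) * jump (of_real (t + real j))) = 0"
      unfolding jump_def by (rule comb) auto
    have kap: "(\<Sum>j\<le>M. d j (of_real \<xi>) * kap (t + real j)) = - 2 * of_real pi * \<i> *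
        (\<Sum>j\<le>M. if 0 < t + real j then d j (of_real \<xi>) * jump (of_real (t + real j)) else 0)"
      if ne: "\<And>j. j \<le> M \<Longrightarrow> t + real j \<noteq> 0"
    proof -
      have "(\<Sum>j\<le>M. d j (of_real \<xi>) * kap (t + real j)) = (\<Sum>j\<le>M. d j (of_real \<xi>) * left_part (of_real (t + real j)))
          + (\<Sum>j\<le>M. - 2 * of_real pi * \<i> * (if 0 < t + real j then d j (of_real \<xi>) * jump (of_real (t + real j)) else 0))"
        unfolding sum.distrib[symmetric]
        by (intro sum.cong refl, subst kap_eq) (use ne in \<open>auto simp: algebra_simps\<close>)
      then show ?thesis unfolding left0 by (simp only: sum_distrib_left add_0)
    qed
    have "(\<Sum>j\<le>M. d j (of_real \<xi>) * kap (t + real j)) = 0"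
    proof (cases "n \<in> R")
      case True
      have pos: "0 < t + real j \<longleftrightarrow> \<beta> * of_int n \<le> real j" and ne: "t + real j \<noteq> 0" if "j \<le> M" for j
      proof -
        have "\<beta> * of_int n - real j \<in> F" unfolding F_def using True that by force
        then have "\<not> (0 < \<beta> * of_int n - real j \<and> \<beta> * of_int n - real j < \<eta>)" using \<eta>(3) by auto
        then show "0 < t + real j \<longleftrightarrow> \<beta> * of_int n \<le> real j" "t + real j \<noteq> 0"
          using \<xi> unfolding t_def by linarith+
      qed
      have "(\<Sum>j\<le>M. if 0 < t + real j then d j (of_real \<xi>) * jump (of_real (t + real j)) else 0)
          = (\<Sum>j\<le>M. A (Inr n) j (of_real \<xi>) * d j (of_real \<xi>))"
      proof (intro sum.cong refl)
        fix j assume "j \<in> {..M}"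
        then have "j \<le> M" by simp
        then show "(if 0 < t + real j then d j (of_real \<xi>) * jump (of_real (t + real j)) else 0)
          = A (Inr n) j (of_real \<xi>) * d j (of_real \<xi>)"
          unfolding pos[OF \<open>j \<le> M\<close>] A_def by (simp add: t_def algebra_simps)
      qed
      then show ?thesis using kap[OF ne] d0 True by (simp add: II_def)
    next
      case False
      then consider "\<beta> * of_int n \<le> 0" | "real M + 1 \<le> \<beta> * of_int n" by (auto simp: R_def)
      then show ?thesis
      proof cases
        case 1
        then have pos: "0 < t + real j" for j using \<xi> by (simp add: t_def)
        then show ?thesis using kap[OF less_imp_neq[OF pos, symmetric]] jump0 by simp
      next
        case 2
        then have neg: "t + real j < 0" if "j \<le> M" for j
          using \<xi> \<eta>(2) that unfolding t_def by linarith
        have "(\<Sum>j\<le>M. if 0 < t + real j then d j (of_real \<xi>) * jump (of_real (t + real j)) else 0) = 0"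
          by (intro sum.neutral) (use neg in \<open>auto dest: order_less_asym\<close>)
        then show ?thesis using kap[OF less_imp_neq[OF neg]] by simp
      qed
    qed
    then show ?thesis by (simp add: t_def algebra_simps)
  qed
  then show ?thesis using d \<eta> by (intro exI[of _ M] exI[of _ \<eta>] exI[of _ d]) auto
qed

text \<open>Spreading the fibre vectors over (0, \<eta>) gives h, annihilated by all of V.
  Completeness would put every \<open>test_pre b\<close> into V; varying b then forces an
  exponential multiple of h to have zero integral over every interval, although it is continuous and
  nonzero near some point.\<close>

lemma not_complete_if:
  assumes \<beta>1: "1 < \<beta>" shows "\<not> gabor_complete g 1 \<beta>"
proof
  assume complete: "gabor_complete g 1 \<beta>"
  have test: "test_pre b \<in> V" for b
    using complete square_integrable_fourier[OF tame_test_pre, of b]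
    unfolding gabor_complete_iff test_in_gabor_span_iff[symmetric] by blast
  obtain M \<eta> d where \<eta>: "0 < \<eta>" "\<eta> \<le> 1" and hol: "\<And>j. d j holomorphic_on UNIV"
    and nz: "\<exists>j\<le>M. \<exists>z. d j z \<noteq> 0"
    and orth: "\<And>\<xi> n. 0 < \<xi> \<Longrightarrow> \<xi> < \<eta> \<Longrightarrow> (\<Sum>j\<le>M. d j (of_real \<xi>) * kap (\<xi> + real j - \<beta> * real_of_int n)) = 0"
    using orthogonal_fibres[OF \<beta>1] by (elim exE conjE) blast
  define D where "D j x = indicator {0<..<\<eta>} x * d j (of_real x)" for j and x :: real
  have d_cont: "continuous_on UNIV (\<lambda>x::real. d j (of_real x))" for j
    by (rule continuous_on_compose2[OF holomorphic_on_imp_continuous_on[OF hol[of j]]]) (auto intro: continuous_intros)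
  have D_meas: "D j \<in> borel_measurable borel" for j
    unfolding D_def using d_cont[of j] by (intro borel_measurable_times borel_measurable_indicator borel_measurable_continuous_onI) auto
  have D_sq: "square_integrable (D j)" for j
  proof -
    have "compact ((\<lambda>x::real. d j (of_real x)) ` {0..1})"
      using d_cont by (intro compact_continuous_image continuous_on_subset[OF d_cont]) auto
    then obtain B where B: "\<And>x. x \<in> {0..1::real} \<Longrightarrow> norm (d j (of_real x)) \<le> B"
      using compact_imp_bounded bounded_iff by (metis imageI)
    have "integrable lborel (\<lambda>x. (norm (D j x))\<^sup>2)"
    proof (rule Bochner_Integration.integrable_bound)
      show "integrable lborel (\<lambda>x. B\<^sup>2 * indicator {0..1::real} x)" by simp
      show "(\<lambda>x. (norm (D j x))\<^sup>2) \<in> borel_measurable lborel" using D_meas[of j] by simp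
      show "AE x in lborel. norm ((norm (D j x))\<^sup>2) \<le> norm (B\<^sup>2 * indicator {0..1} x)"
        using B \<eta> by (intro AE_I2) (auto simp: D_def indicator_def norm_mult intro!: power_mono)
    qed
    then show ?thesis using D_meas by (simp add: square_integrable_def)
  qed
  have shift_sq: "square_integrable (\<lambda>x. f (x - c))" if f: "square_integrable f" for f and c :: real
  proof -
    have "integrable lborel (\<lambda>x. (norm (f x))\<^sup>2) \<Longrightarrow> integrable lborel (\<lambda>x. (norm (f (- c + 1 * x)))\<^sup>2)"
      by (rule lborel_integrable_real_affine) auto
    then show ?thesis using f square_integrable_measurable[OF f] by (simp add: square_integrable_def)
  qed
  define h where "h x = (\<Sum>j\<le>M. D j (x - real j))" for x
  have h_sq: "square_integrable h"
    unfolding h_def[abs_def] by (intro square_integrable_sum shift_sq D_sq)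
  define A where "A = {f. square_integrable f \<and> (\<integral>x. f x * h x \<partial>lborel) = 0}"
  have "kap_atom i \<in> A" for i
  proof (cases i)
    case (Pair m n)
    have sq: "square_integrable (kap_atom (m, n))" by (intro tame_square_integrable tame_kap_atom)
    have int: "integrable lborel (\<lambda>x. kap_atom (m, n) x * D j (x - real j))" for j
      by (intro square_integrable_product sq shift_sq D_sq)
    have eq: "kap_atom (m, n) (\<xi> + real j) = cis (2 * pi * - real_of_int m * (\<xi> - \<beta> * n)) * kap (\<xi> + real j - \<beta> * n)" for \<xi> j
    proof -
      have "cis (2 * pi * - real_of_int m * (\<xi> + real j - \<beta> * n))
          = cis (2 * pi * - real_of_int m * (\<xi> - \<beta> * n)) * cis (2 * pi * of_int (- m * int j))"
        by (simp add: cis_mult algebra_simps)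
      \<comment> \<open>The phase depends on \<xi> only, because m j is an integer; hence it factors
        out of the fibre sum.\<close>
      also have "cis (2 * pi * of_int (- m * int j)) = 1" by (rule cis_multiple_2pi) simp
      finally show ?thesis by (simp add: kap_atom_def)
    qed
    have int': "integrable lborel (\<lambda>\<xi>. kap_atom (m, n) (\<xi> + real j) * D j \<xi>)" for j
      using lborel_integrable_real_affine[OF int, of 1 "real j" j] by (simp add: add.commute)
    have "(\<integral>x. kap_atom (m, n) x * h x \<partial>lborel) = (\<Sum>j\<le>M. \<integral>x. kap_atom (m, n) x * D j (x - real j) \<partial>lborel)"
      unfolding h_def sum_distrib_left using int by (rule Bochner_Integration.integral_sum)
    also have "\<dots> = (\<Sum>j\<le>M. \<integral>\<xi>. kap_atom (m, n) (\<xi> + real j) * D j \<xi> \<partial>lborel)"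
    proof (intro sum.cong refl)
      fix j
      show "(\<integral>x. kap_atom (m, n) x * D j (x - real j) \<partial>lborel) = (\<integral>\<xi>. kap_atom (m, n) (\<xi> + real j) * D j \<xi> \<partial>lborel)"
        by (subst lborel_integral_real_affine[where c = 1 and t = "real j"]) (auto simp: add.commute)
    qed
    also have "\<dots> = (\<integral>\<xi>. (\<Sum>j\<le>M. kap_atom (m, n) (\<xi> + real j) * D j \<xi>) \<partial>lborel)"
      using int' by (rule Bochner_Integration.integral_sum[symmetric])
    also have "(\<lambda>\<xi>. \<Sum>j\<le>M. kap_atom (m, n) (\<xi> + real j) * D j \<xi>) = (\<lambda>\<xi>. 0)"
    proof
      fix \<xi>
      have "(\<Sum>j\<le>M. kap_atom (m, n) (\<xi> + real j) * D j \<xi>) = indicator {0<..<\<eta>} \<xi> *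
          cis (2 * pi * - real_of_int m * (\<xi> - \<beta> * n)) * (\<Sum>j\<le>M. d j (of_real \<xi>) * kap (\<xi> + real j - \<beta> * real_of_int n))"
        unfolding sum_distrib_left eq D_def by (intro sum.cong refl) (simp add: mult_ac)
      also have "\<dots> = 0" using orth[of \<xi> n] by (simp add: indicator_def)
      finally show "(\<Sum>j\<le>M. kap_atom (m, n) (\<xi> + real j) * D j \<xi>) = 0" .
    qed
    finally show ?thesis using sq by (simp add: A_def Pair)
  qed
  then have "V \<subseteq> A"
    unfolding V_def A_def by (intro span_closure_minimal closed_subspace_annihilator h_sq)
  then have test0: "(\<integral>x. test_pre b x * h x \<partial>lborel) = 0" for b using test by (auto simp: A_def)
  \<comment> \<open>Absorbs the exponential of \<open>test_pre b\<close>, whose b-dependence is then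
    a constant factor and the half-line x > b.\<close>
  define G where "G x = exp (- (2 * of_real pi * of_real x)) * h x" for x :: real
  have half: "integrable lborel (\<lambda>x. indicator {b<..} x * G x)" "(\<integral>x. indicator {b<..} x * G x \<partial>lborel) = 0" for b
  proof -
    define C where "C = - 2 * of_real pi * \<i> * exp (2 * of_real pi * complex_of_real b)"
    have C: "C \<noteq> 0" by (simp add: C_def)
    have eq: "indicator {b<..} x * G x = inverse C * (test_pre b x * h x)" for x
    proof -
      have "exp (2 * of_real pi * (- 1) * complex_of_real (x - b))
          = exp (2 * of_real pi * complex_of_real b) * exp (- (2 * of_real pi * of_real x))"
        by (simp add: exp_add[symmetric] algebra_simps)
      then have "test_pre b x = indicator {b<..} x * (C * exp (- (2 * of_real pi * of_real x)))"
        by (simp add: test_pre_def cauchy_pre_def C_def indicator_def)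
      then show ?thesis using C by (simp add: G_def)
    qed
    show "integrable lborel (\<lambda>x. indicator {b<..} x * G x)"
      unfolding eq by (intro integrable_mult_right square_integrable_product h_sq tame_square_integrable tame_test_pre)
    show "(\<integral>x. indicator {b<..} x * G x \<partial>lborel) = 0"
      unfolding eq by (simp add: test0)
  qed
  have zero: "(\<integral>x. indicator {b<..c} x * G x \<partial>lborel) = 0" if "b \<le> c" for b c
  proof -
    have "(\<lambda>x. indicator {b<..c} x * G x) = (\<lambda>x. indicator {b<..} x * G x - indicator {c<..} x * G x)"
      using that by (auto simp: fun_eq_iff indicator_def)
    then show ?thesis using half by simp
  qed
  obtain j1 z1 where j1: "j1 \<le> M" "d j1 z1 \<noteq> 0" using nz by auto
  have "\<exists>\<xi>. 0 < \<xi> \<and> \<xi> < \<eta> \<and> d j1 (of_real \<xi>) \<noteq> 0"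
  proof (rule ccontr)
    assume "\<not> ?thesis"
    then have "{0<..<\<eta>} \<subseteq> {x::real. of_real x \<in> {z. d j1 z = 0}}" by auto
    moreover have "countable {x::real. complex_of_real x \<in> {z. d j1 z = 0}}"
      using entire_countable_zeros[OF hol j1(2)] by (rule countable_image_inj) (simp add: inj_of_real)
    ultimately have "countable {0<..<\<eta>}" by (rule countable_subset)
    then show False using uncountable_open_interval[of 0 \<eta>] \<eta>(1) by simp
  qed
  then obtain \<xi>1 where \<xi>1: "0 < \<xi>1" "\<xi>1 < \<eta>" "d j1 (of_real \<xi>1) \<noteq> 0" by auto
  \<comment> \<open>The continuous function that agrees with G on the piece belonging to j1; the
    pieces of h are disjoint since \<eta> \<le> 1.\<close>
  define G1 where "G1 x = exp (- (2 * of_real pi * of_real x)) * d j1 (of_real (x - real j1))" for x :: real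
  define x1 where "x1 = \<xi>1 + real j1"
  have G1: "G x = G1 x" if "real j1 < x" "x < real j1 + \<eta>" for x
  proof -
    have "D j (x - real j) = (if j = j1 then d j1 (of_real (x - real j1)) else 0)" for j
    proof -
      consider "j = j1" | "real j + 1 \<le> real j1" | "real j1 + 1 \<le> real j" by linarith
      then show ?thesis
      proof cases
        case 1
        then show ?thesis using that by (simp add: D_def)
      next
        case 2
        then show ?thesis using that \<eta> by (auto simp: D_def indicator_def)
      next
        case 3
        then show ?thesis using that \<eta> by (auto simp: D_def indicator_def)
      qed
    qed
    then have "h x = d j1 (of_real (x - real j1))" unfolding h_def using j1(1) by simp
    then show ?thesis by (simp add: G_def G1_def)
  qed
  have "continuous_on UNIV G1"
    unfolding G1_def by (intro continuous_intros continuous_on_compose2[OF d_cont[of j1], of _ "\<lambda>x. x - real j1"]) auto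
  then have "isCont G1 x1" by (simp add: continuous_on_eq_continuous_at)
  moreover have c: "G1 x1 \<noteq> 0" using \<xi>1(3) by (simp add: G1_def x1_def)
  ultimately obtain \<delta> where \<delta>: "0 < \<delta>" "\<And>x. dist x x1 < \<delta> \<Longrightarrow> dist (G1 x) (G1 x1) < norm (G1 x1) / 2"
    unfolding continuous_at_eps_delta by (metis half_gt_zero zero_less_norm_iff)
  define r where "r = min (\<delta> / 2) ((\<eta> - \<xi>1) / 2)"
  have r: "0 < r" "r < \<delta>" "\<xi>1 + r < \<eta>" using \<delta>(1) \<xi>1 by (auto simp: r_def min_def field_simps)
  have near: "norm (G x - G1 x1) \<le> norm (G1 x1) / 2" if "x1 < x" "x \<le> x1 + r" for x
    using \<delta>(2)[of x] G1[of x] that r \<xi>1 by (simp add: dist_norm x1_def)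
  have int1: "integrable lborel (\<lambda>x. indicator {x1<..x1 + r} x * G x)"
  proof -
    have "(\<lambda>x. indicator {x1<..x1 + r} x * G x) = (\<lambda>x. indicator {x1<..} x * G x - indicator {x1 + r<..} x * G x)"
      using r by (auto simp: fun_eq_iff indicator_def)
    then show ?thesis using half by simp
  qed
  have scaleR: "indicator {x1<..x1 + r} x * G1 x1 = indicator {x1<..x1 + r} x *\<^sub>R G1 x1" for x
    by (simp add: indicator_def)
  have ind: "integrable lborel (\<lambda>x. indicator {x1<..x1 + r} x * G1 x1)"
    unfolding scaleR using r by (intro integrable_scaleR_left) (simp add: integrable_indicator_iff)
  have "(\<integral>x. indicator {x1<..x1 + r} x * G1 x1 \<partial>lborel) = of_real r * G1 x1"
    unfolding scaleR using r by (simp add: scaleR_conv_of_real)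
  moreover have "(\<integral>x. indicator {x1<..x1 + r} x * (G x - G1 x1) \<partial>lborel) = - (\<integral>x. indicator {x1<..x1 + r} x * G1 x1 \<partial>lborel)"
    using int1 ind zero[of x1 "x1 + r"] r by (simp add: right_diff_distrib)
  ultimately have "norm (of_real r * G1 x1) = norm (\<integral>x. indicator {x1<..x1 + r} x * (G x - G1 x1) \<partial>lborel)"
    by (metis norm_minus_cancel)
  \<comment> \<open>G has mean 0 on the interval yet stays within half of |G1 x1| from G1 x1, which
    is contradictory.\<close>
  also have "\<dots> \<le> (\<integral>x. indicator {x1<..x1 + r} x * (norm (G1 x1) / 2) \<partial>lborel)"
  proof (rule Bochner_Integration.integral_norm_bound_integral)
    show "integrable lborel (\<lambda>x. indicator {x1<..x1 + r} x * (G x - G1 x1))"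
      unfolding right_diff_distrib using int1 ind by (rule Bochner_Integration.integrable_diff)
    show "integrable lborel (\<lambda>x. indicator {x1<..x1 + r} x * (norm (G1 x1) / 2))"
      using r by (intro integrable_mult_left) (simp add: integrable_indicator_iff)
    show "norm (indicator {x1<..x1 + r} x * (G x - G1 x1)) \<le> indicator {x1<..x1 + r} x * (norm (G1 x1) / 2)" for x
      using near[of x] by (auto simp: indicator_def)
  qed
  also have "\<dots> = r * (norm (G1 x1) / 2)"
    using r by (simp add: integral_mult_left_zero)
  finally show False using r c by (simp add: norm_mult)
qed

lemma complete_iff: "gabor_complete g 1 \<beta> \<longleftrightarrow> \<beta> \<le> 1"
  using complete_if not_complete_if by (meson not_less)

end

section \<open>Reduction to \<alpha> = 1\<close>

lemma gabor_complete_dilate: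
  assumes s: "0 < s" and g: "g \<in> borel_measurable borel" and complete: "gabor_complete g \<alpha> \<beta>"
  shows "gabor_complete (\<lambda>x. g (s * x)) (\<alpha> / s) (\<beta> * s)"
  unfolding gabor_complete_def
proof (intro allI impI)
  fix f and e :: real assume f: "square_integrable f" and e: "0 < e"
  note [measurable] = square_integrable_measurable[OF f] g
  \<comment> \<open>Stretching by s multiplies energies by s, so f' is approximated within s
    e.\<close>
  define f' where "f' x = f (x / s)" for x
  have [measurable]: "f' \<in> borel_measurable borel" unfolding f'_def by measurable
  have "integrable lborel (\<lambda>x. (norm (f x))\<^sup>2) \<Longrightarrow> integrable lborel (\<lambda>x. (norm (f (0 + (1 / s) * x)))\<^sup>2)"
    using s by (intro lborel_integrable_real_affine) auto
  then have "square_integrable f'"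
    using f unfolding f'_def square_integrable_def by simp
  moreover have "0 < s * e" using s e by simp
  ultimately obtain S c where S: "finite S" and
    less: "(\<integral>\<^sup>+ x. ennreal ((norm (f' x - (\<Sum>(m,n)\<in>S. c (m,n) * gabor_atom g \<alpha> \<beta> m n x)))\<^sup>2) \<partial>lborel) < ennreal (s * e)"
    using complete unfolding gabor_complete_def by blast
  have atom: "gabor_atom (\<lambda>x. g (s * x)) (\<alpha> / s) (\<beta> * s) m n y = gabor_atom g \<alpha> \<beta> m n (0 + s * y)" for m n y
    unfolding gabor_atom_def using s by (simp add: right_diff_distrib mult_ac)
  have [measurable]: "gabor_atom g \<alpha> \<beta> m n \<in> borel_measurable borel" for m n
    unfolding gabor_atom_def[abs_def] by measurable
  define X where "X = (\<integral>\<^sup>+ x. ennreal ((norm (f x - (\<Sum>(m,n)\<in>S. c (m,n) *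
      gabor_atom (\<lambda>x. g (s * x)) (\<alpha> / s) (\<beta> * s) m n x)))\<^sup>2) \<partial>lborel)"
  have "(\<integral>\<^sup>+ x. ennreal ((norm (f' x - (\<Sum>(m,n)\<in>S. c (m,n) * gabor_atom g \<alpha> \<beta> m n x)))\<^sup>2) \<partial>lborel)
      = ennreal s * (\<integral>\<^sup>+ x. ennreal ((norm (f' (0 + s * x) - (\<Sum>(m,n)\<in>S. c (m,n) * gabor_atom g \<alpha> \<beta> m n (0 + s * x))))\<^sup>2) \<partial>lborel)"
    using s by (subst nn_integral_real_affine[where c = s and t = 0]) auto
  also have "\<dots> = ennreal s * X"
    unfolding X_def atom f'_def using s by simp
  finally have "ennreal s * X < ennreal s * ennreal e"
    using less s e by (simp add: ennreal_mult)
  then have "X < ennreal e" by (meson mult_left_mono not_less zero_le)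
  then show "\<exists>S c. finite S \<and> (\<integral>\<^sup>+ x. ennreal ((norm (f x - (\<Sum>(m,n)\<in>S. c (m,n) *
      gabor_atom (\<lambda>x. g (s * x)) (\<alpha> / s) (\<beta> * s) m n x)))\<^sup>2) \<partial>lborel) < ennreal e"
    using S unfolding X_def by blast
qed

theorem theorem1p9:
  fixes N :: nat and a w :: "nat \<Rightarrow> complex" and \<alpha> \<beta> :: real
  assumes "N \<ge> 1"
    and "\<forall>k\<in>{1..N}. a k \<noteq> 0"
    and "\<forall>k\<in>{1..N}. Re (w k) \<noteq> 0"
    and "\<forall>k\<in>{1..N}. \<forall>l\<in>{1..N}. k \<noteq> l \<longrightarrow> Re (w k) \<noteq> Re (w l)"
    and "\<alpha> > 0" and "\<beta> > 0"
  shows "gabor_complete (\<lambda>x. \<Sum>k=1..N. a k / (complex_of_real x - \<i> * w k)) \<alpha> \<beta> \<longleftrightarrow> \<alpha> * \<beta> \<le> 1"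
proof -
  define G where "G x = (\<Sum>k=1..N. a k / (complex_of_real x - \<i> * w k))" for x
  have G_meas: "G \<in> borel_measurable borel" unfolding G_def[abs_def] by measurable
  \<comment> \<open>Dividing numerator and denominator of a / (\<alpha> x - \<i> w) by \<alpha>
    keeps the form of the window: both parameters are divided by \<alpha>.\<close>
  interpret cauchy_sum "{1..N}" "\<lambda>k. a k / of_real \<alpha>" "\<lambda>k. w k / of_real \<alpha>" "\<beta> * \<alpha>"
    by unfold_locales (use assms in \<open>auto simp: inj_on_def Re_divide_of_real\<close>)
  have dilated: "(\<lambda>x. G (\<alpha> * x)) = g"
  proof
    fix x
    have "a k / (of_real (\<alpha> * x) - \<i> * w k) = a k / of_real \<alpha> / (of_real x - \<i> * (w k / of_real \<alpha>))" for k
    proof -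
      have "of_real (\<alpha> * x) - \<i> * w k = of_real \<alpha> * (of_real x - \<i> * (w k / of_real \<alpha>))"
        using assms(5) by (simp add: right_diff_distrib)
      then show ?thesis by simp
    qed
    then show "G (\<alpha> * x) = g x" by (simp only: G_def g_def)
  qed
  have "gabor_complete G \<alpha> \<beta> \<longleftrightarrow> gabor_complete g 1 (\<beta> * \<alpha>)"
  proof
    assume "gabor_complete G \<alpha> \<beta>"
    from gabor_complete_dilate[OF assms(5) G_meas this]
    show "gabor_complete g 1 (\<beta> * \<alpha>)" using assms(5) by (simp add: dilated)
  next
    assume *: "gabor_complete g 1 (\<beta> * \<alpha>)"
    have "g \<in> borel_measurable borel" unfolding dilated[symmetric] using G_meas by measurable
    from gabor_complete_dilate[OF _ this *, of "1 / \<alpha>"]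
    have "gabor_complete (\<lambda>x. g (1 / \<alpha> * x)) \<alpha> \<beta>" using assms(5) by simp
    moreover have "(\<lambda>x. g (1 / \<alpha> * x)) = G" unfolding dilated[symmetric] using assms(5) by simp
    ultimately show "gabor_complete G \<alpha> \<beta>" by simp
  qed
  then show ?thesis unfolding G_def[abs_def] complete_iff by (simp add: mult.commute)
qed

end
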